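(* Assume that the market risk premium is $\hat{\varrho}$ and that an investor decides his/her strategy by a misspecified risk premium $\varrho$, and let $X^\varrho_T$ be the resulting terminal wealth. Regard $\mathrm{Var}[X_T^\varrho]$ as a function of $\varrho$. Then there exists $k^*\in(\tfrac12,1)$ such that the terminal variance $\mathrm{Var}[X_T^\varrho]$ attains a unique global minimum at $\varrho=k^*\hat{\varrho}$.
   Context: Fix $T>0$, $d\ge1$, an exploration intensity $c>0$, initial wealth $x_0\in\mathbb{R}$, a target $l\in\mathbb{R}$ for the expected terminal wealth, and a constant invertible volatility matrix $\sigma\in\mathbb{R}^{d\times d}$; a prime denotes transpose. Risk premia ($\hat\varrho$ and $\varrho$) are constant vectors in $\mathbb{R}^d$, by convention with all components positive. Under the true risk premium $\hat\varrho$ and a distributional (exploratory) control with density $\pi_t$ on $\mathbb{R}^d$, the discounted wealth $X$ (real valued, driven by a one-dimensional Brownian motion $W$) satisfies $X_0=x_0$ and $$dX_t=\Big(\int_{\mathbb{R}^d}\hat\varrho'\sigma v\,\pi_t(v)\,dv\Big)dt+\sqrt{\int_{\mathbb{R}^d}v'\sigma'\sigma v\,\pi_t(v)\,dv}\;dW_t,\qquad t\in[0,T].$$ An investor who selects the risk premium $\varrho$ uses the feedback control distribution which at time $t$ and wealth $x$ is the Gaussian law $$\mathcal{N}\Big(-\sigma^{-1}\varrho\,(x-\omega),\ \tfrac{c}{2}e^{\varrho'\varrho(T-t)}(\sigma'\sigma)^{-1}\Big),$$ so that the wealth process $X^\varrho$ satisfies $X_0^\varrho=x_0$ and $$dX_t^\varrho=-\varrho'\hat\varrho\,(X_t^\varrho-\omega)\,dt+\sqrt{(X_t^\varrho-\omega)^2\varrho'\varrho+\tfrac{cd}{2}e^{\varrho'\varrho(T-t)}}\;dW_t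 .$$ Here $\omega$ is the optimal Lagrange multiplier (depending on $\varrho$), for which $\mathbb{E}[X_T^\varrho]=l$, i.e. $\omega=\dfrac{l\,e^{\varrho'\hat\varrho T}-x_0}{e^{\varrho'\hat\varrho T}-1}$.
   Formalization: The formal theorem adds the hypothesis that the target l differs from the initial wealth x₀; when l = x₀ the terminal variance has its unique minimum at ½ϱ̂, so k* = ½ lies outside (½,1) and the statement fails. *)

theory Defs
  imports "HOL-Probability.Probability"
begin

section \<open>Stochastic integration on a Brownian basis\<close>

definition continuous_adapted ::
    "'w measure \<Rightarrow> (real \<Rightarrow> 'w measure) \<Rightarrow> real \<Rightarrow> (real \<Rightarrow> 'w \<Rightarrow> real) \<Rightarrow> bool" where
  "continuous_adapted M F T X \<longleftrightarrow>
     (\<forall>t\<in>{0..T}. X t \<in> borel_measurable (F t)) \<and>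
     (\<forall>\<omega>\<in>space M. continuous_on {0..T} (\<lambda>t. X t \<omega>))"

text \<open>The filtration is indexed by all reals only in order to reuse the library locale; everything
  else refers to times in the horizon \<open>[0, T]\<close>.\<close>

locale brownian_basis = prob_space M + filtration "space M" F
  for M :: "'w measure" and F :: "real \<Rightarrow> 'w measure" +
  fixes T :: real and W :: "real \<Rightarrow> 'w \<Rightarrow> real"
  assumes filtration_subalgebra: "subalgebra M (F t)"
    and W_continuous_adapted: "continuous_adapted M F T W"
    and W_zero: "AE \<omega> in M. W 0 \<omega> = 0"
    and W_increment: "0 \<le> s \<Longrightarrow> s < t \<Longrightarrow> t \<le> T \<Longrightarrow>
      distributed M lborel (\<lambda>\<omega>. W t \<omega> - W s \<omega>) (normal_density 0 (sqrt (t - s)))"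
    and W_independent: "0 \<le> s \<Longrightarrow> s < t \<Longrightarrow> t \<le> T \<Longrightarrow>
      indep_set (sets (F s)) (sets (vimage_algebra (space M) (\<lambda>\<omega>. W t \<omega> - W s \<omega>) borel))"

definition progressive ::
    "(real \<Rightarrow> 'w measure) \<Rightarrow> real \<Rightarrow> (real \<Rightarrow> 'w \<Rightarrow> real) \<Rightarrow> bool" where
  "progressive F T H \<longleftrightarrow>
     (\<forall>t\<in>{0..T}. (\<lambda>(s, \<omega>). H s \<omega>) \<in> borel_measurable (restrict_space borel {0..t} \<Otimes>\<^sub>M F t))"

text \<open>An elementary process takes the bounded value \<open>\<xi> i\<close>, known at time \<open>\<tau> i\<close>, on the interval
  \<open>(\<tau> i, \<tau> (i + 1)]\<close>, where \<open>0 = \<tau> 0 < \<dots> < \<tau> n = T\<close>.\<close>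

definition elementary ::
    "'w measure \<Rightarrow> (real \<Rightarrow> 'w measure) \<Rightarrow> real \<Rightarrow>
     nat \<Rightarrow> (nat \<Rightarrow> real) \<Rightarrow> (nat \<Rightarrow> 'w \<Rightarrow> real) \<Rightarrow> bool" where
  "elementary M F T n \<tau> \<xi> \<longleftrightarrow>
     \<tau> 0 = 0 \<and> \<tau> n = T \<and> (\<forall>i<n. \<tau> i < \<tau> (Suc i)) \<and>
     (\<forall>i<n. \<xi> i \<in> borel_measurable (F (\<tau> i)) \<and> (\<exists>K. \<forall>\<omega>\<in>space M. \<bar>\<xi> i \<omega>\<bar> \<le> K))"

definition elementary_process ::
    "nat \<Rightarrow> (nat \<Rightarrow> real) \<Rightarrow> (nat \<Rightarrow> 'w \<Rightarrow> real) \<Rightarrow> real \<Rightarrow> 'w \<Rightarrow> real" where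
  "elementary_process n \<tau> \<xi> t \<omega> = (\<Sum>i<n. \<xi> i \<omega> * indicator {\<tau> i<..\<tau> (Suc i)} t)"

definition elementary_integral ::
    "(real \<Rightarrow> 'w \<Rightarrow> real) \<Rightarrow> nat \<Rightarrow> (nat \<Rightarrow> real) \<Rightarrow> (nat \<Rightarrow> 'w \<Rightarrow> real) \<Rightarrow> real \<Rightarrow> 'w \<Rightarrow> real" where
  "elementary_integral W n \<tau> \<xi> t \<omega> =
     (\<Sum>i<n. \<xi> i \<omega> * (W (min t (\<tau> (Suc i))) \<omega> - W (min t (\<tau> i)) \<omega>))"

text \<open>The Ito integral of a progressive integrand in \<open>L\<^sup>2\<close>: the continuous version of the
  \<open>L\<^sup>2\<close> limit of elementary integrals. It is determined only up to null sets, hence a relation.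
  Convergence of elementary (bounded) processes to \<open>H\<close> in \<open>L\<^sup>2\<close> of the product measure
  entails that \<open>H\<close> itself is square integrable.\<close>

definition has_ito_integral ::
    "'w measure \<Rightarrow> (real \<Rightarrow> 'w measure) \<Rightarrow> real \<Rightarrow> (real \<Rightarrow> 'w \<Rightarrow> real) \<Rightarrow>
     (real \<Rightarrow> 'w \<Rightarrow> real) \<Rightarrow> (real \<Rightarrow> 'w \<Rightarrow> real) \<Rightarrow> bool" where
  "has_ito_integral M F T W H I \<longleftrightarrow>
     progressive F T H \<and> continuous_adapted M F T I \<and>
     (\<exists>n \<tau> \<xi>.
        (\<forall>k. elementary M F T (n k) (\<tau> k) (\<xi> k)) \<and>
        (\<lambda>k. \<integral>\<^sup>+\<omega>. (\<integral>\<^sup>+s\<in>{0..T}.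
              ennreal ((H s \<omega> - elementary_process (n k) (\<tau> k) (\<xi> k) s \<omega>)\<^sup>2) \<partial>lborel) \<partial>M)
          \<longlonglongrightarrow> 0 \<and>
        (\<forall>t\<in>{0..T}.
           (\<lambda>k. \<integral>\<^sup>+\<omega>.
              ennreal ((I t \<omega> - elementary_integral W (n k) (\<tau> k) (\<xi> k) t \<omega>)\<^sup>2) \<partial>M)
             \<longlonglongrightarrow> 0))"

definition sde_solution ::
    "'w measure \<Rightarrow> (real \<Rightarrow> 'w measure) \<Rightarrow> real \<Rightarrow> (real \<Rightarrow> 'w \<Rightarrow> real) \<Rightarrow> real \<Rightarrow>
     (real \<Rightarrow> real \<Rightarrow> real) \<Rightarrow> (real \<Rightarrow> real \<Rightarrow> real) \<Rightarrow> (real \<Rightarrow> 'w \<Rightarrow> real) \<Rightarrow> bool" where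
  "sde_solution M F T W x\<^sub>0 drift diffusion X \<longleftrightarrow>
     continuous_adapted M F T X \<and>
     (AE \<omega> in M. set_integrable lborel {0..T} (\<lambda>s. drift s (X s \<omega>))) \<and>
     (\<exists>I. has_ito_integral M F T W (\<lambda>s \<omega>. diffusion s (X s \<omega>)) I \<and>
        (\<forall>t\<in>{0..T}. AE \<omega> in M.
           X t \<omega> = x\<^sub>0 + set_lebesgue_integral lborel {0..t} (\<lambda>s. drift s (X s \<omega>)) + I t \<omega>))"

section \<open>Exploratory wealth dynamics\<close>

definition exploratory_drift ::
    "real ^ 'd \<Rightarrow> real ^ 'd ^ 'd \<Rightarrow> (real ^ 'd \<Rightarrow> real) \<Rightarrow> real" where
  "exploratory_drift \<rho> \<sigma> p = (\<integral>v. (\<rho> \<bullet> (\<sigma> *v v)) * p v \<partial>lborel)"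

definition exploratory_diffusion ::
    "real ^ 'd ^ 'd \<Rightarrow> (real ^ 'd \<Rightarrow> real) \<Rightarrow> real" where
  "exploratory_diffusion \<sigma> p =
     sqrt (\<integral>v. (v \<bullet> ((transpose \<sigma> ** \<sigma>) *v v)) * p v \<partial>lborel)"

definition gaussian_density :: "real ^ 'd \<Rightarrow> real ^ 'd ^ 'd \<Rightarrow> real ^ 'd \<Rightarrow> real" where
  "gaussian_density m S v =
     exp (- ((v - m) \<bullet> (matrix_inv S *v (v - m))) / 2) / sqrt ((2 * pi) ^ CARD('d) * det S)"

text \<open>The unique \<open>w\<close> for which the wealth with drift \<open>- (\<rho> \<bullet> \<rho>_true) * (x - w)\<close> has expectation
  \<open>l\<close> at time \<open>T\<close>.\<close>

definition lagrange_multiplier ::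
    "real \<Rightarrow> real \<Rightarrow> real \<Rightarrow> real ^ 'd \<Rightarrow> real ^ 'd \<Rightarrow> real" where
  "lagrange_multiplier T x\<^sub>0 l \<rho>_true \<rho> =
     (l * exp ((\<rho> \<bullet> \<rho>_true) * T) - x\<^sub>0) / (exp ((\<rho> \<bullet> \<rho>_true) * T) - 1)"

definition feedback_control ::
    "real \<Rightarrow> real \<Rightarrow> real ^ 'd ^ 'd \<Rightarrow> real ^ 'd \<Rightarrow> real \<Rightarrow> real \<Rightarrow> real \<Rightarrow> real ^ 'd \<Rightarrow> real" where
  "feedback_control T c \<sigma> \<rho> w t x =
     gaussian_density (- ((x - w) *\<^sub>R (matrix_inv \<sigma> *v \<rho>)))
       ((c / 2 * exp ((\<rho> \<bullet> \<rho>) * (T - t))) *\<^sub>R matrix_inv (transpose \<sigma> ** \<sigma>))"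

text \<open>Wealth of an investor who selects the risk premium \<open>\<rho>\<close> while the true one is
  \<open>\<rho>_true\<close>: the selected premium enters through the control, the true one through the
  drift of the wealth and through the constraint that pins down the multiplier.\<close>

definition wealth_process ::
    "'w measure \<Rightarrow> (real \<Rightarrow> 'w measure) \<Rightarrow> real \<Rightarrow> (real \<Rightarrow> 'w \<Rightarrow> real) \<Rightarrow>
     real \<Rightarrow> real \<Rightarrow> real \<Rightarrow> real ^ 'd ^ 'd \<Rightarrow> real ^ 'd \<Rightarrow> real ^ 'd \<Rightarrow>
     (real \<Rightarrow> 'w \<Rightarrow> real) \<Rightarrow> bool" where
  "wealth_process M F T W c x\<^sub>0 l \<sigma> \<rho>_true \<rho> X \<longleftrightarrow>
     (let \<pi> = feedback_control T c \<sigma> \<rho> (lagrange_multiplier T x\<^sub>0 l \<rho>_true \<rho>) in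
      sde_solution M F T W x\<^sub>0
        (\<lambda>t x. exploratory_drift \<rho>_true \<sigma> (\<pi> t x))
        (\<lambda>t x. exploratory_diffusion \<sigma> (\<pi> t x)) X)"

definition risk_premium :: "real ^ 'd \<Rightarrow> bool" where
  "risk_premium \<rho> \<longleftrightarrow> (\<forall>i. 0 < \<rho> $ i)"

end

theory Submission
  imports Defs
begin

text \<open>
  Write \<open>a = \<rho> \<bullet> \<rho>_true\<close> and \<open>b = \<rho> \<bullet> \<rho>\<close>, and let \<open>w\<close> be the Lagrange multiplier. Averaging
  the drift and the squared diffusion over the Gaussian control shows that \<open>Y = X - w\<close> has drift
  \<open>- a Y\<close> and squared diffusion \<open>b Y\<^sup>2 + (c d / 2) exp (b (T - t))\<close>. Its first two moments therefore
  satisfy closed linear integral equations (\<open>linear_sde_moments\<close>), and solving them gives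
  (\<open>terminal_variance\<close>)

    \<open>Var X\<^sub>T = (l - x\<^sub>0)\<^sup>2 (exp (b T) - 1) / (exp (a T) - 1)\<^sup>2
      + (c d / 2) \<integral>\<^sub>0\<^sup>T exp (2 (b - a) (T - s)) ds\<close>.

  For fixed \<open>a\<close> this is strictly increasing in \<open>b\<close>, and among all \<open>\<rho>\<close> with the same \<open>a\<close> the squared
  norm \<open>b\<close> is smallest exactly at the multiple of \<open>\<rho>_true\<close>, the orthogonal projection of \<open>\<rho>\<close>. So only
  the ray \<open>\<rho> = k \<rho>_true\<close> with \<open>k > 0\<close> matters. There the first term is a positive multiple of

    \<open>(exp (k\<^sup>2 B) - 1) / (exp (k B) - 1)\<^sup>2\<close>  with  \<open>B = (\<rho>_true \<bullet> \<rho>_true) T\<close>,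

  which decreases up to \<open>k = 1\<close>, is stationary there and increases afterwards, while the second term
  is an increasing convex function of \<open>k\<^sup>2 - k\<close> and hence smallest at \<open>k = 1/2\<close>. All minimisers thus
  lie in \<open>[1/2, 1]\<close>. Both terms are convex on this interval, the second one strictly, so there is
  only one minimiser; and at either end point one term is stationary while the other one improves
  at a positive rate towards the interior, so it is an inner point (\<open>unique_minimizer_between\<close>). The
  convexity of the first term is the delicate part (\<open>excess_ratio_convex\<close>): it comes from convexity
  of its logarithm, which uses \<open>k \<ge> 1/2\<close> and reduces to an elementary bound on \<open>ln\<close>.

  The second moment is found without Ito's formula. The solution is \<open>Y\<^sub>t = Z\<^sub>t + I\<^sub>t\<close> with the stochastic
  integral \<open>I\<close> and the path-wise differentiable process \<open>Z\<^sub>t = Y\<^sub>0 - a \<integral>\<^sub>0\<^sup>t Y\<^sub>s ds\<close>. The ordinary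
  chain rule handles \<open>Z\<^sub>t\<^sup>2\<close>, the isometry handles \<open>I\<^sub>t\<^sup>2\<close>, and the mixed term \<open>E (Y\<^sub>t I\<^sub>t)\<close> satisfies an
  integral equation of its own because the increments of \<open>I\<close> are orthogonal to the past.
\<close>

section \<open>Linear changes of variables for Lebesgue measure\<close>

lemma Basis_vec_eq_range: "(Basis :: (real ^ 'n) set) = range (\<lambda>i. axis i 1)"
  by (auto simp: Basis_vec_def)

lemma inj_axis_1: "inj (\<lambda>i::'n::finite. axis i (1::real))"
  by (auto simp: inj_def axis_eq_axis)

lemma prod_Basis_vec:
  fixes g :: "real ^ 'n \<Rightarrow> 'a::comm_monoid_mult"
  shows "prod g Basis = (\<Prod>i\<in>UNIV. g (axis i 1))"
  unfolding Basis_vec_eq_range by (simp add: prod.reindex[OF inj_axis_1])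

lemma sum_Basis_vec:
  fixes g :: "real ^ 'n \<Rightarrow> 'a::comm_monoid_add"
  shows "sum g Basis = (\<Sum>i\<in>UNIV. g (axis i 1))"
  unfolding Basis_vec_eq_range by (simp add: sum.reindex[OF inj_axis_1])

text \<open>Integrating first in the coordinate along \<open>m\<close>, a shear is a translation of the line, because the
  coordinate along \<open>n\<close> is then constant.\<close>

lemma nn_integral_lborel_shear:
  fixes f :: "'a::euclidean_space \<Rightarrow> ennreal"
  assumes m: "m \<in> Basis" and n: "n \<in> Basis" and "m \<noteq> n"
    and [measurable]: "f \<in> borel_measurable borel"
  shows "(\<integral>\<^sup>+x. f (x + (c * (x \<bullet> n)) *\<^sub>R m) \<partial>lborel) = (\<integral>\<^sup>+x. f x \<partial>lborel)"
proof -
  interpret product_sigma_finite "\<lambda>_::'a. lborel :: real measure"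
    by standard
  define P where "P g = (\<Sum>b\<in>Basis. g b *\<^sub>R b)" for g :: "'a \<Rightarrow> real"
  have Pn: "P g \<bullet> n = g n" for g
    using n by (simp add: P_def)
  have Pupd: "P (g(m := y)) = P (g(m := 0)) + y *\<^sub>R m" for g y
  proof -
    have "P (g(m := y)) = y *\<^sub>R m + (\<Sum>b\<in>Basis - {m}. g b *\<^sub>R b)" for y
      using m by (simp add: P_def sum.remove)
    from this[of y] this[of 0] show ?thesis
      by simp
  qed
  have P[measurable]: "P \<in> borel_measurable (\<Pi>\<^sub>M b\<in>Basis. lborel)"
    unfolding P_def by measurable
  have eq: "(\<integral>\<^sup>+x. g x \<partial>lborel) =
      (\<integral>\<^sup>+x. (\<integral>\<^sup>+y. g (P (x(m := y))) \<partial>lborel) \<partial>(\<Pi>\<^sub>M b\<in>Basis - {m}. lborel))"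
    if [measurable]: "g \<in> borel_measurable borel" for g :: "'a \<Rightarrow> ennreal"
  proof -
    have "(\<integral>\<^sup>+x. g x \<partial>lborel) = (\<integral>\<^sup>+x. g (P x) \<partial>(\<Pi>\<^sub>M b\<in>Basis. lborel))"
      unfolding P_def by (subst lborel_eq) (simp add: nn_integral_distr)
    also have "\<dots> = (\<integral>\<^sup>+x. g (P x) \<partial>(\<Pi>\<^sub>M b\<in>insert m (Basis - {m}). lborel))"
      using m by (simp add: insert_absorb)
    also have "\<dots> =
      (\<integral>\<^sup>+x. (\<integral>\<^sup>+y. g (P (x(m := y))) \<partial>lborel) \<partial>(\<Pi>\<^sub>M b\<in>Basis - {m}. lborel))"
    proof (rule product_nn_integral_insert)
      have "(\<lambda>x. g (P x)) \<in> borel_measurable (\<Pi>\<^sub>M b\<in>Basis. lborel)"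
        by measurable
      then show "(\<lambda>x. g (P x)) \<in> borel_measurable (\<Pi>\<^sub>M b\<in>insert m (Basis - {m}). lborel)"
        using m by (simp add: insert_absorb)
    qed auto
    finally show ?thesis .
  qed
  have "(\<integral>\<^sup>+x. f (x + (c * (x \<bullet> n)) *\<^sub>R m) \<partial>lborel) =
      (\<integral>\<^sup>+x. (\<integral>\<^sup>+y. f (P (x(m := c * x n + 1 * y))) \<partial>lborel) \<partial>(\<Pi>\<^sub>M b\<in>Basis - {m}. lborel))"
  proof (subst eq, measurable, intro nn_integral_cong)
    fix x :: "'a \<Rightarrow> real" and y :: real
    have "P (x(m := y)) \<bullet> n = x n"
      using \<open>m \<noteq> n\<close> by (simp add: Pn)
    then have "P (x(m := y)) + (c * (P (x(m := y)) \<bullet> n)) *\<^sub>R m = P (x(m := c * x n + 1 * y))"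
      unfolding Pupd[of x y] Pupd[of x "c * x n + 1 * y"] by (simp add: Pn algebra_simps)
    then show "f (P (x(m := y)) + (c * (P (x(m := y)) \<bullet> n)) *\<^sub>R m) = f (P (x(m := c * x n + 1 * y)))"
      by simp
  qed
  also have "\<dots> = (\<integral>\<^sup>+x. (\<integral>\<^sup>+y. f (P (x(m := y))) \<partial>lborel) \<partial>(\<Pi>\<^sub>M b\<in>Basis - {m}. lborel))"
  proof (rule nn_integral_cong)
    fix x :: "'a \<Rightarrow> real"
    have [measurable]: "(\<lambda>y. P (x(m := y))) \<in> borel_measurable borel"
      by (subst Pupd) measurable
    show "(\<integral>\<^sup>+y. f (P (x(m := c * x n + 1 * y))) \<partial>lborel) = (\<integral>\<^sup>+y. f (P (x(m := y))) \<partial>lborel)"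
      by (subst nn_integral_real_affine[of "\<lambda>y. f (P (x(m := y)))" 1 "c * x n"]) auto
  qed
  also have "\<dots> = (\<integral>\<^sup>+x. f x \<partial>lborel)"
    by (rule eq[symmetric]) measurable
  finally show ?thesis .
qed

lemma nn_integral_lborel_swap:
  fixes f :: "real ^ 'n \<Rightarrow> ennreal"
  assumes [measurable]: "f \<in> borel_measurable borel"
  shows "(\<integral>\<^sup>+x. f (\<chi> i. x $ Transposition.transpose m n i) \<partial>lborel) = (\<integral>\<^sup>+x. f x \<partial>lborel)"
proof -
  define h :: "real ^ 'n \<Rightarrow> real ^ 'n" where "h x = (\<chi> i. x $ Transposition.transpose m n i)" for x
  have "linear h"
    by (intro linearI) (simp_all add: h_def vec_eq_iff)
  then have h[measurable]: "h \<in> borel_measurable borel"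
    by (intro borel_measurable_continuous_onI linear_continuous_on linear_linear[THEN iffD1])
      (simp add: linear_conv_bounded_linear)
  have hh: "h (h x) = x" for x
    by (simp add: h_def vec_eq_iff)
  have "lborel = distr lborel borel h"
  proof (rule lborel_eqI)
    fix l u :: "real ^ 'n"
    assume "\<And>b. b \<in> Basis \<Longrightarrow> l \<bullet> b \<le> u \<bullet> b"
    from this[OF axis_in_Basis_iff[THEN iffD2]] have le: "l $ i \<le> u $ i" for i
      by (simp add: inner_axis)
    have box: "h -` box l u = box (h l) (h u)"
    proof (intro set_eqI iffI)
      fix x assume "x \<in> box (h l) (h u)"
      then have "l $ (Transposition.transpose m n i) < x $ i \<and> x $ i < u $ (Transposition.transpose m n i)" for i
        by (simp add: mem_box_cart h_def)
      from this[of "Transposition.transpose m n _"] show "x \<in> h -` box l u"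
        by (simp add: mem_box_cart h_def)
    next
      fix x assume "x \<in> h -` box l u"
      then have "l $ i < x $ (Transposition.transpose m n i) \<and> x $ (Transposition.transpose m n i) < u $ i" for i
        by (simp add: mem_box_cart h_def)
      from this[of "Transposition.transpose m n _"] show "x \<in> box (h l) (h u)"
        by (simp add: mem_box_cart h_def)
    qed
    have "emeasure (distr lborel borel h) (box l u) = emeasure lborel (box (h l) (h u))"
      by (simp add: emeasure_distr box)
    also have "\<dots> = (\<Prod>b\<in>Basis. (h u - h l) \<bullet> b)"
      using le by (intro emeasure_lborel_box) (auto simp: Basis_vec_def inner_axis h_def)
    also have "(\<Prod>b\<in>Basis. (h u - h l) \<bullet> b) = (\<Prod>b\<in>Basis. (u - l) \<bullet> b)"
    proof -
      have "(\<Prod>i\<in>UNIV. (u - l) $ (Transposition.transpose m n i)) = (\<Prod>i\<in>UNIV. (u - l) $ i)"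
        by (rule prod.reindex_bij_betw) simp
      then show ?thesis
        by (simp add: prod_Basis_vec inner_axis h_def)
    qed
    finally show "emeasure (distr lborel borel h) (box l u) = (\<Prod>b\<in>Basis. (u - l) \<bullet> b)" .
  qed simp
  then have "(\<integral>\<^sup>+x. f x \<partial>lborel) = (\<integral>\<^sup>+x. f x \<partial>distr lborel borel h)"
    by simp
  also have "\<dots> = (\<integral>\<^sup>+x. f (h x) \<partial>lborel)"
    by (rule nn_integral_distr) simp_all
  finally show ?thesis
    by (simp add: h_def)
qed

lemma borel_measurable_matrix_vector_mult[measurable]:
  "(\<lambda>x. A *v x) \<in> borel_measurable (borel :: (real ^ 'n) measure)" for A :: "real ^ 'n ^ 'm"
  by (intro borel_measurable_continuous_onI linear_continuous_on matrix_vector_mul_bounded_linear)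

text \<open>Both sides are multiplicative in \<open>A\<close>, so it suffices to treat the factors of Gaussian
  elimination: diagonal matrices scale the coordinates, exchanges of coordinates and shears preserve
  the measure.\<close>

lemma nn_integral_lborel_matrix:
  fixes A :: "real ^ 'n ^ 'n" and f :: "real ^ 'n \<Rightarrow> ennreal"
  assumes "det A \<noteq> 0" and "f \<in> borel_measurable borel"
  shows "ennreal \<bar>det A\<bar> * (\<integral>\<^sup>+x. f (A *v x) \<partial>lborel) = (\<integral>\<^sup>+x. f x \<partial>lborel)"
proof -
  define P where "P A \<longleftrightarrow> (det A \<noteq> 0 \<longrightarrow> (\<forall>f \<in> borel_measurable borel.
      ennreal \<bar>det A\<bar> * (\<integral>\<^sup>+x. f (A *v x) \<partial>lborel) = (\<integral>\<^sup>+x. f x \<partial>lborel)))" for A :: "real ^ 'n ^ 'n"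
  have "P A"
  proof (rule induct_matrix_elementary)
    fix A B :: "real ^ 'n ^ 'n"
    assume A: "P A" and B: "P B"
    show "P (A ** B)"
      unfolding P_def
    proof (intro impI ballI)
      fix f :: "real ^ 'n \<Rightarrow> ennreal"
      assume det: "det (A ** B) \<noteq> 0" and f[measurable]: "f \<in> borel_measurable borel"
      have fA: "(\<lambda>x. f (A *v x)) \<in> borel_measurable borel"
        by measurable
      have "(\<integral>\<^sup>+x. f (A *v x) \<partial>lborel) = ennreal \<bar>det B\<bar> * (\<integral>\<^sup>+x. f (A *v (B *v x)) \<partial>lborel)"
        using B[unfolded P_def, THEN mp, THEN bspec, OF _ fA] det by (simp add: det_mul)
      then have "ennreal \<bar>det A\<bar> * (ennreal \<bar>det B\<bar> * (\<integral>\<^sup>+x. f (A *v (B *v x)) \<partial>lborel)) =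
          (\<integral>\<^sup>+x. f x \<partial>lborel)"
        using A[unfolded P_def, THEN mp, THEN bspec, OF _ f] det by (simp add: det_mul)
      then show "ennreal \<bar>det (A ** B)\<bar> * (\<integral>\<^sup>+x. f ((A ** B) *v x) \<partial>lborel) = (\<integral>\<^sup>+x. f x \<partial>lborel)"
        by (simp add: det_mul abs_mult ennreal_mult mult.assoc matrix_vector_mul_assoc)
    qed
  next
    fix A :: "real ^ 'n ^ 'n" and i
    assume "row i A = 0"
    then show "P A"
      by (simp add: P_def det_zero_row)
  next
    fix A :: "real ^ 'n ^ 'n"
    assume diag: "\<And>i j. i \<noteq> j \<Longrightarrow> A $ i $ j = 0"
    show "P A"
      unfolding P_def
    proof (intro impI ballI)
      fix f :: "real ^ 'n \<Rightarrow> ennreal"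
      assume det: "det A \<noteq> 0" and f[measurable]: "f \<in> borel_measurable borel"
      have dA: "det A = (\<Prod>i\<in>UNIV. A $ i $ i)"
        by (rule det_diagonal) (rule diag)
      define c :: "real ^ 'n \<Rightarrow> real" where "c b = b \<bullet> (A *v b)" for b
      have c: "c (axis i 1) = A $ i $ i" for i
        by (simp add: c_def inner_axis' matrix_vector_mult_basis column_def)
      have T: "0 + (\<Sum>j\<in>Basis. (c j * (x \<bullet> j)) *\<^sub>R j) = A *v x" for x
      proof -
        have "(\<Sum>j\<in>UNIV. A $ i $ j * x $ j) = A $ i $ i * x $ i" for i
          by (subst sum.remove[of _ i]) (auto simp: diag)
        then show ?thesis
          by (simp add: sum_Basis_vec c inner_axis)
            (simp add: vec_eq_iff matrix_vector_mult_def axis_def if_distrib cong: if_cong)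
      qed
      have p: "(\<Prod>j\<in>Basis. \<bar>c j\<bar>) = \<bar>det A\<bar>"
        by (simp add: prod_Basis_vec c dA abs_prod)
      have "c j \<noteq> 0" if "j \<in> Basis" for j
        using that det by (auto simp: Basis_vec_eq_range c dA)
      from lborel_affine_euclidean[of c 0, OF this]
      have "lborel = density (distr lborel borel ((*v) A)) (\<lambda>_. \<bar>det A\<bar>)"
        unfolding T p by simp
      then have "(\<integral>\<^sup>+x. f x \<partial>lborel) =
          (\<integral>\<^sup>+x. f x \<partial>density (distr lborel borel ((*v) A)) (\<lambda>_. \<bar>det A\<bar>))"
        by simp
      also have "\<dots> = ennreal \<bar>det A\<bar> * (\<integral>\<^sup>+x. f (A *v x) \<partial>lborel)"
        by (simp add: nn_integral_density nn_integral_distr nn_integral_cmult)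
      finally show "ennreal \<bar>det A\<bar> * (\<integral>\<^sup>+x. f (A *v x) \<partial>lborel) = (\<integral>\<^sup>+x. f x \<partial>lborel)" ..
    qed
  next
    fix m n :: 'n
    assume "m \<noteq> n"
    let ?S = "(\<chi> i j. mat 1 $ i $ Transposition.transpose m n j) :: real ^ 'n ^ 'n"
    have "\<bar>det ?S\<bar> = 1"
      using det_permute_columns[of "Transposition.transpose m n" "mat 1 :: real ^ 'n ^ 'n"]
      by (simp add: permutes_swap_id sign_swap_id abs_mult)
    moreover have "?S *v x = (\<chi> i. x $ Transposition.transpose m n i)" for x
    proof -
      have "(\<Sum>j\<in>UNIV. (if i = Transposition.transpose m n j then 1 else 0) * x $ j) =
          x $ Transposition.transpose m n i" for i
        by (subst sum.remove[of _ "Transposition.transpose m n i"]) (auto intro!: sum.neutral split: if_splits)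
      then show ?thesis
        by (simp add: vec_eq_iff matrix_vector_mult_def mat_def)
    qed
    ultimately show "P ?S"
      by (simp add: P_def nn_integral_lborel_swap)
  next
    fix m n :: 'n and c :: real
    assume mn: "m \<noteq> n"
    let ?S = "(\<chi> i j. if i = m \<and> j = n then c else of_bool (i = j)) :: real ^ 'n ^ 'n"
    have "?S = (\<chi> k. if k = m then row m (mat 1) + c *s row n (mat 1) else row k (mat 1))"
      using mn by (auto simp: vec_eq_iff row_def mat_def)
    then have "det ?S = 1"
      using det_row_operation[OF mn, of "mat 1" c] by simp
    moreover have "?S *v x = x + (c * (x \<bullet> axis n 1)) *\<^sub>R axis m 1" for x
    proof -
      have "(\<Sum>j\<in>UNIV. (if i = m \<and> j = n then c else of_bool (i = j)) * x $ j) =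
          x $ i + (if i = m then c * x $ n else 0)" for i
      proof -
        have "(\<Sum>j\<in>UNIV. (if i = m \<and> j = n then c else of_bool (i = j)) * x $ j) =
            (\<Sum>j\<in>UNIV. (if i = j then x $ j else 0) + (if j = n then (if i = m then c * x $ j else 0) else 0))"
          using mn by (intro sum.cong) auto
        then show ?thesis
          by (simp add: sum.distrib)
      qed
      then show ?thesis
        unfolding inner_axis by (simp add: vec_eq_iff matrix_vector_mult_def axis_def)
    qed
    ultimately show "P ?S"
      using mn by (simp add: P_def nn_integral_lborel_shear axis_eq_axis)
  qed
  with assms show ?thesis
    by (simp add: P_def)
qed

lemma distr_lborel_matrix:
  fixes A :: "real ^ 'n ^ 'n"
  assumes "det A \<noteq> 0"
  shows "lborel = density (distr lborel borel ((*v) A)) (\<lambda>_. ennreal \<bar>det A\<bar>)"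
proof (rule measure_eqI)
  fix S :: "(real ^ 'n) set"
  assume "S \<in> sets lborel"
  then have S[measurable]: "S \<in> sets borel"
    by simp
  have "emeasure (density (distr lborel borel ((*v) A)) (\<lambda>_. ennreal \<bar>det A\<bar>)) S =
      (\<integral>\<^sup>+x. ennreal \<bar>det A\<bar> * indicator S (A *v x) \<partial>lborel)"
    by (simp add: emeasure_density nn_integral_distr)
  also have "\<dots> = ennreal \<bar>det A\<bar> * (\<integral>\<^sup>+x. indicator S (A *v x) \<partial>lborel)"
    by (simp add: nn_integral_cmult)
  also have "\<dots> = (\<integral>\<^sup>+x. indicator S x \<partial>lborel)"
    by (rule nn_integral_lborel_matrix[OF assms]) simp
  finally show "emeasure lborel S = emeasure (density (distr lborel borel ((*v) A)) (\<lambda>_. ennreal \<bar>det A\<bar>)) S"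
    by simp
qed simp

lemma integral_lborel_matrix:
  fixes A :: "real ^ 'n ^ 'n" and f :: "real ^ 'n \<Rightarrow> real"
  assumes "det A \<noteq> 0" and [measurable]: "f \<in> borel_measurable borel"
  shows "(\<integral>x. \<bar>det A\<bar> * f (A *v x) \<partial>lborel) = (\<integral>x. f x \<partial>lborel)"
proof -
  have "(\<integral>x. f x \<partial>lborel) = (\<integral>x. f x \<partial>density (distr lborel borel ((*v) A)) (\<lambda>_. ennreal \<bar>det A\<bar>))"
    using distr_lborel_matrix[OF assms(1)] by simp
  also have "\<dots> = (\<integral>x. \<bar>det A\<bar> * f x \<partial>distr lborel borel ((*v) A))"
    by (subst integral_density) auto
  also have "\<dots> = (\<integral>x. \<bar>det A\<bar> * f (A *v x) \<partial>lborel)"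
    by (subst integral_distr) auto
  finally show ?thesis ..
qed


section \<open>Exploratory drift and diffusion of Gaussian controls\<close>

lemma has_bochner_integral_lborel_prod:
  fixes f :: "'a::euclidean_space \<Rightarrow> real \<Rightarrow> real"
  assumes "\<And>b. b \<in> Basis \<Longrightarrow> has_bochner_integral lborel (f b) (I b)"
  shows "has_bochner_integral lborel (\<lambda>x. \<Prod>b\<in>Basis. f b (x \<bullet> b)) (\<Prod>b\<in>Basis. I b)"
proof -
  interpret product_sigma_finite "\<lambda>_::'a. lborel :: real measure"
    by standard
  have int: "integrable lborel (f b)" and I: "integral\<^sup>L lborel (f b) = I b" if "b \<in> Basis" for b
    using assms[OF that] by (auto simp: has_bochner_integral_iff)
  have [measurable]: "f b \<in> borel_measurable borel" if "b \<in> Basis" for b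
    using int[OF that] by (auto dest: borel_measurable_integrable)
  have meas: "(\<lambda>x. \<Prod>b\<in>Basis. f b (x \<bullet> b)) \<in> borel_measurable borel"
    by measurable
  have eq: "(\<Prod>b\<in>Basis. f b ((\<Sum>c\<in>Basis. g c *\<^sub>R c) \<bullet> b)) = (\<Prod>b\<in>Basis. f b (g b))" for g
    by (intro prod.cong) simp_all
  have "has_bochner_integral (\<Pi>\<^sub>M b\<in>Basis. lborel) (\<lambda>g. \<Prod>b\<in>Basis. f b (g b)) (\<Prod>b\<in>Basis. I b)"
    using int I by (simp add: has_bochner_integral_iff product_integrable_prod product_integral_prod)
  then have "has_bochner_integral (distr (\<Pi>\<^sub>M b\<in>Basis. lborel) borel (\<lambda>g. \<Sum>c\<in>Basis. g c *\<^sub>R c))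
      (\<lambda>x. \<Prod>b\<in>Basis. f b (x \<bullet> b)) (\<Prod>b\<in>Basis. I b)"
    by (subst has_bochner_integral_distr) (simp_all add: meas eq)
  then show ?thesis
    by (simp add: lborel_eq[symmetric])
qed

definition isotropic_normal_density :: "real \<Rightarrow> real ^ 'n \<Rightarrow> real" where
  "isotropic_normal_density s u = exp (- (u \<bullet> u) / (2 * s)) / sqrt ((2 * pi * s) ^ CARD('n))"

lemma borel_measurable_isotropic_normal_density[measurable]:
  "isotropic_normal_density s \<in> borel_measurable borel"
  unfolding isotropic_normal_density_def[abs_def] by measurable

text \<open>Independence of the coordinates: it reduces all Gaussian moments to one dimension.\<close>

lemma isotropic_normal_density_eq_prod:
  fixes u :: "real ^ 'n"
  assumes "0 < s"
  shows "isotropic_normal_density s u = (\<Prod>b\<in>Basis. normal_density 0 (sqrt s) (u \<bullet> b))"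
proof -
  have "(\<Prod>b\<in>Basis. normal_density 0 (sqrt s) (u \<bullet> b)) =
      (\<Prod>b\<in>(Basis :: (real ^ 'n) set). 1 / sqrt (2 * pi * s)) * (\<Prod>b\<in>Basis. exp (- (u \<bullet> b)\<^sup>2 / (2 * s)))"
    unfolding prod.distrib[symmetric] using assms by (simp add: normal_density_def)
  also have "(\<Prod>b\<in>(Basis :: (real ^ 'n) set). 1 / sqrt (2 * pi * s)) = 1 / sqrt ((2 * pi * s) ^ CARD('n))"
    by (simp only: prod_constant DIM_cart DIM_real power_one_over real_sqrt_power mult_1_right)
  also have "(\<Prod>b\<in>Basis. exp (- (u \<bullet> b)\<^sup>2 / (2 * s))) = exp (- (u \<bullet> u) / (2 * s))"
    by (simp add: exp_sum[symmetric] euclidean_inner[of u u] power2_eq_square sum_divide_distrib sum_negf)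
  finally show ?thesis
    by (simp add: isotropic_normal_density_def)
qed

lemma isotropic_normal_moments:
  assumes "0 < s"
  shows "has_bochner_integral lborel (isotropic_normal_density s :: real ^ 'n \<Rightarrow> real) 1"
    and "b \<in> Basis \<Longrightarrow>
      has_bochner_integral lborel (\<lambda>u :: real ^ 'n. (u \<bullet> b) * isotropic_normal_density s u) 0"
    and "b \<in> Basis \<Longrightarrow>
      has_bochner_integral lborel (\<lambda>u :: real ^ 'n. (u \<bullet> b)\<^sup>2 * isotropic_normal_density s u) s"
proof -
  let ?N = "normal_density 0 (sqrt s)"
  have pos: "0 < sqrt s"
    using assms by simp
  have m0: "has_bochner_integral lborel ?N 1"
    using normal_moment_even[OF pos, of 0 0] by simp
  have m1: "has_bochner_integral lborel (\<lambda>x. x * ?N x) 0"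
    using normal_moment_odd[OF pos, of 0 0] by (simp add: mult.commute)
  have m2: "has_bochner_integral lborel (\<lambda>x. x\<^sup>2 * ?N x) s"
    using normal_moment_even[OF pos, of 0 1] assms by (simp add: mult.commute)
  have split: "has_bochner_integral lborel (\<lambda>u :: real ^ 'n. f (u \<bullet> b) * isotropic_normal_density s u) I"
    if b: "b \<in> Basis" and f: "has_bochner_integral lborel (\<lambda>x. f x * ?N x) I" for f I b
  proof -
    have "has_bochner_integral lborel
        (\<lambda>u :: real ^ 'n. \<Prod>c\<in>Basis. (if c = b then f (u \<bullet> c) * ?N (u \<bullet> c) else ?N (u \<bullet> c)))
        (\<Prod>c\<in>Basis. if c = b then I else 1)"
      using f m0 by (intro has_bochner_integral_lborel_prod) auto
    moreover have "(\<Prod>c\<in>Basis. (if c = b then f (u \<bullet> c) * ?N (u \<bullet> c) else ?N (u \<bullet> c))) =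
        f (u \<bullet> b) * isotropic_normal_density s u" for u
    proof -
      have "(\<Prod>c\<in>Basis. (if c = b then f (u \<bullet> c) * ?N (u \<bullet> c) else ?N (u \<bullet> c))) =
          (\<Prod>c\<in>Basis. (if c = b then f (u \<bullet> c) else 1) * ?N (u \<bullet> c))"
        by (intro prod.cong) auto
      then show ?thesis
        using b by (simp add: prod.distrib isotropic_normal_density_eq_prod[OF assms])
    qed
    ultimately show ?thesis
      using b by simp
  qed
  show "has_bochner_integral lborel (isotropic_normal_density s :: real ^ 'n \<Rightarrow> real) 1"
    using has_bochner_integral_lborel_prod[OF m0, where 'a = "real ^ 'n"]
    by (simp add: isotropic_normal_density_eq_prod[OF assms, abs_def])
  show "has_bochner_integral lborel (\<lambda>u :: real ^ 'n. (u \<bullet> b) * isotropic_normal_density s u) 0"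
    if "b \<in> Basis"
    using split[OF that m1] .
  show "has_bochner_integral lborel (\<lambda>u :: real ^ 'n. (u \<bullet> b)\<^sup>2 * isotropic_normal_density s u) s"
    if "b \<in> Basis"
    using split[OF that m2] .
qed

lemma isotropic_normal_inner:
  fixes a :: "real ^ 'n"
  assumes "0 < s"
  shows "has_bochner_integral lborel (\<lambda>u. (a \<bullet> u) * isotropic_normal_density s u) 0"
proof -
  have "has_bochner_integral lborel (\<lambda>u. \<Sum>b\<in>Basis. (a \<bullet> b) * ((u \<bullet> b) * isotropic_normal_density s u))
      (\<Sum>b\<in>Basis. (a \<bullet> b) * 0)"
    by (intro has_bochner_integral_sum has_bochner_integral_mult_right isotropic_normal_moments assms)
  moreover have "(\<Sum>b\<in>Basis. (a \<bullet> b) * ((u \<bullet> b) * isotropic_normal_density s u)) =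
      (a \<bullet> u) * isotropic_normal_density s u" for u
    by (subst euclidean_inner[of a u]) (simp add: sum_distrib_right mult.assoc)
  ultimately show ?thesis
    by simp
qed

lemma isotropic_normal_norm:
  assumes "0 < s"
  shows "has_bochner_integral lborel (\<lambda>u :: real ^ 'n. (u \<bullet> u) * isotropic_normal_density s u) (s * CARD('n))"
proof -
  have "has_bochner_integral lborel (\<lambda>u :: real ^ 'n. \<Sum>b\<in>Basis. (u \<bullet> b)\<^sup>2 * isotropic_normal_density s u)
      (\<Sum>b\<in>(Basis :: (real ^ 'n) set). s)"
    by (intro has_bochner_integral_sum isotropic_normal_moments assms)
  moreover have "(\<Sum>b\<in>Basis. (u \<bullet> b)\<^sup>2 * isotropic_normal_density s u) = (u \<bullet> u) * isotropic_normal_density s u"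
    for u :: "real ^ 'n"
    by (simp add: euclidean_inner[of u u] sum_distrib_right power2_eq_square)
  ultimately show ?thesis
    by (simp add: mult.commute)
qed

lemma matrix_inv_works:
  fixes A :: "'a::semiring_1 ^ 'n ^ 'm"
  assumes "invertible A"
  shows "A ** matrix_inv A = mat 1" "matrix_inv A ** A = mat 1"
  using someI_ex[OF assms[unfolded invertible_def]] by (simp_all add: matrix_inv_def)

lemma matrix_inv_eqI:
  fixes A :: "'a::semiring_1 ^ 'n ^ 'm"
  assumes "A ** B = mat 1" and "B ** A = mat 1"
  shows "matrix_inv A = B"
proof -
  have "invertible A"
    using assms by (auto simp: invertible_def)
  have "matrix_inv A = matrix_inv A ** (A ** B)"
    by (simp add: assms(1))
  also have "\<dots> = (matrix_inv A ** A) ** B"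
    by (rule matrix_mul_assoc)
  also have "\<dots> = B"
    by (simp add: matrix_inv_works(2)[OF \<open>invertible A\<close>])
  finally show ?thesis .
qed

text \<open>The substitution \<open>u = \<sigma> v\<close> turns the covariance into \<open>s\<close> times the identity, so that the only
  trace of \<open>\<sigma>\<close> is the Jacobian factor.\<close>

lemma gaussian_density_whitened:
  fixes \<sigma> :: "real ^ 'd ^ 'd"
  assumes "invertible \<sigma>" and "0 < s"
  shows "gaussian_density m (s *\<^sub>R matrix_inv (transpose \<sigma> ** \<sigma>)) v =
    \<bar>det \<sigma>\<bar> * isotropic_normal_density s (\<sigma> *v v - \<sigma> *v m)"
proof -
  let ?S = "transpose \<sigma> ** \<sigma>"
  have inv: "invertible ?S"
    using assms(1) by (simp add: invertible_mult transpose_invertible)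
  have det\<sigma>: "det \<sigma> \<noteq> 0"
    using assms(1) by (simp add: invertible_det_nz)
  have detS: "det ?S = (det \<sigma>)\<^sup>2"
    by (simp add: det_mul power2_eq_square)
  have "matrix_inv (s *\<^sub>R matrix_inv ?S) = (1 / s) *\<^sub>R ?S"
    using assms(2) inv by (intro matrix_inv_eqI)
      (simp_all add: scalar_matrix_assoc[symmetric] matrix_scalar_ac matrix_inv_works)
  moreover have "w \<bullet> (((1 / s) *\<^sub>R ?S) *v w) = ((\<sigma> *v w) \<bullet> (\<sigma> *v w)) / s" for w
    by (simp add: scaleR_matrix_vector_assoc[symmetric] matrix_vector_mul_assoc[symmetric]
        dot_lmul_matrix[symmetric] inner_commute)
  moreover have "det (s *\<^sub>R matrix_inv ?S) = s ^ CARD('d) / (det \<sigma>)\<^sup>2"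
  proof -
    have "det ?S * det (matrix_inv ?S) = 1"
      using inv by (metis det_I det_mul matrix_inv_works(1))
    then have "det (matrix_inv ?S) = 1 / (det \<sigma>)\<^sup>2"
      using det\<sigma> by (simp add: detS field_simps)
    moreover have "s *\<^sub>R matrix_inv ?S = (\<chi> i. s *s (matrix_inv ?S $ i))"
      by (simp add: vec_eq_iff)
    ultimately show ?thesis
      by (simp add: det_rows_mul)
  qed
  ultimately show ?thesis
    using det\<sigma> by (simp add: gaussian_density_def isotropic_normal_density_def power_mult_distrib
        real_sqrt_divide real_sqrt_mult matrix_vector_mult_diff_distrib[of \<sigma>])
qed

lemma integral_gaussian_density:
  fixes \<sigma> :: "real ^ 'd ^ 'd" and f :: "real ^ 'd \<Rightarrow> real"
  assumes "invertible \<sigma>" and "0 < s" and [measurable]: "f \<in> borel_measurable borel"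
  shows "(\<integral>v. f (\<sigma> *v v) * gaussian_density m (s *\<^sub>R matrix_inv (transpose \<sigma> ** \<sigma>)) v \<partial>lborel) =
    (\<integral>u. f (\<sigma> *v m + u) * isotropic_normal_density s u \<partial>lborel)"
proof -
  have "(\<integral>v. f (\<sigma> *v v) * gaussian_density m (s *\<^sub>R matrix_inv (transpose \<sigma> ** \<sigma>)) v \<partial>lborel) =
      (\<integral>v. \<bar>det \<sigma>\<bar> * (f (\<sigma> *v v) * isotropic_normal_density s (\<sigma> *v v - \<sigma> *v m)) \<partial>lborel)"
    by (simp add: gaussian_density_whitened[OF assms(1,2)] mult_ac)
  also have "\<dots> = (\<integral>u. f u * isotropic_normal_density s (u - \<sigma> *v m) \<partial>lborel)"
    using assms(1) by (intro integral_lborel_matrix) (auto simp: invertible_det_nz)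
  also have "\<dots> = (\<integral>u. f u * isotropic_normal_density s (u - \<sigma> *v m) \<partial>distr lborel borel ((+) (\<sigma> *v m)))"
    by (simp add: lborel_distr_plus)
  also have "\<dots> = (\<integral>u. f (\<sigma> *v m + u) * isotropic_normal_density s u \<partial>lborel)"
    by (subst integral_distr) simp_all
  finally show ?thesis .
qed

lemma exploratory_drift_gaussian:
  fixes \<sigma> :: "real ^ 'd ^ 'd"
  assumes "invertible \<sigma>" and "0 < s"
  shows "exploratory_drift \<rho> \<sigma> (gaussian_density m (s *\<^sub>R matrix_inv (transpose \<sigma> ** \<sigma>))) = \<rho> \<bullet> (\<sigma> *v m)"
proof -
  have "has_bochner_integral lborel
      (\<lambda>u. (\<rho> \<bullet> (\<sigma> *v m)) * isotropic_normal_density s u + (\<rho> \<bullet> u) * isotropic_normal_density s u)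
      ((\<rho> \<bullet> (\<sigma> *v m)) * 1 + 0)"
    by (intro has_bochner_integral_add has_bochner_integral_mult_right isotropic_normal_moments
        isotropic_normal_inner assms)
  then have "(\<integral>u. (\<rho> \<bullet> (\<sigma> *v m + u)) * isotropic_normal_density s u \<partial>lborel) = \<rho> \<bullet> (\<sigma> *v m)"
    by (simp add: has_bochner_integral_iff inner_add_right distrib_right)
  then show ?thesis
    unfolding exploratory_drift_def
    by (subst integral_gaussian_density[OF assms]) simp_all
qed

lemma exploratory_diffusion_gaussian:
  fixes \<sigma> :: "real ^ 'd ^ 'd"
  assumes "invertible \<sigma>" and "0 < s"
  shows "exploratory_diffusion \<sigma> (gaussian_density m (s *\<^sub>R matrix_inv (transpose \<sigma> ** \<sigma>))) =
    sqrt ((\<sigma> *v m) \<bullet> (\<sigma> *v m) + s * CARD('d))"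
proof -
  let ?m = "\<sigma> *v m"
  have A: "has_bochner_integral lborel (\<lambda>u :: real ^ 'd. (?m \<bullet> ?m) * isotropic_normal_density s u) ((?m \<bullet> ?m) * 1)"
    by (rule has_bochner_integral_mult_right) (rule isotropic_normal_moments assms)+
  have B: "has_bochner_integral lborel (\<lambda>u. 2 * ((?m \<bullet> u) * isotropic_normal_density s u)) (2 * 0)"
    by (rule has_bochner_integral_mult_right) (rule isotropic_normal_inner assms)+
  have "has_bochner_integral lborel
      (\<lambda>u. (?m \<bullet> ?m) * isotropic_normal_density s u +
        (2 * ((?m \<bullet> u) * isotropic_normal_density s u) + (u \<bullet> u) * isotropic_normal_density s u))
      ((?m \<bullet> ?m) * 1 + (2 * 0 + s * CARD('d)))"
    by (rule has_bochner_integral_add[OF A has_bochner_integral_add[OF B isotropic_normal_norm[OF assms(2)]]])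
  moreover have "(?m \<bullet> ?m) * isotropic_normal_density s u +
        (2 * ((?m \<bullet> u) * isotropic_normal_density s u) + (u \<bullet> u) * isotropic_normal_density s u) =
      ((?m + u) \<bullet> (?m + u)) * isotropic_normal_density s u" for u
    by (simp add: inner_add_left inner_add_right inner_commute[of u ?m] distrib_right)
  ultimately have "(\<integral>u. ((?m + u) \<bullet> (?m + u)) * isotropic_normal_density s u \<partial>lborel) =
      ?m \<bullet> ?m + s * CARD('d)"
    by (simp add: has_bochner_integral_iff)
  moreover have "v \<bullet> ((transpose \<sigma> ** \<sigma>) *v v) = (\<sigma> *v v) \<bullet> (\<sigma> *v v)" for v
    by (simp add: matrix_vector_mul_assoc[symmetric] dot_lmul_matrix[symmetric] inner_commute)
  ultimately show ?thesis
    unfolding exploratory_diffusion_def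
    by (simp add: integral_gaussian_density[OF assms, of "\<lambda>u. u \<bullet> u"])
qed

section \<open>Square integrable functions\<close>

definition square_integrable :: "'a measure \<Rightarrow> ('a \<Rightarrow> real) \<Rightarrow> bool" where
  "square_integrable M f \<longleftrightarrow> f \<in> borel_measurable M \<and> integrable M (\<lambda>x. (f x)\<^sup>2)"

lemma square_integrableD:
  assumes "square_integrable M f"
  shows "f \<in> borel_measurable M" "integrable M (\<lambda>x. (f x)\<^sup>2)"
  using assms by (auto simp: square_integrable_def)

lemma integrable_mult_square_integrable:
  assumes "square_integrable M f" and "square_integrable M g"
  shows "integrable M (\<lambda>x. f x * g x)"
proof (rule Bochner_Integration.integrable_bound)
  show "integrable M (\<lambda>x. (f x)\<^sup>2 + (g x)\<^sup>2)"
    using assms by (simp add: square_integrableD)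
  show "(\<lambda>x. f x * g x) \<in> borel_measurable M"
    using assms by (intro borel_measurable_times square_integrableD)
  have "\<bar>f x * g x\<bar> \<le> (f x)\<^sup>2 + (g x)\<^sup>2" for x
  proof -
    have "2 * (\<bar>f x\<bar> * \<bar>g x\<bar>) \<le> (f x)\<^sup>2 + (g x)\<^sup>2"
      using sum_squares_bound[of "\<bar>f x\<bar>" "\<bar>g x\<bar>"] by simp
    moreover have "0 \<le> \<bar>f x\<bar> * \<bar>g x\<bar>"
      by simp
    ultimately show ?thesis
      unfolding abs_mult by linarith
  qed
  then show "AE x in M. norm (f x * g x) \<le> norm ((f x)\<^sup>2 + (g x)\<^sup>2)"
    by simp
qed

lemma square_integrable_add:
  assumes "square_integrable M f" and "square_integrable M g"
  shows "square_integrable M (\<lambda>x. f x + g x)"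
proof -
  have "integrable M (\<lambda>x. (f x)\<^sup>2 + (g x)\<^sup>2 + 2 * (f x * g x))"
    using assms by (simp add: square_integrableD integrable_mult_square_integrable)
  then show ?thesis
    using assms[THEN square_integrableD(1)] by (simp add: square_integrable_def power2_sum mult.assoc)
qed

lemma square_integrable_cmult:
  "square_integrable M f \<Longrightarrow> square_integrable M (\<lambda>x. c * f x)"
  by (auto simp: square_integrable_def power_mult_distrib)

lemma square_integrable_diff:
  assumes "square_integrable M f" and "square_integrable M g"
  shows "square_integrable M (\<lambda>x. f x - g x)"
  using square_integrable_add[OF assms(1) square_integrable_cmult[OF assms(2), of "-1"]] by simp

lemma square_integrable_sum:
  assumes "\<And>i. i \<in> A \<Longrightarrow> square_integrable M (f i)"
  shows "square_integrable M (\<lambda>x. \<Sum>i\<in>A. f i x)"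
  using assms
proof (induction A rule: infinite_finite_induct)
  case (insert i A)
  then show ?case
    by (simp add: square_integrable_add)
qed (simp_all add: square_integrable_def)

lemma square_integrable_const: "finite_measure M \<Longrightarrow> square_integrable M (\<lambda>_. c)"
  by (simp add: square_integrable_def finite_measure.integrable_const)

lemma square_integrable_AE_cong:
  assumes "square_integrable M f" and "g \<in> borel_measurable M" and "AE x in M. f x = g x"
  shows "square_integrable M g"
  unfolding square_integrable_def
proof
  show "integrable M (\<lambda>x. (g x)\<^sup>2)"
    using assms(1) by (rule integrable_cong_AE_imp[OF square_integrableD(2)])
      (use assms in auto)
qed fact

lemma integral_mult_square_le:
  assumes f: "square_integrable M f" and g: "square_integrable M g"
  shows "(\<integral>x. f x * g x \<partial>M)\<^sup>2 \<le> (\<integral>x. (f x)\<^sup>2 \<partial>M) * (\<integral>x. (g x)\<^sup>2 \<partial>M)"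
proof -
  let ?a = "\<integral>x. (f x)\<^sup>2 \<partial>M" and ?b = "\<integral>x. f x * g x \<partial>M" and ?c = "\<integral>x. (g x)\<^sup>2 \<partial>M"
  have fg: "integrable M (\<lambda>x. f x * g x)"
    using f g by (rule integrable_mult_square_integrable)
  have quad: "0 \<le> ?a + 2 * t * ?b + t\<^sup>2 * ?c" for t
  proof -
    have "0 \<le> (\<integral>x. (f x + t * g x)\<^sup>2 \<partial>M)"
      by simp
    also have "(\<lambda>x. (f x + t * g x)\<^sup>2) = (\<lambda>x. (f x)\<^sup>2 + 2 * t * (f x * g x) + t\<^sup>2 * (g x)\<^sup>2)"
      by (simp add: power2_eq_square algebra_simps)
    also have "integral\<^sup>L M \<dots> = ?a + 2 * t * ?b + t\<^sup>2 * ?c"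
      using f g fg by (simp add: square_integrableD)
    finally show ?thesis .
  qed
  have c: "0 \<le> ?c"
    by simp
  show ?thesis
  proof (cases "?c = 0")
    case True
    have "?b = 0"
    proof (rule ccontr)
      assume "?b \<noteq> 0"
      \<comment> \<open>the quadratic degenerates to a line, which this \<open>t\<close> takes to \<open>- 1\<close>\<close>
      then show False
        using quad[of "- (?a + 1) / (2 * ?b)"] True by (simp add: field_simps)
    qed
    with True show ?thesis
      by simp
  next
    case False
    with c have "0 < ?c"
      by linarith
    \<comment> \<open>the vertex of the quadratic\<close>
    with quad[of "- ?b / ?c"] show ?thesis
      by (simp add: field_simps power2_eq_square)
  qed
qed

text \<open>Convergence in the mean square passes square integrability, inner products and norms on to the
  limit. The elementary integrals enter the definition of the Ito integral through such a limit.\<close>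

lemma square_integrable_limit:
  assumes f: "\<And>k. square_integrable M (f k)" and g[measurable]: "g \<in> borel_measurable M"
    and lim: "(\<lambda>k. \<integral>\<^sup>+x. ennreal ((g x - f k x)\<^sup>2) \<partial>M) \<longlonglongrightarrow> 0"
  shows "square_integrable M g"
    and "square_integrable M h \<Longrightarrow> (\<lambda>k. \<integral>x. h x * f k x \<partial>M) \<longlonglongrightarrow> (\<integral>x. h x * g x \<partial>M)"
    and "(\<lambda>k. \<integral>x. (f k x)\<^sup>2 \<partial>M) \<longlonglongrightarrow> (\<integral>x. (g x)\<^sup>2 \<partial>M)"
proof -
  have [measurable]: "f k \<in> borel_measurable M" for k
    using f by (rule square_integrableD)
  have "eventually (\<lambda>k. (\<integral>\<^sup>+x. ennreal ((g x - f k x)\<^sup>2) \<partial>M) < 1) sequentially"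
    using lim by (rule order_tendstoD) simp
  then obtain k where k: "(\<integral>\<^sup>+x. ennreal ((g x - f k x)\<^sup>2) \<partial>M) < 1"
    by (auto simp: eventually_sequentially)
  have "integrable M (\<lambda>x. (g x - f k x)\<^sup>2)"
  proof (rule integrableI_bounded)
    show "(\<integral>\<^sup>+x. ennreal (norm ((g x - f k x)\<^sup>2)) \<partial>M) < \<infinity>"
      using k by (simp add: order.strict_trans[OF _ ennreal_one_less_top])
  qed simp
  then have "square_integrable M (\<lambda>x. g x - f k x)"
    by (simp add: square_integrable_def)
  from square_integrable_add[OF this f[of k]] show G: "square_integrable M g"
    by simp
  define D where "D k = (\<integral>x. (g x - f k x)\<^sup>2 \<partial>M)" for k
  have diff: "square_integrable M (\<lambda>x. g x - f k x)" for k
    using G f by (rule square_integrable_diff)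
  have "(\<lambda>k. ennreal (D k)) \<longlonglongrightarrow> ennreal 0"
    using lim by (simp add: D_def nn_integral_eq_integral square_integrableD(2)[OF diff])
  then have D: "D \<longlonglongrightarrow> 0"
    by (subst (asm) tendsto_ennreal_iff) (auto simp: D_def)
  have lim_mult: "(\<lambda>k. \<integral>x. h x * f k x \<partial>M) \<longlonglongrightarrow> (\<integral>x. h x * g x \<partial>M)"
    if h: "square_integrable M h" for h
  proof -
    have "(\<lambda>k. (\<integral>x. h x * (g x - f k x) \<partial>M)\<^sup>2) \<longlonglongrightarrow> 0"
    proof (rule tendsto_sandwich[where f = "\<lambda>_. 0"])
      show "(\<lambda>k. (\<integral>x. (h x)\<^sup>2 \<partial>M) * D k) \<longlonglongrightarrow> 0"
        using tendsto_mult_left[OF D, of "\<integral>x. (h x)\<^sup>2 \<partial>M"] by simp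
      show "\<forall>\<^sub>F k in sequentially. (\<integral>x. h x * (g x - f k x) \<partial>M)\<^sup>2 \<le> (\<integral>x. (h x)\<^sup>2 \<partial>M) * D k"
        unfolding D_def by (intro always_eventually allI integral_mult_square_le h diff)
    qed simp_all
    from tendsto_real_sqrt[OF this] have "(\<lambda>k. \<integral>x. h x * (g x - f k x) \<partial>M) \<longlonglongrightarrow> 0"
      by (simp add: tendsto_rabs_zero_iff)
    then have "(\<lambda>k. (\<integral>x. h x * g x \<partial>M) - (\<integral>x. h x * f k x \<partial>M)) \<longlonglongrightarrow> 0"
      using h G f by (simp add: right_diff_distrib integrable_mult_square_integrable)
    then have "(\<lambda>k. (\<integral>x. h x * g x \<partial>M) - ((\<integral>x. h x * g x \<partial>M) - (\<integral>x. h x * f k x \<partial>M)))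
        \<longlonglongrightarrow> (\<integral>x. h x * g x \<partial>M) - 0"
      by (intro tendsto_diff tendsto_const)
    then show ?thesis
      by simp
  qed
  then show "square_integrable M h \<Longrightarrow> (\<lambda>k. \<integral>x. h x * f k x \<partial>M) \<longlonglongrightarrow> (\<integral>x. h x * g x \<partial>M)" .
  have "(\<integral>x. (f k x)\<^sup>2 \<partial>M) = D k - (\<integral>x. (g x)\<^sup>2 \<partial>M) + 2 * (\<integral>x. g x * f k x \<partial>M)" for k
  proof -
    have "(\<lambda>x. (f k x)\<^sup>2) = (\<lambda>x. (g x - f k x)\<^sup>2 - (g x)\<^sup>2 + 2 * (g x * f k x))"
      by (simp add: power2_eq_square algebra_simps)
    then show ?thesis
      using G f diff[of k] by (simp add: D_def square_integrableD integrable_mult_square_integrable)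
  qed
  moreover have "(\<lambda>k. D k - (\<integral>x. (g x)\<^sup>2 \<partial>M) + 2 * (\<integral>x. g x * f k x \<partial>M)) \<longlonglongrightarrow>
      0 - (\<integral>x. (g x)\<^sup>2 \<partial>M) + 2 * (\<integral>x. g x * g x \<partial>M)"
    by (intro tendsto_intros D lim_mult G)
  ultimately show "(\<lambda>k. \<integral>x. (f k x)\<^sup>2 \<partial>M) \<longlonglongrightarrow> (\<integral>x. (g x)\<^sup>2 \<partial>M)"
    by (simp add: power2_eq_square)
qed

section \<open>A linear integral equation\<close>

text \<open>The equation makes \<open>f\<close> first continuous and then differentiable with \<open>f' = \<kappa> f + g\<close>, whence
  \<open>exp (- \<kappa> t) f t\<close> has derivative \<open>exp (- \<kappa> t) g t\<close>. The moments of a solution are known a priori to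
  be integrable in time, by Fubini's theorem, and this starts the bootstrap.\<close>

lemma linear_volterra_solution:
  fixes f g :: "real \<Rightarrow> real"
  assumes "0 \<le> T" and f: "set_integrable lborel {0..T} f" and g: "continuous_on {0..T} g"
    and eq: "\<And>t. t \<in> {0..T} \<Longrightarrow> f t = f\<^sub>0 + (LBINT s:{0..t}. \<kappa> * f s + g s)"
  shows "f T = exp (\<kappa> * T) * (f\<^sub>0 + integral {0..T} (\<lambda>s. exp (- \<kappa> * s) * g s))"
proof -
  have gi: "set_integrable lborel {0..T} g"
    using g by (rule borel_integrable_atLeastAtMost')
  have int: "set_integrable lborel {0..T} (\<lambda>s. \<kappa> * f s + g s)"
    using f gi by (intro set_integral_add set_integrable_mult_right) auto
  have feq: "f t = f\<^sub>0 + integral {0..t} (\<lambda>s. \<kappa> * f s + g s)" if "t \<in> {0..T}" for t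
  proof -
    have "set_integrable lborel {0..t} (\<lambda>s. \<kappa> * f s + g s)"
      using int that by (rule_tac set_integrable_subset) auto
    then show ?thesis
      using eq[OF that] by (simp add: set_borel_integral_eq_integral)
  qed
  have "continuous_on {0..T} (\<lambda>t. f\<^sub>0 + integral {0..t} (\<lambda>s. \<kappa> * f s + g s))"
    by (intro continuous_intros indefinite_integral_continuous_1 set_borel_integral_eq_integral int)
  then have fc: "continuous_on {0..T} f"
    by (rule continuous_on_eq) (simp add: feq)
  define h where "h t = exp (- \<kappa> * t) * f t - integral {0..t} (\<lambda>s. exp (- \<kappa> * s) * g s)" for t
  have "(h has_field_derivative 0) (at t within {0..T})" if t: "t \<in> {0..T}" for t
  proof -
    have "((\<lambda>t. f\<^sub>0 + integral {0..t} (\<lambda>s. \<kappa> * f s + g s)) has_real_derivative 0 + (\<kappa> * f t + g t))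
        (at t within {0..T})"
      by (intro DERIV_add DERIV_const integral_has_real_derivative continuous_intros fc g t)
    then have f': "(f has_real_derivative \<kappa> * f t + g t) (at t within {0..T})"
      using has_field_derivative_transform_within[OF _ zero_less_one t, of _ _ f] feq by simp
    have i': "((\<lambda>t. integral {0..t} (\<lambda>s. exp (- \<kappa> * s) * g s)) has_real_derivative exp (- \<kappa> * t) * g t)
        (at t within {0..T})"
      by (intro integral_has_real_derivative continuous_intros g t)
    show ?thesis
      unfolding h_def
      by (rule derivative_eq_intros f' i' refl | simp)+ (simp add: algebra_simps)
  qed
  then obtain c where "\<And>t. t \<in> {0..T} \<Longrightarrow> h t = c"
    using has_field_derivative_zero_constant[of "{0..T}" h] by auto
  then have "h T = h 0"
    using \<open>0 \<le> T\<close> by simp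
  moreover have "f 0 = f\<^sub>0"
    using feq[of 0] \<open>0 \<le> T\<close> by simp
  ultimately have "exp (- \<kappa> * T) * f T = f\<^sub>0 + integral {0..T} (\<lambda>s. exp (- \<kappa> * s) * g s)"
    by (simp add: h_def)
  moreover have "f T = exp (\<kappa> * T) * (exp (- \<kappa> * T) * f T)"
    by (simp add: exp_minus)
  ultimately show ?thesis
    by simp
qed


section \<open>Elementary stochastic integrals\<close>

lemma elementary_mono:
  assumes "elementary M F T n \<tau> \<xi>" and "i \<le> j" and "j \<le> n"
  shows "\<tau> i \<le> \<tau> j"
  using assms(2,3)
proof (induction j rule: dec_induct)
  case (step j)
  have "\<tau> k < \<tau> (Suc k)" if "Suc k \<le> n" for k
    using assms(1) that by (simp add: elementary_def)
  from this[OF step.prems] step.IH step.prems show ?case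
    by simp
qed simp

lemma elementary_range:
  assumes "elementary M F T n \<tau> \<xi>" and "i \<le> n"
  shows "0 \<le> \<tau> i" and "\<tau> i \<le> T"
  using elementary_mono[OF assms(1), of 0 i] elementary_mono[OF assms(1), of i n] assms
  by (auto simp: elementary_def)

text \<open>The intervals of constancy are disjoint, so the cross terms vanish.\<close>

lemma elementary_process_square:
  assumes "elementary M F T n \<tau> \<xi>"
  shows "(elementary_process n \<tau> \<xi> s \<omega>)\<^sup>2 = (\<Sum>i<n. (\<xi> i \<omega>)\<^sup>2 * indicator {\<tau> i<..\<tau> (Suc i)} s)"
proof -
  have disj: "indicator {\<tau> i<..\<tau> (Suc i)} s * indicator {\<tau> j<..\<tau> (Suc j)} s = (0::real)"
    if "i < n" "j < n" "i \<noteq> j" for i j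
  proof -
    have "\<tau> (Suc i) \<le> \<tau> j \<or> \<tau> (Suc j) \<le> \<tau> i"
      using that by (cases "i < j") (auto intro!: elementary_mono[OF assms])
    then show ?thesis
      by (auto simp: indicator_def)
  qed
  let ?a = "\<lambda>i. \<xi> i \<omega> * indicator {\<tau> i<..\<tau> (Suc i)} s"
  have "(elementary_process n \<tau> \<xi> s \<omega>)\<^sup>2 = (\<Sum>i<n. \<Sum>j<n. ?a i * ?a j)"
    unfolding elementary_process_def power2_eq_square sum_product ..
  also have "\<dots> = (\<Sum>i<n. (\<xi> i \<omega>)\<^sup>2 * indicator {\<tau> i<..\<tau> (Suc i)} s)"
  proof (rule sum.cong)
    fix i assume i: "i \<in> {..<n}"
    have "(\<Sum>j<n. ?a i * ?a j) = (\<Sum>j<n. if j = i then ?a i * ?a i else 0)"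
    proof (rule sum.cong)
      fix j assume "j \<in> {..<n}"
      then show "?a i * ?a j = (if j = i then ?a i * ?a i else 0)"
        using i disj[of i j] by auto
    qed simp
    then show "(\<Sum>j<n. ?a i * ?a j) = (\<xi> i \<omega>)\<^sup>2 * indicator {\<tau> i<..\<tau> (Suc i)} s"
      using i by (simp add: power2_eq_square indicator_def)
  qed simp
  finally show ?thesis .
qed

context brownian_basis
begin

lemma adapted_measurable: "f \<in> borel_measurable (F t) \<Longrightarrow> f \<in> borel_measurable M"
  by (rule measurable_from_subalg[OF filtration_subalgebra])

lemma adapted_mono: "s \<le> t \<Longrightarrow> f \<in> borel_measurable (F s) \<Longrightarrow> f \<in> borel_measurable (F t)"
  using measurable_mono[of borel borel "F s" "F t"] sets_F_mono space_F by auto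

lemma W_measurable: "0 \<le> t \<Longrightarrow> t \<le> T \<Longrightarrow> W t \<in> borel_measurable (F t)"
  using W_continuous_adapted by (auto simp: continuous_adapted_def)

lemma W_increment_moments:
  assumes "0 \<le> s" and "s \<le> t" and "t \<le> T"
  shows "integrable M (\<lambda>\<omega>. W t \<omega> - W s \<omega>)"
    and "integrable M (\<lambda>\<omega>. (W t \<omega> - W s \<omega>)\<^sup>2)"
    and "expectation (\<lambda>\<omega>. W t \<omega> - W s \<omega>) = 0"
    and "expectation (\<lambda>\<omega>. (W t \<omega> - W s \<omega>)\<^sup>2) = t - s"
proof -
  have "integrable M (\<lambda>\<omega>. W t \<omega> - W s \<omega>) \<and> integrable M (\<lambda>\<omega>. (W t \<omega> - W s \<omega>)\<^sup>2) \<and>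
    expectation (\<lambda>\<omega>. W t \<omega> - W s \<omega>) = 0 \<and> expectation (\<lambda>\<omega>. (W t \<omega> - W s \<omega>)\<^sup>2) = t - s"
  proof (cases "s = t")
    case False
    then have st: "s < t" and pos: "0 < sqrt (t - s)"
      using assms by auto
    note D = W_increment[OF assms(1) st assms(3)]
    note m1 = normal_moment_odd[OF pos, of 0 0]
    note m2 = normal_moment_even[OF pos, of 0 1]
    show ?thesis
      using distributed_integrable[OF D, of "\<lambda>x. x"] distributed_integral[OF D, of "\<lambda>x. x"]
        distributed_integrable[OF D, of "\<lambda>x. x\<^sup>2"] distributed_integral[OF D, of "\<lambda>x. x\<^sup>2"]
        m1 m2 st by (simp add: has_bochner_integral_iff)
  qed simp
  then show "integrable M (\<lambda>\<omega>. W t \<omega> - W s \<omega>)"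
    and "integrable M (\<lambda>\<omega>. (W t \<omega> - W s \<omega>)\<^sup>2)"
    and "expectation (\<lambda>\<omega>. W t \<omega> - W s \<omega>) = 0"
    and "expectation (\<lambda>\<omega>. (W t \<omega> - W s \<omega>)\<^sup>2) = t - s"
    by auto
qed

text \<open>The case \<open>s = t\<close> is trivial but convenient: the truncated time points of an elementary integral
  often coincide.\<close>

lemma W_increment_independent:
  fixes A :: "'w \<Rightarrow> real" and h :: "real \<Rightarrow> real"
  assumes "0 \<le> s" and "s \<le> t" and "t \<le> T"
    and A: "A \<in> borel_measurable (F s)" "integrable M A"
    and h: "h \<in> borel_measurable borel" "integrable M (\<lambda>\<omega>. h (W t \<omega> - W s \<omega>))"
  shows "integrable M (\<lambda>\<omega>. A \<omega> * h (W t \<omega> - W s \<omega>))"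
    and "expectation (\<lambda>\<omega>. A \<omega> * h (W t \<omega> - W s \<omega>)) =
      expectation A * expectation (\<lambda>\<omega>. h (W t \<omega> - W s \<omega>))"
proof -
  have "integrable M (\<lambda>\<omega>. A \<omega> * h (W t \<omega> - W s \<omega>)) \<and>
    expectation (\<lambda>\<omega>. A \<omega> * h (W t \<omega> - W s \<omega>)) =
      expectation A * expectation (\<lambda>\<omega>. h (W t \<omega> - W s \<omega>))"
  proof (cases "s = t")
    case True
    then show ?thesis
      using A by (simp add: prob_space)
  next
    case False
    then have st: "s < t"
      using assms by simp
    let ?D = "\<lambda>\<omega>. W t \<omega> - W s \<omega>"
    have D: "?D \<in> borel_measurable M"
      using W_increment_moments(1)[OF assms(1-3)] by simp
    have "indep_set (sets (F s)) (sets (vimage_algebra (space M) ?D borel))"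
      using W_independent[OF assms(1) st assms(3)] .
    then have "indep_set (sigma_sets (space M) {A -` S \<inter> space M | S. S \<in> sets borel})
        (sigma_sets (space M) {?D -` S \<inter> space M | S. S \<in> sets borel})"
      unfolding indep_set_def
    proof (rule indep_sets_mono_sets)
      fix i :: bool
      have "sigma_sets (space M) {A -` S \<inter> space M | S. S \<in> sets borel} \<subseteq> sets (F s)"
        unfolding space_F[of s, symmetric] by (rule sets.sigma_sets_subset) (use measurable_sets[OF A(1)] in auto)
      then show "case_bool (sigma_sets (space M) {A -` S \<inter> space M | S. S \<in> sets borel})
          (sigma_sets (space M) {?D -` S \<inter> space M | S. S \<in> sets borel}) i
          \<subseteq> case_bool (sets (F s)) (sets (vimage_algebra (space M) ?D borel)) i"
        by (simp add: sets_vimage_algebra split: bool.split)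
    qed
    then have "indep_var borel A borel ?D"
      using D adapted_measurable[OF A(1)] by (simp add: indep_var_eq)
    then have "indep_var borel (id \<circ> A) borel (h \<circ> ?D)"
      using h(1) by (intro indep_var_compose) auto
    then have "indep_var borel A borel (\<lambda>\<omega>. h (?D \<omega>))"
      by (simp add: comp_def)
    then show ?thesis
      using A(2) h(2) by (simp add: indep_var_integrable indep_var_lebesgue_integral)
  qed
  then show "integrable M (\<lambda>\<omega>. A \<omega> * h (W t \<omega> - W s \<omega>))"
    and "expectation (\<lambda>\<omega>. A \<omega> * h (W t \<omega> - W s \<omega>)) =
      expectation A * expectation (\<lambda>\<omega>. h (W t \<omega> - W s \<omega>))"
    by auto
qed

lemma W_increment_orthogonal:
  fixes A :: "'w \<Rightarrow> real"
  assumes "0 \<le> s" and "s \<le> t" and "t \<le> T" and "A \<in> borel_measurable (F s)" and "integrable M A"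
  shows "integrable M (\<lambda>\<omega>. A \<omega> * (W t \<omega> - W s \<omega>))"
    and "expectation (\<lambda>\<omega>. A \<omega> * (W t \<omega> - W s \<omega>)) = 0"
  using W_increment_independent[OF assms, of "\<lambda>x. x"] W_increment_moments[OF assms(1-3)] by simp_all

lemma square_integrable_mult_increment:
  assumes "0 \<le> s" and "s \<le> t" and "t \<le> T"
    and A: "A \<in> borel_measurable (F s)" "square_integrable M A"
  shows "square_integrable M (\<lambda>\<omega>. A \<omega> * (W t \<omega> - W s \<omega>))"
    and "expectation (\<lambda>\<omega>. (A \<omega> * (W t \<omega> - W s \<omega>))\<^sup>2) = expectation (\<lambda>\<omega>. (A \<omega>)\<^sup>2) * (t - s)"
proof -
  have A2: "(\<lambda>\<omega>. (A \<omega>)\<^sup>2) \<in> borel_measurable (F s)"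
    using A by measurable
  note * = W_increment_independent[OF assms(1-3) A2 square_integrableD(2)[OF A(2)],
      where h = "\<lambda>x. x\<^sup>2"]
  have "(\<lambda>\<omega>. A \<omega> * (W t \<omega> - W s \<omega>)) \<in> borel_measurable M"
    using W_increment_moments(1)[OF assms(1-3)] square_integrableD(1)[OF A(2)]
    by (intro borel_measurable_times) auto
  then show "square_integrable M (\<lambda>\<omega>. A \<omega> * (W t \<omega> - W s \<omega>))"
    using * W_increment_moments[OF assms(1-3)]
    by (simp add: square_integrable_def power_mult_distrib)
  show "expectation (\<lambda>\<omega>. (A \<omega> * (W t \<omega> - W s \<omega>))\<^sup>2) = expectation (\<lambda>\<omega>. (A \<omega>)\<^sup>2) * (t - s)"
    using * W_increment_moments[OF assms(1-3)] by (simp add: power_mult_distrib)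
qed

lemma square_integrable_mult_bounded:
  assumes "square_integrable M A" and "\<xi> \<in> borel_measurable M" and "\<And>\<omega>. \<omega> \<in> space M \<Longrightarrow> \<bar>\<xi> \<omega>\<bar> \<le> K"
  shows "square_integrable M (\<lambda>\<omega>. A \<omega> * \<xi> \<omega>)"
  unfolding square_integrable_def
proof
  show m: "(\<lambda>\<omega>. A \<omega> * \<xi> \<omega>) \<in> borel_measurable M"
    using assms(2) square_integrableD(1)[OF assms(1)] by (rule_tac borel_measurable_times)
  show "integrable M (\<lambda>\<omega>. (A \<omega> * \<xi> \<omega>)\<^sup>2)"
  proof (rule Bochner_Integration.integrable_bound)
    show "integrable M (\<lambda>\<omega>. K\<^sup>2 * (A \<omega>)\<^sup>2)"
      using assms(1) by (simp add: square_integrableD)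
    show "(\<lambda>\<omega>. (A \<omega> * \<xi> \<omega>)\<^sup>2) \<in> borel_measurable M"
      using m by measurable
    have "(A \<omega> * \<xi> \<omega>)\<^sup>2 \<le> K\<^sup>2 * (A \<omega>)\<^sup>2" if "\<omega> \<in> space M" for \<omega>
      using power_mono[OF assms(3)[OF that], of 2]
      by (simp add: power_mult_distrib mult.commute[of "K\<^sup>2"] mult_left_mono)
    then show "AE \<omega> in M. norm ((A \<omega> * \<xi> \<omega>)\<^sup>2) \<le> norm (K\<^sup>2 * (A \<omega>)\<^sup>2)"
      by (intro AE_I2) simp
  qed
qed


lemma elementary_measurable:
  assumes "elementary M F T n \<tau> \<xi>" and "i < n" and "\<tau> i \<le> t"
  shows "\<xi> i \<in> borel_measurable (F t)"
  using assms by (intro adapted_mono[OF assms(3)]) (simp add: elementary_def)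

lemma elementary_bounded:
  assumes "elementary M F T n \<tau> \<xi>" and "i < n"
  obtains K where "\<And>\<omega>. \<omega> \<in> space M \<Longrightarrow> \<bar>\<xi> i \<omega>\<bar> \<le> K"
proof -
  from assms obtain K where "\<forall>\<omega>\<in>space M. \<bar>\<xi> i \<omega>\<bar> \<le> K"
    unfolding elementary_def by blast
  then show thesis
    using that[of K] by blast
qed

lemma elementary_square_integrable:
  assumes "elementary M F T n \<tau> \<xi>" and "i < n"
  shows "square_integrable M (\<xi> i)"
proof -
  obtain K where "\<And>\<omega>. \<omega> \<in> space M \<Longrightarrow> \<bar>\<xi> i \<omega>\<bar> \<le> K"
    using elementary_bounded[OF assms] by blast
  moreover have "\<xi> i \<in> borel_measurable M"
    using adapted_measurable elementary_measurable[OF assms order_refl] .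
  ultimately show ?thesis
    using square_integrable_mult_bounded[of "\<lambda>_. 1" "\<xi> i" K]
    by (simp add: square_integrable_const finite_measure_axioms)
qed

text \<open>Stated for partial sums, because the isometry is proved by induction over the summands.\<close>

lemma elementary_integral_adapted:
  assumes el: "elementary M F T n \<tau> \<xi>" and "0 \<le> t" and "t \<le> T" and "k \<le> n"
  shows "(\<lambda>\<omega>. \<Sum>i<k. \<xi> i \<omega> * (W (min t (\<tau> (Suc i))) \<omega> - W (min t (\<tau> i)) \<omega>))
      \<in> borel_measurable (F (min t (\<tau> k)))" (is ?m)
    and "square_integrable M (\<lambda>\<omega>. \<Sum>i<k. \<xi> i \<omega> * (W (min t (\<tau> (Suc i))) \<omega> - W (min t (\<tau> i)) \<omega>))" (is ?i)
proof -
  have "(\<lambda>\<omega>. \<xi> i \<omega> * (W (min t (\<tau> (Suc i))) \<omega> - W (min t (\<tau> i)) \<omega>)) \<in> borel_measurable (F (min t (\<tau> k))) \<and>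
      square_integrable M (\<lambda>\<omega>. \<xi> i \<omega> * (W (min t (\<tau> (Suc i))) \<omega> - W (min t (\<tau> i)) \<omega>))" if i: "i < k" for i
  proof (cases "\<tau> i \<le> t")
    case False
    then have "min t (\<tau> i) = t" "min t (\<tau> (Suc i)) = t"
      using elementary_mono[OF el, of i "Suc i"] i \<open>k \<le> n\<close> by auto
    then show ?thesis
      by (simp add: square_integrable_def)
  next
    case True
    have i': "i < n" "Suc i \<le> n" "\<tau> (Suc i) \<le> \<tau> k" "\<tau> i \<le> \<tau> (Suc i)" "\<tau> i \<le> \<tau> k" "0 \<le> \<tau> i"
      using i \<open>k \<le> n\<close> by (auto intro!: elementary_mono[OF el] elementary_range[OF el])
    have "(\<lambda>\<omega>. \<xi> i \<omega> * (W (min t (\<tau> (Suc i))) \<omega> - W (min t (\<tau> i)) \<omega>)) \<in> borel_measurable (F (min t (\<tau> k)))"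
      using i' True assms
      by (intro borel_measurable_times borel_measurable_diff elementary_measurable[OF el]
          adapted_mono[OF _ W_measurable]) auto
    moreover have "square_integrable M (\<lambda>\<omega>. \<xi> i \<omega> * (W (min t (\<tau> (Suc i))) \<omega> - W (min t (\<tau> i)) \<omega>))"
      using i' True assms
      by (intro square_integrable_mult_increment elementary_measurable[OF el] elementary_square_integrable[OF el]) auto
    ultimately show ?thesis ..
  qed
  then show ?m ?i
    by (auto intro!: borel_measurable_sum square_integrable_sum)
qed

lemma elementary_integral_square_integrable:
  assumes "elementary M F T n \<tau> \<xi>" and "0 \<le> t" and "t \<le> T"
  shows "square_integrable M (elementary_integral W n \<tau> \<xi> t)"
  using elementary_integral_adapted(2)[OF assms order_refl] by (simp add: elementary_integral_def[abs_def])

text \<open>The martingale property. The increment over \<open>[s, t]\<close> is the sum of \<open>\<xi> i\<close> times the Brownian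
  increments between the time points clamped to \<open>[s, t]\<close>; each of these starts no earlier than \<open>s\<close>
  and, unless it vanishes, no earlier than \<open>\<tau> i\<close>, so it is independent of both factors in front.\<close>

lemma elementary_integral_orthogonal:
  assumes el: "elementary M F T n \<tau> \<xi>" and st: "0 \<le> s" "s \<le> t" "t \<le> T"
    and A: "A \<in> borel_measurable (F s)" "square_integrable M A"
  shows "expectation (\<lambda>\<omega>. A \<omega> * elementary_integral W n \<tau> \<xi> t \<omega>) =
    expectation (\<lambda>\<omega>. A \<omega> * elementary_integral W n \<tau> \<xi> s \<omega>)"
proof -
  let ?u = "\<lambda>i. max s (min t (\<tau> i))"
  have clamp: "elementary_integral W n \<tau> \<xi> t \<omega> - elementary_integral W n \<tau> \<xi> s \<omega> =
      (\<Sum>i<n. \<xi> i \<omega> * (W (?u (Suc i)) \<omega> - W (?u i) \<omega>))" for \<omega>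
    unfolding elementary_integral_def sum_subtractf[symmetric]
  proof (rule sum.cong)
    fix i assume "i \<in> {..<n}"
    then have "\<tau> i \<le> \<tau> (Suc i)"
      by (auto intro!: elementary_mono[OF el])
    then consider "\<tau> (Suc i) \<le> s" | "\<tau> i \<le> s" "s \<le> \<tau> (Suc i)" | "s \<le> \<tau> i" "s \<le> \<tau> (Suc i)"
      by linarith
    then have "(W (min t (\<tau> (Suc i))) \<omega> - W (min t (\<tau> i)) \<omega>) -
        (W (min s (\<tau> (Suc i))) \<omega> - W (min s (\<tau> i)) \<omega>) = W (?u (Suc i)) \<omega> - W (?u i) \<omega>"
      using st \<open>\<tau> i \<le> \<tau> (Suc i)\<close> by cases (simp_all add: min_def max_def)
    then show "\<xi> i \<omega> * (W (min t (\<tau> (Suc i))) \<omega> - W (min t (\<tau> i)) \<omega>) -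
        \<xi> i \<omega> * (W (min s (\<tau> (Suc i))) \<omega> - W (min s (\<tau> i)) \<omega>) =
        \<xi> i \<omega> * (W (?u (Suc i)) \<omega> - W (?u i) \<omega>)"
      by (simp add: right_diff_distrib[symmetric])
  qed simp
  have summand: "integrable M (\<lambda>\<omega>. A \<omega> * \<xi> i \<omega> * (W (?u (Suc i)) \<omega> - W (?u i) \<omega>)) \<and>
      expectation (\<lambda>\<omega>. A \<omega> * \<xi> i \<omega> * (W (?u (Suc i)) \<omega> - W (?u i) \<omega>)) = 0" if i: "i < n" for i
  proof (cases "?u (Suc i) = ?u i")
    case True
    show ?thesis
      unfolding True by simp
  next
    case False
    have mono: "\<tau> i \<le> \<tau> (Suc i)" and range: "\<tau> (Suc i) \<le> T"
      using i by (auto intro!: elementary_mono[OF el] elementary_range[OF el])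
    have u: "0 \<le> ?u i" "?u i \<le> ?u (Suc i)" "?u (Suc i) \<le> T" "\<tau> i \<le> ?u i" "s \<le> ?u i"
      using st mono range False by (auto simp: min_def max_def split: if_splits)
    have m: "(\<lambda>\<omega>. A \<omega> * \<xi> i \<omega>) \<in> borel_measurable (F (?u i))"
      by (intro borel_measurable_times elementary_measurable[OF el i] adapted_mono[OF _ A(1)] u)
    have "integrable M (\<lambda>\<omega>. A \<omega> * \<xi> i \<omega>)"
      by (intro integrable_mult_square_integrable A elementary_square_integrable[OF el i])
    then show ?thesis
      by (intro conjI W_increment_orthogonal u m)
  qed
  have J: "integrable M (\<lambda>\<omega>. A \<omega> * elementary_integral W n \<tau> \<xi> r \<omega>)" if "0 \<le> r" "r \<le> T" for r
    by (rule integrable_mult_square_integrable[OF A(2) elementary_integral_square_integrable[OF el that]])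
  have "expectation (\<lambda>\<omega>. A \<omega> * elementary_integral W n \<tau> \<xi> t \<omega>) -
      expectation (\<lambda>\<omega>. A \<omega> * elementary_integral W n \<tau> \<xi> s \<omega>) =
      expectation (\<lambda>\<omega>. A \<omega> * (elementary_integral W n \<tau> \<xi> t \<omega> - elementary_integral W n \<tau> \<xi> s \<omega>))"
    using J[of s] J[of t] st by (simp add: right_diff_distrib)
  also have "\<dots> = expectation (\<lambda>\<omega>. \<Sum>i<n. A \<omega> * \<xi> i \<omega> * (W (?u (Suc i)) \<omega> - W (?u i) \<omega>))"
    unfolding clamp by (simp add: sum_distrib_left mult.assoc)
  also have "\<dots> = (\<Sum>i<n. expectation (\<lambda>\<omega>. A \<omega> * \<xi> i \<omega> * (W (?u (Suc i)) \<omega> - W (?u i) \<omega>)))"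
    by (rule Bochner_Integration.integral_sum) (use summand in blast)
  also have "\<dots> = 0"
    by (rule sum.neutral) (use summand in blast)
  finally show ?thesis
    by simp
qed

lemma elementary_integral_square:
  assumes el: "elementary M F T n \<tau> \<xi>" and t: "0 \<le> t" "t \<le> T"
  shows "expectation (\<lambda>\<omega>. (elementary_integral W n \<tau> \<xi> t \<omega>)\<^sup>2) =
    (\<Sum>i<n. expectation (\<lambda>\<omega>. (\<xi> i \<omega>)\<^sup>2) * (min t (\<tau> (Suc i)) - min t (\<tau> i)))"
proof -
  define D where "D i \<omega> = W (min t (\<tau> (Suc i))) \<omega> - W (min t (\<tau> i)) \<omega>" for i \<omega>
  define S where "S k \<omega> = (\<Sum>i<k. \<xi> i \<omega> * D i \<omega>)" for k \<omega>
  have S: "S k \<in> borel_measurable (F (min t (\<tau> k)))" "square_integrable M (S k)" if "k \<le> n" for k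
    using elementary_integral_adapted[OF el t that] by (simp_all add: S_def[abs_def] D_def)
  have "expectation (\<lambda>\<omega>. (S k \<omega>)\<^sup>2) =
    (\<Sum>i<k. expectation (\<lambda>\<omega>. (\<xi> i \<omega>)\<^sup>2) * (min t (\<tau> (Suc i)) - min t (\<tau> i)))" if "k \<le> n" for k
    using that
  proof (induction k)
    case 0
    then show ?case
      by (simp add: S_def)
  next
    case (Suc k)
    then have k: "k < n" "k \<le> n"
      by auto
    have u: "0 \<le> min t (\<tau> k)" "min t (\<tau> k) \<le> min t (\<tau> (Suc k))" "min t (\<tau> (Suc k)) \<le> T"
      using t k elementary_mono[OF el, of k "Suc k"] elementary_range[OF el, of k] by auto
    have step: "square_integrable M (\<lambda>\<omega>. \<xi> k \<omega> * D k \<omega>) \<and>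
        expectation (\<lambda>\<omega>. (\<xi> k \<omega> * D k \<omega>)\<^sup>2) =
          expectation (\<lambda>\<omega>. (\<xi> k \<omega>)\<^sup>2) * (min t (\<tau> (Suc k)) - min t (\<tau> k)) \<and>
        expectation (\<lambda>\<omega>. S k \<omega> * (\<xi> k \<omega> * D k \<omega>)) = 0"
    proof (cases "\<tau> k \<le> t")
      case True
      have \<xi>: "\<xi> k \<in> borel_measurable (F (min t (\<tau> k)))" "square_integrable M (\<xi> k)"
        using True k by (auto intro!: elementary_measurable[OF el] elementary_square_integrable[OF el])
      have "(\<lambda>\<omega>. S k \<omega> * \<xi> k \<omega>) \<in> borel_measurable (F (min t (\<tau> k)))"
        by (intro borel_measurable_times S k \<xi>)
      moreover have "integrable M (\<lambda>\<omega>. S k \<omega> * \<xi> k \<omega>)"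
        by (intro integrable_mult_square_integrable S k \<xi>)
      ultimately have "expectation (\<lambda>\<omega>. S k \<omega> * \<xi> k \<omega> * D k \<omega>) = 0"
        unfolding D_def by (rule W_increment_orthogonal(2)[OF u])
      then show ?thesis
        using square_integrable_mult_increment[OF u \<xi>] by (simp add: D_def mult.assoc)
    next
      case False
      then have "min t (\<tau> k) = t" "min t (\<tau> (Suc k)) = t"
        using elementary_mono[OF el, of k "Suc k"] k by auto
      then show ?thesis
        by (simp add: D_def square_integrable_def)
    qed
    have "(\<lambda>\<omega>. (S (Suc k) \<omega>)\<^sup>2) = (\<lambda>\<omega>. (S k \<omega>)\<^sup>2 + 2 * (S k \<omega> * (\<xi> k \<omega> * D k \<omega>)) + (\<xi> k \<omega> * D k \<omega>)\<^sup>2)"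
      by (simp add: S_def power2_eq_square algebra_simps)
    moreover have "integrable M (\<lambda>\<omega>. S k \<omega> * (\<xi> k \<omega> * D k \<omega>))"
      using step S(2)[OF k(2)] by (intro integrable_mult_square_integrable) auto
    ultimately have "expectation (\<lambda>\<omega>. (S (Suc k) \<omega>)\<^sup>2) =
        expectation (\<lambda>\<omega>. (S k \<omega>)\<^sup>2) + expectation (\<lambda>\<omega>. (\<xi> k \<omega> * D k \<omega>)\<^sup>2)"
      using step S(2)[OF k(2)] by (simp add: square_integrableD)
    then show ?case
      using step Suc.IH k by simp
  qed
  from this[OF order_refl] show ?thesis
    by (simp add: S_def D_def elementary_integral_def)
qed

text \<open>The Ito isometry: both sides are the sum of \<open>E (\<xi> i)\<^sup>2\<close> times the length of the part of the
  interval \<open>(\<tau> i, \<tau> (i + 1)]\<close> before \<open>t\<close>. It lives on the product of the sample space with Lebesgue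
  measure, where the convergence of integrands takes place.\<close>

lemma elementary_isometry:
  assumes el: "elementary M F T n \<tau> \<xi>" and t: "0 \<le> t" "t \<le> T"
  shows "square_integrable (M \<Otimes>\<^sub>M lborel) (\<lambda>(\<omega>, s). indicator {0..t} s * elementary_process n \<tau> \<xi> s \<omega>)"
    and "(\<integral>p. (case p of (\<omega>, s) \<Rightarrow> indicator {0..t} s * elementary_process n \<tau> \<xi> s \<omega>)\<^sup>2 \<partial>(M \<Otimes>\<^sub>M lborel)) =
      expectation (\<lambda>\<omega>. (elementary_integral W n \<tau> \<xi> t \<omega>)\<^sup>2)"
proof -
  let ?f = "\<lambda>(\<omega>, s). indicator {0..t} s * elementary_process n \<tau> \<xi> s \<omega>"
  let ?d = "\<lambda>i. min t (\<tau> (Suc i)) - min t (\<tau> i)"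
  have \<xi>[measurable]: "\<xi> i \<in> borel_measurable M" if "i < n" for i
    using square_integrableD(1)[OF elementary_square_integrable[OF el that]] .
  have meas: "?f \<in> borel_measurable (M \<Otimes>\<^sub>M lborel)"
    unfolding elementary_process_def by measurable
  have d: "0 \<le> ?d i" if "i < n" for i
    using elementary_mono[OF el, of i "Suc i"] that by auto
  have sq: "(?f (\<omega>, s))\<^sup>2 = (\<Sum>i<n. (\<xi> i \<omega>)\<^sup>2 * indicator {\<tau> i<..min t (\<tau> (Suc i))} s)" for \<omega> s
  proof -
    have "indicator {0..t} s * indicator {\<tau> i<..\<tau> (Suc i)} s = (indicator {\<tau> i<..min t (\<tau> (Suc i))} s :: real)"
      if "i < n" for i
      using elementary_range(1)[OF el, of i] that by (auto simp: indicator_def)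
    moreover have "(?f (\<omega>, s))\<^sup>2 = (\<Sum>i<n. (\<xi> i \<omega>)\<^sup>2 * (indicator {0..t} s * indicator {\<tau> i<..\<tau> (Suc i)} s))"
    proof -
      have "(indicator {0..t} s :: real)\<^sup>2 = indicator {0..t} s"
        by (simp add: indicator_def)
      then have "(?f (\<omega>, s))\<^sup>2 = indicator {0..t} s * (elementary_process n \<tau> \<xi> s \<omega>)\<^sup>2"
        by (simp add: power_mult_distrib)
      then show ?thesis
        unfolding elementary_process_square[OF el] sum_distrib_left
        by (simp only: mult.left_commute[of "indicator {0..t} s"])
    qed
    ultimately show ?thesis
      by simp
  qed
  have len: "(\<integral>\<^sup>+s. ennreal ((\<xi> i \<omega>)\<^sup>2 * indicator {\<tau> i<..min t (\<tau> (Suc i))} s) \<partial>lborel) =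
      ennreal ((\<xi> i \<omega>)\<^sup>2 * ?d i)" if "i < n" for i \<omega>
  proof -
    have "emeasure lborel {\<tau> i<..min t (\<tau> (Suc i))} = ennreal (?d i)"
      using elementary_mono[OF el, of i "Suc i"] that by (cases "\<tau> i \<le> t") auto
    then show ?thesis
      by (simp add: ennreal_mult' ennreal_indicator nn_integral_cmult)
  qed
  have "(\<integral>\<^sup>+p. ennreal ((?f p)\<^sup>2) \<partial>(M \<Otimes>\<^sub>M lborel)) = (\<integral>\<^sup>+\<omega>. \<integral>\<^sup>+s. ennreal ((?f (\<omega>, s))\<^sup>2) \<partial>lborel \<partial>M)"
    by (rule lborel.nn_integral_fst[symmetric]) (use meas in measurable)
  also have "\<dots> = (\<integral>\<^sup>+\<omega>. (\<Sum>i<n. ennreal ((\<xi> i \<omega>)\<^sup>2 * ?d i)) \<partial>M)"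
  proof (rule nn_integral_cong)
    fix \<omega>
    have "(\<integral>\<^sup>+s. ennreal ((?f (\<omega>, s))\<^sup>2) \<partial>lborel) =
        (\<integral>\<^sup>+s. (\<Sum>i<n. ennreal ((\<xi> i \<omega>)\<^sup>2 * indicator {\<tau> i<..min t (\<tau> (Suc i))} s)) \<partial>lborel)"
      unfolding sq by (simp add: sum_ennreal)
    also have "\<dots> = (\<Sum>i<n. ennreal ((\<xi> i \<omega>)\<^sup>2 * ?d i))"
      by (subst nn_integral_sum) (auto simp: len)
    finally show "(\<integral>\<^sup>+s. ennreal ((?f (\<omega>, s))\<^sup>2) \<partial>lborel) = (\<Sum>i<n. ennreal ((\<xi> i \<omega>)\<^sup>2 * ?d i))" .
  qed
  also have "\<dots> = (\<Sum>i<n. \<integral>\<^sup>+\<omega>. ennreal ((\<xi> i \<omega>)\<^sup>2 * ?d i) \<partial>M)"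
    by (subst nn_integral_sum) auto
  also have "\<dots> = (\<Sum>i<n. ennreal (expectation (\<lambda>\<omega>. (\<xi> i \<omega>)\<^sup>2) * ?d i))"
  proof (rule sum.cong)
    fix i assume i: "i \<in> {..<n}"
    then have "integrable M (\<lambda>\<omega>. (\<xi> i \<omega>)\<^sup>2 * ?d i)"
      using elementary_square_integrable[OF el, of i] by (simp add: square_integrableD)
    then show "(\<integral>\<^sup>+\<omega>. ennreal ((\<xi> i \<omega>)\<^sup>2 * ?d i) \<partial>M) = ennreal (expectation (\<lambda>\<omega>. (\<xi> i \<omega>)\<^sup>2) * ?d i)"
      using i d[of i] by (subst nn_integral_eq_integral) auto
  qed simp
  also have "\<dots> = ennreal (expectation (\<lambda>\<omega>. (elementary_integral W n \<tau> \<xi> t \<omega>)\<^sup>2))"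
    unfolding elementary_integral_square[OF el t] using d by (intro sum_ennreal) simp
  finally have "has_bochner_integral (M \<Otimes>\<^sub>M lborel) (\<lambda>p. (?f p)\<^sup>2)
      (expectation (\<lambda>\<omega>. (elementary_integral W n \<tau> \<xi> t \<omega>)\<^sup>2))"
    using meas by (intro has_bochner_integral_nn_integral) auto
  with meas show "square_integrable (M \<Otimes>\<^sub>M lborel) ?f"
    and "(\<integral>p. (?f p)\<^sup>2 \<partial>(M \<Otimes>\<^sub>M lborel)) = expectation (\<lambda>\<omega>. (elementary_integral W n \<tau> \<xi> t \<omega>)\<^sup>2)"
    by (auto simp: square_integrable_def has_bochner_integral_iff)
qed

end

section \<open>The Ito integral and measurability of continuous processes\<close>

context brownian_basis
begin

text \<open>Everything that is needed about the Ito integral survives the mean-square limit from elementary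
  integrals; the mean is zero because the increments are orthogonal to constants and the elementary
  integrals start at zero.\<close>

lemma ito_integral_properties:
  assumes "0 < T" and ito: "has_ito_integral M F T W H I" and t\<^sub>0: "t\<^sub>0 \<in> {0..T}"
  shows "square_integrable M (I t\<^sub>0)"
    and "square_integrable (M \<Otimes>\<^sub>M lborel) (\<lambda>(\<omega>, s). indicator {0..t\<^sub>0} s * H s \<omega>)"
    and "0 \<le> s \<Longrightarrow> s \<le> t\<^sub>0 \<Longrightarrow> A \<in> borel_measurable (F s) \<Longrightarrow> square_integrable M A \<Longrightarrow>
      expectation (\<lambda>\<omega>. A \<omega> * I t\<^sub>0 \<omega>) = expectation (\<lambda>\<omega>. A \<omega> * I s \<omega>)"
    and "expectation (\<lambda>\<omega>. (I t\<^sub>0 \<omega>)\<^sup>2) =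
      (\<integral>p. (case p of (\<omega>, s) \<Rightarrow> indicator {0..t\<^sub>0} s * H s \<omega>)\<^sup>2 \<partial>(M \<Otimes>\<^sub>M lborel))"
    and "expectation (I t\<^sub>0) = 0"
proof -
  from ito obtain n \<tau> \<xi> where el: "\<And>k. elementary M F T (n k) (\<tau> k) (\<xi> k)"
    and Hlim: "(\<lambda>k. \<integral>\<^sup>+\<omega>. (\<integral>\<^sup>+s\<in>{0..T}.
              ennreal ((H s \<omega> - elementary_process (n k) (\<tau> k) (\<xi> k) s \<omega>)\<^sup>2) \<partial>lborel) \<partial>M)
          \<longlonglongrightarrow> 0"
    and Ilim: "\<And>t. t \<in> {0..T} \<Longrightarrow> (\<lambda>k. \<integral>\<^sup>+\<omega>.
              ennreal ((I t \<omega> - elementary_integral W (n k) (\<tau> k) (\<xi> k) t \<omega>)\<^sup>2) \<partial>M)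
             \<longlonglongrightarrow> 0"
    and prog: "progressive F T H" and cont: "continuous_adapted M F T I"
    unfolding has_ito_integral_def by blast
  let ?J = "\<lambda>k. elementary_integral W (n k) (\<tau> k) (\<xi> k)"
  let ?E = "\<lambda>k. elementary_process (n k) (\<tau> k) (\<xi> k)"
  have It: "I t \<in> borel_measurable (F t)" if "t \<in> {0..T}" for t
    using cont that by (auto simp: continuous_adapted_def)
  have J: "square_integrable M (?J k t)" if "t \<in> {0..T}" for k t
    using elementary_integral_square_integrable[OF el] that by auto
  note I = square_integrable_limit[OF J adapted_measurable[OF It] Ilim]
  from I(1)[OF t\<^sub>0 t\<^sub>0 t\<^sub>0] show "square_integrable M (I t\<^sub>0)" .
  have orth: "expectation (\<lambda>\<omega>. A \<omega> * I t \<omega>) = expectation (\<lambda>\<omega>. A \<omega> * I s \<omega>)"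
    if st: "0 \<le> s" "s \<le> t" "t \<le> T" and A: "A \<in> borel_measurable (F s)" "square_integrable M A" for s t A
  proof -
    have "(\<lambda>k. expectation (\<lambda>\<omega>. A \<omega> * ?J k t \<omega>)) \<longlonglongrightarrow> expectation (\<lambda>\<omega>. A \<omega> * I t \<omega>)"
      using st by (intro I(2) A) auto
    moreover have "(\<lambda>k. expectation (\<lambda>\<omega>. A \<omega> * ?J k s \<omega>)) \<longlonglongrightarrow> expectation (\<lambda>\<omega>. A \<omega> * I s \<omega>)"
      using st by (intro I(2) A) auto
    ultimately show ?thesis
      unfolding elementary_integral_orthogonal[OF el st A] by (rule LIMSEQ_unique)
  qed
  show "expectation (\<lambda>\<omega>. A \<omega> * I t\<^sub>0 \<omega>) = expectation (\<lambda>\<omega>. A \<omega> * I s \<omega>)"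
    if "0 \<le> s" "s \<le> t\<^sub>0" "A \<in> borel_measurable (F s)" "square_integrable M A"
    using that t\<^sub>0 by (intro orth) auto
  have one: "square_integrable M (\<lambda>_. 1)"
    by (simp add: square_integrable_const finite_measure_axioms)
  have "(\<lambda>k. expectation (\<lambda>\<omega>. 1 * ?J k 0 \<omega>)) \<longlonglongrightarrow> expectation (\<lambda>\<omega>. 1 * I 0 \<omega>)"
    using \<open>0 < T\<close> by (intro I(2) one) auto
  moreover have "?J k 0 \<omega> = 0" for k \<omega>
    using elementary_range(1)[OF el] by (simp add: elementary_integral_def min_absorb1)
  ultimately have "expectation (I 0) = 0"
    by (simp add: LIMSEQ_const_iff)
  then show "expectation (I t\<^sub>0) = 0"
    using orth[of 0 t\<^sub>0 "\<lambda>_. 1"] t\<^sub>0 one by simp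
  have H: "square_integrable (M \<Otimes>\<^sub>M lborel) (\<lambda>(\<omega>, s). indicator {0..t} s * H s \<omega>) \<and>
    (\<lambda>k. \<integral>p. (case p of (\<omega>, s) \<Rightarrow> indicator {0..t} s * ?E k s \<omega>)\<^sup>2 \<partial>(M \<Otimes>\<^sub>M lborel)) \<longlonglongrightarrow>
      (\<integral>p. (case p of (\<omega>, s) \<Rightarrow> indicator {0..t} s * H s \<omega>)\<^sup>2 \<partial>(M \<Otimes>\<^sub>M lborel))"
    if t: "t \<in> {0..T}" for t
  proof -
    let ?H = "\<lambda>(\<omega>, s). indicator {0..t} s * H s \<omega>"
    let ?F = "\<lambda>k (\<omega>, s). indicator {0..t} s * ?E k s \<omega>"
    \<comment> \<open>clamping the time to the horizon extends the progressive process to the whole line\<close>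
    have a: "(\<lambda>(s, \<omega>). H s \<omega>) \<in> borel_measurable (restrict_space borel {0..T} \<Otimes>\<^sub>M F T)"
      using prog \<open>0 < T\<close> by (auto simp: progressive_def)
    have b: "(\<lambda>p. (max 0 (min T (snd p)), fst p)) \<in> M \<Otimes>\<^sub>M lborel \<rightarrow>\<^sub>M restrict_space borel {0..T} \<Otimes>\<^sub>M F T"
    proof (rule measurable_Pair)
      show "(\<lambda>p. max 0 (min T (snd p))) \<in> M \<Otimes>\<^sub>M lborel \<rightarrow>\<^sub>M restrict_space borel {0..T}"
        using \<open>0 < T\<close> by (intro measurable_restrict_space2) auto
      have "fst \<in> M \<Otimes>\<^sub>M lborel \<rightarrow>\<^sub>M M"
        by simp
      then show "(\<lambda>p. fst p) \<in> M \<Otimes>\<^sub>M lborel \<rightarrow>\<^sub>M F T"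
        using filtration_subalgebra[of T] by (auto simp: measurable_def subalgebra_def)
    qed
    from measurable_compose[OF b a]
    have "(\<lambda>p. H (max 0 (min T (snd p))) (fst p)) \<in> borel_measurable (M \<Otimes>\<^sub>M lborel)"
      by (simp only: prod.case)
    then have "(\<lambda>p. indicator {0..t} (snd p) * H (max 0 (min T (snd p))) (fst p)) \<in> borel_measurable (M \<Otimes>\<^sub>M lborel)"
      by measurable
    also have "(\<lambda>p. indicator {0..t} (snd p) * H (max 0 (min T (snd p))) (fst p)) = ?H"
      using t by (auto simp: fun_eq_iff indicator_def)
    finally have Hm: "?H \<in> borel_measurable (M \<Otimes>\<^sub>M lborel)" .
    have Fi: "square_integrable (M \<Otimes>\<^sub>M lborel) (?F k)" for k
      using elementary_isometry(1)[OF el] t by auto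
    have "(\<lambda>k. \<integral>\<^sup>+p. ennreal ((?H p - ?F k p)\<^sup>2) \<partial>(M \<Otimes>\<^sub>M lborel)) \<longlonglongrightarrow> 0"
    proof (rule tendsto_sandwich[OF _ _ tendsto_const Hlim])
      show "\<forall>\<^sub>F k in sequentially. (\<integral>\<^sup>+p. ennreal ((?H p - ?F k p)\<^sup>2) \<partial>(M \<Otimes>\<^sub>M lborel)) \<le>
        (\<integral>\<^sup>+\<omega>. (\<integral>\<^sup>+s\<in>{0..T}. ennreal ((H s \<omega> - ?E k s \<omega>)\<^sup>2) \<partial>lborel) \<partial>M)"
      proof (intro always_eventually allI)
        fix k
        have "(\<integral>\<^sup>+p. ennreal ((?H p - ?F k p)\<^sup>2) \<partial>(M \<Otimes>\<^sub>M lborel)) =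
            (\<integral>\<^sup>+\<omega>. \<integral>\<^sup>+s. ennreal ((?H (\<omega>, s) - ?F k (\<omega>, s))\<^sup>2) \<partial>lborel \<partial>M)"
          using Hm square_integrableD(1)[OF Fi[of k]] by (intro lborel.nn_integral_fst[symmetric] measurable_compose[OF _ measurable_ennreal]
              borel_measurable_power borel_measurable_diff)
        also have "\<dots> \<le> (\<integral>\<^sup>+\<omega>. (\<integral>\<^sup>+s\<in>{0..T}. ennreal ((H s \<omega> - ?E k s \<omega>)\<^sup>2) \<partial>lborel) \<partial>M)"
          using t by (intro nn_integral_mono) (auto simp: indicator_def)
        finally show "(\<integral>\<^sup>+p. ennreal ((?H p - ?F k p)\<^sup>2) \<partial>(M \<Otimes>\<^sub>M lborel)) \<le>
          (\<integral>\<^sup>+\<omega>. (\<integral>\<^sup>+s\<in>{0..T}. ennreal ((H s \<omega> - ?E k s \<omega>)\<^sup>2) \<partial>lborel) \<partial>M)" .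
      qed
    qed simp
    from square_integrable_limit(1,3)[OF Fi Hm this] show ?thesis
      by blast
  qed
  from this[OF t\<^sub>0] show "square_integrable (M \<Otimes>\<^sub>M lborel) (\<lambda>(\<omega>, s). indicator {0..t\<^sub>0} s * H s \<omega>)"
    by blast
  show "expectation (\<lambda>\<omega>. (I t\<^sub>0 \<omega>)\<^sup>2) =
      (\<integral>p. (case p of (\<omega>, s) \<Rightarrow> indicator {0..t\<^sub>0} s * H s \<omega>)\<^sup>2 \<partial>(M \<Otimes>\<^sub>M lborel))"
  proof (rule LIMSEQ_unique[OF I(3)[OF t\<^sub>0 t\<^sub>0 t\<^sub>0]])
    have "(\<integral>p. (case p of (\<omega>, s) \<Rightarrow> indicator {0..t\<^sub>0} s * ?E k s \<omega>)\<^sup>2 \<partial>(M \<Otimes>\<^sub>M lborel)) =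
        expectation (\<lambda>\<omega>. (?J k t\<^sub>0 \<omega>)\<^sup>2)" for k
      using elementary_isometry(2)[OF el] t\<^sub>0 by auto
    with H[OF t\<^sub>0] show "(\<lambda>k. expectation (\<lambda>\<omega>. (?J k t\<^sub>0 \<omega>)\<^sup>2)) \<longlonglongrightarrow>
      (\<integral>p. (case p of (\<omega>, s) \<Rightarrow> indicator {0..t\<^sub>0} s * H s \<omega>)\<^sup>2 \<partial>(M \<Otimes>\<^sub>M lborel))"
      by simp
  qed
qed

text \<open>A continuous process is the limit of the processes frozen at the grid points of mesh
  \<open>1 / (k + 1)\<close>, which take only countably many time values and so are jointly measurable.\<close>

lemma continuous_process_measurable_pair:
  fixes X :: "real \<Rightarrow> 'w \<Rightarrow> real"
  assumes "0 \<le> T" and X: "\<And>t. t \<in> {0..T} \<Longrightarrow> X t \<in> borel_measurable M"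
    and cont: "\<And>\<omega>. \<omega> \<in> space M \<Longrightarrow> continuous_on {0..T} (\<lambda>t. X t \<omega>)"
  shows "(\<lambda>(\<omega>, s). indicator {0..T} s * X s \<omega>) \<in> borel_measurable (M \<Otimes>\<^sub>M lborel)"
proof -
  define c where "c s = max 0 (min T s)" for s :: real
  have c: "c s \<in> {0..T}" for s
    using \<open>0 \<le> T\<close> by (auto simp: c_def)
  have [measurable]: "c \<in> borel_measurable borel"
    unfolding c_def[abs_def] by measurable
  have X': "X (c s) \<in> borel_measurable M" for s
    using X c .
  define f where "f k p = X (c (real_of_int \<lfloor>real (Suc k) * c (snd p)\<rfloor> / real (Suc k))) (fst p)"
    for k :: nat and p :: "'w \<times> real"
  have f: "f k \<in> borel_measurable (M \<Otimes>\<^sub>M lborel)" for k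
    unfolding f_def
  proof (rule measurable_compose_countable[
        where f = "\<lambda>i p. X (c (real_of_int i / real (Suc k))) (fst p)"])
    show "(\<lambda>p. X (c (real_of_int i / real (Suc k))) (fst p)) \<in> borel_measurable (M \<Otimes>\<^sub>M lborel)" for i :: int
      by (rule measurable_compose[OF measurable_fst X'])
    show "(\<lambda>p. \<lfloor>real (Suc k) * c (snd p)\<rfloor>) \<in> M \<Otimes>\<^sub>M lborel \<rightarrow>\<^sub>M count_space UNIV"
      by measurable
  qed
  have "(\<lambda>p. X (c (snd p)) (fst p)) \<in> borel_measurable (M \<Otimes>\<^sub>M lborel)"
  proof (rule borel_measurable_LIMSEQ_real[OF _ f])
    fix p :: "'w \<times> real" assume "p \<in> space (M \<Otimes>\<^sub>M lborel)"
    then have \<omega>: "fst p \<in> space M"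
      by (auto simp: space_pair_measure)
    let ?r = "\<lambda>k. real_of_int \<lfloor>real (Suc k) * c (snd p)\<rfloor> / real (Suc k)"
    have "?r \<longlonglongrightarrow> c (snd p)"
    proof (rule tendsto_sandwich)
      have "c (snd p) - 1 / real (Suc k) \<le> ?r k" for k
      proof -
        have "(real (Suc k) * c (snd p) - 1) / real (Suc k) \<le> ?r k"
          by (intro divide_right_mono) linarith+
        then show ?thesis
          by (simp add: diff_divide_distrib)
      qed
      then show "\<forall>\<^sub>F k in sequentially. c (snd p) - 1 / real (Suc k) \<le> ?r k"
        by simp
      have "?r k \<le> c (snd p)" for k
      proof -
        have "?r k \<le> (real (Suc k) * c (snd p)) / real (Suc k)"
          by (intro divide_right_mono) linarith+
        then show ?thesis
          by simp
      qed
      then show "\<forall>\<^sub>F k in sequentially. ?r k \<le> c (snd p)"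
        by simp
      have "(\<lambda>k. c (snd p) - 1 / real (Suc k)) \<longlonglongrightarrow> c (snd p) - 0"
        by (intro tendsto_intros LIMSEQ_Suc[OF lim_1_over_n])
      then show "(\<lambda>k. c (snd p) - 1 / real (Suc k)) \<longlonglongrightarrow> c (snd p)"
        by simp
    qed simp
    then have "(\<lambda>k. c (?r k)) \<longlonglongrightarrow> c (c (snd p))"
      unfolding c_def by (intro tendsto_intros)
    moreover have "c (c (snd p)) = c (snd p)"
      using c[of "snd p"] by (simp add: c_def)
    moreover have "continuous_on {0..T} (\<lambda>s. X s (fst p))"
      using cont[OF \<omega>] .
    ultimately show "(\<lambda>k. f k p) \<longlonglongrightarrow> X (c (snd p)) (fst p)"
      unfolding f_def using c by (intro continuous_on_tendsto_compose[of "{0..T}" "\<lambda>s. X s (fst p)"]) auto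
  qed
  then have "(\<lambda>p. indicator {0..T} (snd p) * X (c (snd p)) (fst p)) \<in> borel_measurable (M \<Otimes>\<^sub>M lborel)"
    by measurable
  also have "(\<lambda>p. indicator {0..T} (snd p) * X (c (snd p)) (fst p)) = (\<lambda>(\<omega>, s). indicator {0..T} s * X s \<omega>)"
    by (auto simp: fun_eq_iff indicator_def c_def)
  finally show ?thesis .
qed

end

section \<open>Moments of a linear stochastic differential equation\<close>

context brownian_basis
begin

interpretation time: pair_sigma_finite M "lborel :: real measure" ..

text \<open>Fubini's theorem in the forms in which it serves the moment equations.\<close>

lemma expectation_time_integral:
  fixes Z :: "real \<Rightarrow> 'w \<Rightarrow> real"
  assumes "integrable (M \<Otimes>\<^sub>M lborel) (\<lambda>(\<omega>, s). indicator {0..t} s * Z s \<omega>)"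
  shows "integrable M (\<lambda>\<omega>. LBINT s:{0..t}. Z s \<omega>)"
    and "expectation (\<lambda>\<omega>. LBINT s:{0..t}. Z s \<omega>) = (LBINT s:{0..t}. expectation (Z s))"
    and "set_integrable lborel {0..t} (\<lambda>s. expectation (Z s))"
    and "(\<integral>p. (case p of (\<omega>, s) \<Rightarrow> indicator {0..t} s * Z s \<omega>) \<partial>(M \<Otimes>\<^sub>M lborel)) =
      (LBINT s:{0..t}. expectation (Z s))"
  using time.integrable_fst[OF assms] time.Fubini_integral[OF assms] time.integrable_snd[OF assms]
    time.integral_snd[OF assms]
  by (simp_all add: set_lebesgue_integral_def set_integrable_def)

lemma integrable_time_product:
  fixes f :: "'w \<Rightarrow> real" and t :: real
  assumes f: "integrable M f"
  shows "integrable (M \<Otimes>\<^sub>M lborel) (\<lambda>(\<omega>, s). indicator {0..t} s * f \<omega>)"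
proof (rule time.Fubini_integrable)
  have [measurable]: "f \<in> borel_measurable M"
    using f by simp
  show "(\<lambda>(\<omega>, s). indicator {0..t} s * f \<omega>) \<in> borel_measurable (M \<Otimes>\<^sub>M lborel)"
    by measurable
  have ind: "integrable lborel (indicator {0..t} :: real \<Rightarrow> real)"
    by (simp add: integrable_indicator_iff emeasure_lborel_Icc_eq)
  have "(\<lambda>\<omega>. \<integral>s. norm (case (\<omega>, s) of (\<omega>, s) \<Rightarrow> indicator {0..t} s * f \<omega>) \<partial>lborel) =
      (\<lambda>\<omega>. measure lborel {0..t} * \<bar>f \<omega>\<bar>)"
    by (simp add: abs_mult)
  then show "integrable M (\<lambda>\<omega>. \<integral>s. norm (case (\<omega>, s) of (\<omega>, s) \<Rightarrow> indicator {0..t} s * f \<omega>) \<partial>lborel)"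
    using f by simp
  show "AE \<omega> in M. integrable lborel (\<lambda>s. case (\<omega>, s) of (\<omega>, s) \<Rightarrow> indicator {0..t} s * f \<omega>)"
    using ind by simp
qed

lemma square_integrable_time_integrable:
  fixes t :: real
  assumes "square_integrable (M \<Otimes>\<^sub>M lborel) (\<lambda>(\<omega>, s). indicator {0..t} s * Z s \<omega>)"
  shows "integrable (M \<Otimes>\<^sub>M lborel) (\<lambda>(\<omega>, s). indicator {0..t} s * Z s \<omega>)"
    and "integrable (M \<Otimes>\<^sub>M lborel) (\<lambda>(\<omega>, s). indicator {0..t} s * (Z s \<omega>)\<^sup>2)"
proof -
  have sq: "(indicator {0..t} s :: real)\<^sup>2 = indicator {0..t} s" for s :: real
    by (simp add: indicator_def)
  have "square_integrable (M \<Otimes>\<^sub>M lborel) (\<lambda>(\<omega>, s). indicator {0..t} s * 1)"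
    using integrable_time_product[of "\<lambda>_. 1"]
    by (simp add: square_integrable_def case_prod_beta' sq)
  from integrable_mult_square_integrable[OF this assms]
  show "integrable (M \<Otimes>\<^sub>M lborel) (\<lambda>(\<omega>, s). indicator {0..t} s * Z s \<omega>)"
    by (simp add: case_prod_beta' mult.assoc[symmetric] power2_eq_square[symmetric] sq)
  show "integrable (M \<Otimes>\<^sub>M lborel) (\<lambda>(\<omega>, s). indicator {0..t} s * (Z s \<omega>)\<^sup>2)"
    using square_integrableD(2)[OF assms] by (simp add: case_prod_beta' power_mult_distrib sq)
qed

lemma square_integrable_time_product_integrable:
  fixes t :: real
  assumes "square_integrable (M \<Otimes>\<^sub>M lborel) (\<lambda>(\<omega>, s). indicator {0..t} s * Y s \<omega>)"
    and "square_integrable (M \<Otimes>\<^sub>M lborel) (\<lambda>(\<omega>, s). indicator {0..t} s * Z s \<omega>)"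
  shows "integrable (M \<Otimes>\<^sub>M lborel) (\<lambda>(\<omega>, s). indicator {0..t} s * (Y s \<omega> * Z s \<omega>))"
proof -
  have "indicator {0..t} s * Y s \<omega> * (indicator {0..t} s * Z s \<omega>) = indicator {0..t} s * (Y s \<omega> * Z s \<omega>)"
    for s \<omega>
    by (simp add: indicator_def)
  with integrable_mult_square_integrable[OF assms] show ?thesis
    by (simp add: case_prod_beta')
qed

text \<open>With \<open>v t = E (Y t)\<^sup>2\<close>, \<open>C t = E (Y t * I t)\<close> and \<open>G t = E (I t)\<^sup>2\<close>, the decomposition
  \<open>Y = Z + I\<close> gives
  \<open>C = - a \<integral> C + G\<close>, \<open>E Z\<^sup>2 = y0\<^sup>2 - 2 a \<integral> (v - C)\<close> and \<open>v = E Z\<^sup>2 + 2 (C - G) + G\<close>. Here \<open>C\<close> drops out and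
  \<open>v = y0\<^sup>2 - 2 a \<integral> v + G\<close> remains, where \<open>G = \<integral> (b v + g)\<close> by the isometry.\<close>

theorem linear_sde_moments:
  fixes a b w x\<^sub>0 :: real and g :: "real \<Rightarrow> real"
  assumes T: "0 < T" and b: "0 < b" and gc: "continuous_on {0..T} g"
    and gn: "\<And>t. t \<in> {0..T} \<Longrightarrow> 0 \<le> g t"
    and sde: "sde_solution M F T W x\<^sub>0 (\<lambda>t x. - a * (x - w)) (\<lambda>t x. sqrt (b * (x - w)\<^sup>2 + g t)) X"
  shows "square_integrable M (\<lambda>\<omega>. X T \<omega> - w)"
    and "expectation (\<lambda>\<omega>. X T \<omega> - w) = exp (- a * T) * (x\<^sub>0 - w)"
    and "expectation (\<lambda>\<omega>. (X T \<omega> - w)\<^sup>2) = exp ((b - 2 * a) * T) *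
      ((x\<^sub>0 - w)\<^sup>2 + integral {0..T} (\<lambda>s. exp (- (b - 2 * a) * s) * g s))"
proof -
  define Y where "Y s \<omega> = X s \<omega> - w" for s \<omega>
  define H where "H s \<omega> = sqrt (b * (Y s \<omega>)\<^sup>2 + g s)" for s \<omega>
  define y0 where "y0 = x\<^sub>0 - w"
  from sde obtain I where ito: "has_ito_integral M F T W H I"
    and eq: "\<And>t. t \<in> {0..T} \<Longrightarrow> AE \<omega> in M. X t \<omega> = x\<^sub>0 + (LBINT s:{0..t}. - a * Y s \<omega>) + I t \<omega>"
    and Xc: "continuous_adapted M F T X"
    unfolding sde_solution_def H_def Y_def by blast
  note ito_L2 = ito_integral_properties(1)[OF T ito]
    and H_L2 = ito_integral_properties(2)[OF T ito]
    and ito_orth = ito_integral_properties(3)[OF T ito]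
    and ito_isometry = ito_integral_properties(4)[OF T ito]
    and ito_mean = ito_integral_properties(5)[OF T ito]
  have YF: "Y t \<in> borel_measurable (F t)" and Ym: "Y t \<in> borel_measurable M" if "t \<in> {0..T}" for t
  proof -
    have "X t \<in> borel_measurable (F t)"
      using Xc that by (simp add: continuous_adapted_def)
    then show "Y t \<in> borel_measurable (F t)"
      unfolding Y_def by measurable
    then show "Y t \<in> borel_measurable M"
      by (rule adapted_measurable)
  qed
  have Yc: "continuous_on {0..T} (\<lambda>s. Y s \<omega>)" if "\<omega> \<in> space M" for \<omega>
    using Xc that unfolding Y_def by (intro continuous_intros) (simp add: continuous_adapted_def)
  have restrict: "(\<lambda>(\<omega>, s). indicator {0..t} s * Z s \<omega>) \<in> borel_measurable (M \<Otimes>\<^sub>M lborel)"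
    if Z: "(\<lambda>(\<omega>, s). indicator {0..T} s * Z s \<omega>) \<in> borel_measurable (M \<Otimes>\<^sub>M lborel)"
      and t: "t \<in> {0..T}" for t and Z :: "real \<Rightarrow> 'w \<Rightarrow> real"
  proof -
    have "(\<lambda>p. indicator {0..t} (snd p) * (case p of (\<omega>, s) \<Rightarrow> indicator {0..T} s * Z s \<omega>))
        \<in> borel_measurable (M \<Otimes>\<^sub>M lborel)"
      using Z by measurable
    also have "(\<lambda>p. indicator {0..t} (snd p) * (case p of (\<omega>, s) \<Rightarrow> indicator {0..T} s * Z s \<omega>)) =
        (\<lambda>(\<omega>, s). indicator {0..t} s * Z s \<omega>)"
      using t by (auto simp: fun_eq_iff indicator_def)
    finally show ?thesis .
  qed
  have Hsq: "(H s \<omega>)\<^sup>2 = b * (Y s \<omega>)\<^sup>2 + g s" if "s \<in> {0..T}" for s \<omega>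
    using gn[OF that] b by (simp add: H_def)
  have Y_L2: "square_integrable (M \<Otimes>\<^sub>M lborel) (\<lambda>(\<omega>, s). indicator {0..t} s * Y s \<omega>)"
    if t: "t \<in> {0..T}" for t
    unfolding square_integrable_def
  proof
    show m: "(\<lambda>(\<omega>, s). indicator {0..t} s * Y s \<omega>) \<in> borel_measurable (M \<Otimes>\<^sub>M lborel)"
      by (rule restrict[OF continuous_process_measurable_pair t]) (use T Ym Yc in auto)
    show "integrable (M \<Otimes>\<^sub>M lborel) (\<lambda>p. (case p of (\<omega>, s) \<Rightarrow> indicator {0..t} s * Y s \<omega>)\<^sup>2)"
    proof (rule Bochner_Integration.integrable_bound)
      show "integrable (M \<Otimes>\<^sub>M lborel)
          (\<lambda>p. (1 / b) * (case p of (\<omega>, s) \<Rightarrow> indicator {0..t} s * H s \<omega>)\<^sup>2)"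
        using square_integrableD(2)[OF H_L2[OF t]] by (rule integrable_mult_right)
      show "(\<lambda>p. (case p of (\<omega>, s) \<Rightarrow> indicator {0..t} s * Y s \<omega>)\<^sup>2) \<in> borel_measurable (M \<Otimes>\<^sub>M lborel)"
        using m by (rule borel_measurable_power)
      have "(indicator {0..t} s * Y s \<omega>)\<^sup>2 \<le> (1 / b) * (indicator {0..t} s * H s \<omega>)\<^sup>2" for s \<omega>
      proof (cases "s \<in> {0..t}")
        case True
        then have "s \<in> {0..T}"
          using t by auto
        then show ?thesis
          using True Hsq[of s \<omega>] gn[of s] b by (simp add: field_simps)
      qed (simp add: b less_imp_le)
      then show "AE p in M \<Otimes>\<^sub>M lborel. norm ((case p of (\<omega>, s) \<Rightarrow> indicator {0..t} s * Y s \<omega>)\<^sup>2) \<le>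
          norm ((1 / b) * (case p of (\<omega>, s) \<Rightarrow> indicator {0..t} s * H s \<omega>)\<^sup>2)"
        using b by (auto intro!: AE_I2 simp: abs_mult)
    qed
  qed
  note Y_int = square_integrable_time_integrable[OF Y_L2]
  define U where "U t \<omega> = (LBINT s:{0..t}. Y s \<omega>)" for t \<omega>
  define Q where "Q \<omega> = (LBINT s:{0..T}. (Y s \<omega>)\<^sup>2)" for \<omega>
  have Q: "integrable M Q"
    unfolding Q_def using T by (intro expectation_time_integral(1) Y_int(2)) auto
  have Um: "U t \<in> borel_measurable M" if "t \<in> {0..T}" for t
    using expectation_time_integral(1)[OF Y_int(1)[OF that]] by (simp add: U_def[abs_def])
  \<comment> \<open>a square integrable bound that is uniform in time, by the Cauchy-Schwarz inequality\<close>
  have U_bound: "(U t \<omega>)\<^sup>2 \<le> T * Q \<omega>" if t: "t \<in> {0..T}" and \<omega>: "\<omega> \<in> space M" for t \<omega>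
  proof -
    have cont: "continuous_on {0..t} (\<lambda>s. Y s \<omega>)"
      using Yc[OF \<omega>] t by (auto intro: continuous_on_subset)
    have Yt: "set_integrable lborel {0..t} (\<lambda>s. Y s \<omega>)" and Yt2: "set_integrable lborel {0..t} (\<lambda>s. (Y s \<omega>)\<^sup>2)"
      by (intro borel_integrable_atLeastAtMost' cont continuous_intros)+
    have YT2: "set_integrable lborel {0..T} (\<lambda>s. (Y s \<omega>)\<^sup>2)"
      by (intro borel_integrable_atLeastAtMost' Yc \<omega> continuous_intros)
    have i2: "(indicator {0..t} s :: real)\<^sup>2 = indicator {0..t} s" for s :: real
      by (simp add: indicator_def)
    have "square_integrable lborel (\<lambda>s. indicator {0..t} s :: real)"
      by (simp add: square_integrable_def i2 integrable_indicator_iff emeasure_lborel_Icc_eq)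
    moreover have "square_integrable lborel (\<lambda>s. indicator {0..t} s * Y s \<omega>)"
      using Yt Yt2 by (simp add: square_integrable_def set_integrable_def power_mult_distrib i2)
    ultimately have "(\<integral>s. indicator {0..t} s * (indicator {0..t} s * Y s \<omega>) \<partial>lborel)\<^sup>2 \<le>
        (\<integral>s. (indicator {0..t} s)\<^sup>2 \<partial>lborel) * (\<integral>s. (indicator {0..t} s * Y s \<omega>)\<^sup>2 \<partial>lborel)"
      by (rule integral_mult_square_le)
    then have "(U t \<omega>)\<^sup>2 \<le> t * (LBINT s:{0..t}. (Y s \<omega>)\<^sup>2)"
      using t by (simp add: U_def set_lebesgue_integral_def mult.assoc[symmetric] power_mult_distrib i2
          power2_eq_square[of "indicator {0..t} _", symmetric])
    also have "\<dots> \<le> T * Q \<omega>"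
    proof (intro mult_mono)
      show "(LBINT s:{0..t}. (Y s \<omega>)\<^sup>2) \<le> Q \<omega>"
        unfolding Q_def set_lebesgue_integral_def
        using Yt2 YT2 t unfolding set_integrable_def
        by (intro integral_mono) (auto simp: indicator_def)
      show "0 \<le> (LBINT s:{0..t}. (Y s \<omega>)\<^sup>2)"
        by (simp add: set_lebesgue_integral_def)
    qed (use t T in auto)
    finally show ?thesis .
  qed
  define Z where "Z t \<omega> = y0 - a * U t \<omega>" for t \<omega>
  have const: "square_integrable M (\<lambda>_. c)" for c
    by (simp add: square_integrable_const finite_measure_axioms)
  have U_L2: "square_integrable M (U t)" if t: "t \<in> {0..T}" for t
    unfolding square_integrable_def
  proof
    show "integrable M (\<lambda>\<omega>. (U t \<omega>)\<^sup>2)"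
    proof (rule Bochner_Integration.integrable_bound)
      show "integrable M (\<lambda>\<omega>. T * Q \<omega>)"
        using Q by simp
      show "(\<lambda>\<omega>. (U t \<omega>)\<^sup>2) \<in> borel_measurable M"
        using Um[OF t] by (rule borel_measurable_power)
      have "norm ((U t \<omega>)\<^sup>2) \<le> norm (T * Q \<omega>)" if "\<omega> \<in> space M" for \<omega>
        using U_bound[OF t that] by simp
      then show "AE \<omega> in M. norm ((U t \<omega>)\<^sup>2) \<le> norm (T * Q \<omega>)"
        by (intro AE_I2)
    qed
  qed (rule Um[OF t])
  have Z_L2: "square_integrable M (Z t)" if "t \<in> {0..T}" for t
    unfolding Z_def by (intro square_integrable_diff const square_integrable_cmult U_L2 that)
  have YZI: "AE \<omega> in M. Y t \<omega> = Z t \<omega> + I t \<omega>" if "t \<in> {0..T}" for t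
    using eq[OF that, unfolded set_integral_mult_right]
    by eventually_elim (simp add: Y_def[of t] Z_def U_def y0_def)
  have Y_L2': "square_integrable M (Y t)" if "t \<in> {0..T}" for t
    using square_integrable_add[OF Z_L2[OF that] ito_L2[OF that]] Ym[OF that]
    by (rule square_integrable_AE_cong) (use YZI[OF that] in eventually_elim, simp)
  from this[of T] show "square_integrable M (\<lambda>\<omega>. X T \<omega> - w)"
    using T by (simp add: Y_def[abs_def])
  have L1: "integrable M f" if "square_integrable M f" for f
    using integrable_mult_square_integrable[OF that const[of 1]] by simp
  have prod: "integrable M (\<lambda>\<omega>. f \<omega> * f' \<omega>)" if "square_integrable M f" "square_integrable M f'" for f f'
    using that by (rule integrable_mult_square_integrable)
  define v where "v t = expectation (\<lambda>\<omega>. (Y t \<omega>)\<^sup>2)" for t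
  define C where "C t = expectation (\<lambda>\<omega>. Y t \<omega> * I t \<omega>)" for t
  define G where "G t = expectation (\<lambda>\<omega>. (I t \<omega>)\<^sup>2)" for t
  have mean: "expectation (Y t) = y0 + (LBINT s:{0..t}. - a * expectation (Y s) + 0)" if t: "t \<in> {0..T}" for t
  proof -
    have "expectation (Y t) = expectation (\<lambda>\<omega>. Z t \<omega> + I t \<omega>)"
      using YZI[OF t] Ym[OF t] square_integrableD(1)[OF Z_L2[OF t]] square_integrableD(1)[OF ito_L2[OF t]]
      by (intro integral_cong_AE) auto
    also have "\<dots> = y0 - a * expectation (U t)"
      using L1[OF U_L2[OF t]] L1[OF ito_L2[OF t]] ito_mean[OF t] by (simp add: Z_def prob_space)
    also have "expectation (U t) = (LBINT s:{0..t}. expectation (Y s))"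
      unfolding U_def by (rule expectation_time_integral(2)[OF Y_int(1)[OF t]])
    finally show ?thesis
      unfolding add_0_right set_integral_mult_right by simp
  qed
  have "expectation (Y T) = exp (- a * T) * (y0 + integral {0..T} (\<lambda>s. exp (- (- a) * s) * 0))"
    by (rule linear_volterra_solution)
      (use T mean expectation_time_integral(3)[OF Y_int(1)[of T]] in auto)
  then show "expectation (\<lambda>\<omega>. X T \<omega> - w) = exp (- a * T) * (x\<^sub>0 - w)"
    by (simp add: Y_def[abs_def] y0_def)
  have Ceq: "C t = - a * (LBINT s:{0..t}. C s) + G t" and C_int: "set_integrable lborel {0..t} C"
    if t: "t \<in> {0..T}" for t
  proof -
    have It2: "square_integrable (M \<Otimes>\<^sub>M lborel) (\<lambda>(\<omega>, s). indicator {0..t} s * I t \<omega>)"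
    proof -
      have [measurable]: "I t \<in> borel_measurable M"
        using square_integrableD(1)[OF ito_L2[OF t]] .
      have "(indicator {0..t} s * I t \<omega>)\<^sup>2 = indicator {0..t} s * (I t \<omega>)\<^sup>2" for s \<omega>
        by (simp add: indicator_def)
      then show ?thesis
        using integrable_time_product[OF square_integrableD(2)[OF ito_L2[OF t]], of t]
        by (simp add: square_integrable_def case_prod_beta')
    qed
    note int = square_integrable_time_product_integrable[OF Y_L2[OF t] It2]
    \<comment> \<open>the integral beyond \<open>s\<close> is orthogonal to \<open>Y s\<close>\<close>
    have cong: "expectation (\<lambda>\<omega>. Y s \<omega> * I t \<omega>) = C s" if "s \<in> {0..t}" for s
      unfolding C_def using that t by (intro ito_orth YF Y_L2') auto
    have "C t = expectation (\<lambda>\<omega>. (Z t \<omega> + I t \<omega>) * I t \<omega>)"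
      unfolding C_def
      using YZI[OF t] Ym[OF t] square_integrableD(1)[OF Z_L2[OF t]] square_integrableD(1)[OF ito_L2[OF t]]
      by (intro integral_cong_AE) auto
    also have "(\<lambda>\<omega>. (Z t \<omega> + I t \<omega>) * I t \<omega>) = (\<lambda>\<omega>. y0 * I t \<omega> - a * (U t \<omega> * I t \<omega>) + (I t \<omega>)\<^sup>2)"
      by (simp add: Z_def algebra_simps power2_eq_square)
    also have "expectation \<dots> = - a * expectation (\<lambda>\<omega>. U t \<omega> * I t \<omega>) + G t"
      using L1[OF ito_L2[OF t]] prod[OF U_L2[OF t] ito_L2[OF t]] square_integrableD(2)[OF ito_L2[OF t]]
        ito_mean[OF t] by (simp add: G_def)
    also have "expectation (\<lambda>\<omega>. U t \<omega> * I t \<omega>) = expectation (\<lambda>\<omega>. LBINT s:{0..t}. Y s \<omega> * I t \<omega>)"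
      by (simp add: U_def)
    also have "\<dots> = (LBINT s:{0..t}. expectation (\<lambda>\<omega>. Y s \<omega> * I t \<omega>))"
      by (rule expectation_time_integral(2)[OF int])
    also have "\<dots> = (LBINT s:{0..t}. C s)"
      by (rule set_lebesgue_integral_cong) (auto simp: cong)
    finally show "C t = - a * (LBINT s:{0..t}. C s) + G t" .
    have "set_integrable lborel {0..t} (\<lambda>s. expectation (\<lambda>\<omega>. Y s \<omega> * I t \<omega>))"
      by (rule expectation_time_integral(3)[OF int])
    then show "set_integrable lborel {0..t} C"
      by (rule set_integrable_cong[OF refl refl, THEN iffD1, rotated]) (rule cong)
  qed
  have v_int: "set_integrable lborel {0..t} v" if t: "t \<in> {0..T}" for t
    unfolding v_def[abs_def] by (rule expectation_time_integral(3)[OF Y_int(2)[OF t]])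
  have g_int: "set_integrable lborel {0..t} g" if t: "t \<in> {0..T}" for t
    using gc t by (intro borel_integrable_atLeastAtMost') (auto intro: continuous_on_subset)
  have Geq: "G t = (LBINT s:{0..t}. b * v s + g s)" if t: "t \<in> {0..T}" for t
  proof -
    note int = square_integrable_time_integrable(2)[OF H_L2[OF t]]
    have i2: "(indicator {0..t} s :: real)\<^sup>2 = indicator {0..t} s" for s :: real
      by (simp add: indicator_def)
    have "G t = (\<integral>p. (case p of (\<omega>, s) \<Rightarrow> indicator {0..t} s * (H s \<omega>)\<^sup>2) \<partial>(M \<Otimes>\<^sub>M lborel))"
      unfolding G_def ito_isometry[OF t] by (simp add: case_prod_beta' power_mult_distrib i2)
    also have "\<dots> = (LBINT s:{0..t}. expectation (\<lambda>\<omega>. (H s \<omega>)\<^sup>2))"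
      by (rule expectation_time_integral(4)[OF int])
    also have "\<dots> = (LBINT s:{0..t}. b * v s + g s)"
    proof (rule set_lebesgue_integral_cong)
      show "\<forall>s. s \<in> {0..t} \<longrightarrow> expectation (\<lambda>\<omega>. (H s \<omega>)\<^sup>2) = b * v s + g s"
      proof (intro allI impI)
        fix s assume "s \<in> {0..t}"
        then have s: "s \<in> {0..T}"
          using t by auto
        show "expectation (\<lambda>\<omega>. (H s \<omega>)\<^sup>2) = b * v s + g s"
          using square_integrableD(2)[OF Y_L2'[OF s]] by (simp add: Hsq[OF s] v_def prob_space)
      qed
    qed simp
    finally show ?thesis .
  qed
  have Zsq: "expectation (\<lambda>\<omega>. (Z t \<omega>)\<^sup>2) = y0\<^sup>2 - 2 * a * (LBINT s:{0..t}. v s - C s)" if t: "t \<in> {0..T}" for t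
  proof -
    have Zcont: "continuous_on {0..T} (\<lambda>s. Z s \<omega>)"
      and Zder: "\<And>s. s \<in> {0..T} \<Longrightarrow> ((\<lambda>s. Z s \<omega>) has_real_derivative - a * Y s \<omega>) (at s within {0..T})"
      if \<omega>: "\<omega> \<in> space M" for \<omega>
    proof -
      have UHK: "U s \<omega> = integral {0..s} (\<lambda>r. Y r \<omega>)" if "s \<in> {0..T}" for s
        unfolding U_def using that
        by (intro set_borel_integral_eq_integral borel_integrable_atLeastAtMost' continuous_on_subset[OF Yc[OF \<omega>]]) auto
      show der: "((\<lambda>s. Z s \<omega>) has_real_derivative - a * Y s \<omega>) (at s within {0..T})" if s: "s \<in> {0..T}" for s
      proof -
        have "((\<lambda>s. y0 - a * integral {0..s} (\<lambda>r. Y r \<omega>)) has_real_derivative 0 - a * Y s \<omega>) (at s within {0..T})"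
          by (intro DERIV_diff DERIV_const DERIV_cmult integral_has_real_derivative Yc \<omega> s)
        then show ?thesis
          using has_field_derivative_transform_within[OF _ zero_less_one s, of _ _ "\<lambda>s. Z s \<omega>"] UHK
          by (simp add: Z_def)
      qed
      show "continuous_on {0..T} (\<lambda>s. Z s \<omega>)"
        using der by (rule DERIV_continuous_on)
    qed
    have pathwise: "(Z t \<omega>)\<^sup>2 = y0\<^sup>2 - 2 * a * (LBINT s:{0..t}. Z s \<omega> * Y s \<omega>)" if \<omega>: "\<omega> \<in> space M" for \<omega>
    proof -
      have "((\<lambda>s. 2 * Z s \<omega> * (- a * Y s \<omega>)) has_integral (Z t \<omega>)\<^sup>2 - (Z 0 \<omega>)\<^sup>2) {0..t}"
      proof (rule fundamental_theorem_of_calculus)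
        show "0 \<le> t"
          using t by simp
        fix s assume s: "s \<in> {0..t}"
        then have s': "s \<in> {0..T}"
          using t by auto
        have "((\<lambda>s. (Z s \<omega>)\<^sup>2) has_real_derivative 2 * Z s \<omega> * (- a * Y s \<omega>)) (at s within {0..T})"
          by (rule derivative_eq_intros Zder[OF \<omega> s'] refl | simp)+
        then have "((\<lambda>s. (Z s \<omega>)\<^sup>2) has_real_derivative 2 * Z s \<omega> * (- a * Y s \<omega>)) (at s within {0..t})"
          by (rule DERIV_subset) (use t in auto)
        then show "((\<lambda>s. (Z s \<omega>)\<^sup>2) has_vector_derivative 2 * Z s \<omega> * (- a * Y s \<omega>)) (at s within {0..t})"
          by (simp add: has_real_derivative_iff_has_vector_derivative)
      qed
      also have "(\<lambda>s. 2 * Z s \<omega> * (- a * Y s \<omega>)) = (\<lambda>s. (- 2 * a) * (Z s \<omega> * Y s \<omega>))"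
        by (simp add: fun_eq_iff)
      finally have "(Z t \<omega>)\<^sup>2 - (Z 0 \<omega>)\<^sup>2 = integral {0..t} (\<lambda>s. (- 2 * a) * (Z s \<omega> * Y s \<omega>))"
        by (rule integral_unique[symmetric])
      also have "\<dots> = - 2 * a * integral {0..t} (\<lambda>s. Z s \<omega> * Y s \<omega>)"
        by simp
      also have "integral {0..t} (\<lambda>s. Z s \<omega> * Y s \<omega>) = (LBINT s:{0..t}. Z s \<omega> * Y s \<omega>)"
        using t by (intro set_borel_integral_eq_integral(2)[symmetric] borel_integrable_atLeastAtMost'
            continuous_on_subset[OF continuous_on_mult[OF Zcont[OF \<omega>] Yc[OF \<omega>]]]) auto
      finally have "(Z t \<omega>)\<^sup>2 - (Z 0 \<omega>)\<^sup>2 = - 2 * a * (LBINT s:{0..t}. Z s \<omega> * Y s \<omega>)" .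
      moreover have "U 0 \<omega> = 0"
        unfolding U_def set_lebesgue_integral_def
        by (rule integral_eq_zero_AE) (use AE_lborel_singleton[of "0::real"] in eventually_elim, simp)
      ultimately show ?thesis
        by (simp add: Z_def[of 0])
    qed
    have Zpair: "square_integrable (M \<Otimes>\<^sub>M lborel) (\<lambda>(\<omega>, s). indicator {0..t} s * Z s \<omega>)"
      unfolding square_integrable_def
    proof
      show m: "(\<lambda>(\<omega>, s). indicator {0..t} s * Z s \<omega>) \<in> borel_measurable (M \<Otimes>\<^sub>M lborel)"
        by (rule restrict[OF continuous_process_measurable_pair t])
          (use T square_integrableD(1)[OF Z_L2] Zcont in auto)
      show "integrable (M \<Otimes>\<^sub>M lborel) (\<lambda>p. (case p of (\<omega>, s) \<Rightarrow> indicator {0..t} s * Z s \<omega>)\<^sup>2)"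
      proof (rule Bochner_Integration.integrable_bound)
        show "integrable (M \<Otimes>\<^sub>M lborel) (\<lambda>(\<omega>, s). indicator {0..t} s * (2 * y0\<^sup>2 + 2 * (a\<^sup>2 * (T * Q \<omega>))))"
          by (rule integrable_time_product) (use Q in simp)
        show "(\<lambda>p. (case p of (\<omega>, s) \<Rightarrow> indicator {0..t} s * Z s \<omega>)\<^sup>2) \<in> borel_measurable (M \<Otimes>\<^sub>M lborel)"
          using m by (rule borel_measurable_power)
        have "(indicator {0..t} s * Z s \<omega>)\<^sup>2 \<le> \<bar>indicator {0..t} s * (2 * y0\<^sup>2 + 2 * (a\<^sup>2 * (T * Q \<omega>)))\<bar>"
          if \<omega>: "\<omega> \<in> space M" for s \<omega>
        proof (cases "s \<in> {0..t}")
          case True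
          then have "s \<in> {0..T}"
            using t by auto
          then have "a\<^sup>2 * (U s \<omega>)\<^sup>2 \<le> a\<^sup>2 * (T * Q \<omega>)"
            using U_bound \<omega> by (intro mult_left_mono) auto
          moreover have "(Z s \<omega>)\<^sup>2 \<le> 2 * y0\<^sup>2 + 2 * (a\<^sup>2 * (U s \<omega>)\<^sup>2)"
            using zero_le_power2[of "y0 + a * U s \<omega>"]
            by (simp add: Z_def power2_eq_square algebra_simps)
          ultimately show ?thesis
            using True by simp
        qed simp
        then show "AE p in M \<Otimes>\<^sub>M lborel. norm ((case p of (\<omega>, s) \<Rightarrow> indicator {0..t} s * Z s \<omega>)\<^sup>2) \<le>
            norm (case p of (\<omega>, s) \<Rightarrow> indicator {0..t} s * (2 * y0\<^sup>2 + 2 * (a\<^sup>2 * (T * Q \<omega>))))"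
          by (intro AE_I2) (auto simp: space_pair_measure)
      qed
    qed
    note int = square_integrable_time_product_integrable[OF Zpair Y_L2[OF t]]
    have "expectation (\<lambda>\<omega>. (Z t \<omega>)\<^sup>2) = expectation (\<lambda>\<omega>. y0\<^sup>2 - 2 * a * (LBINT s:{0..t}. Z s \<omega> * Y s \<omega>))"
      using pathwise by (intro Bochner_Integration.integral_cong) auto
    also have "\<dots> = y0\<^sup>2 - 2 * a * expectation (\<lambda>\<omega>. LBINT s:{0..t}. Z s \<omega> * Y s \<omega>)"
      using expectation_time_integral(1)[OF int] by (simp add: prob_space)
    also have "expectation (\<lambda>\<omega>. LBINT s:{0..t}. Z s \<omega> * Y s \<omega>) =
        (LBINT s:{0..t}. expectation (\<lambda>\<omega>. Z s \<omega> * Y s \<omega>))"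
      by (rule expectation_time_integral(2)[OF int])
    also have "\<dots> = (LBINT s:{0..t}. v s - C s)"
    proof (rule set_lebesgue_integral_cong)
      show "\<forall>s. s \<in> {0..t} \<longrightarrow> expectation (\<lambda>\<omega>. Z s \<omega> * Y s \<omega>) = v s - C s"
      proof (intro allI impI)
        fix s assume "s \<in> {0..t}"
        then have s: "s \<in> {0..T}"
          using t by auto
        have "expectation (\<lambda>\<omega>. Z s \<omega> * Y s \<omega>) = expectation (\<lambda>\<omega>. (Y s \<omega>)\<^sup>2 - Y s \<omega> * I s \<omega>)"
        proof (rule integral_cong_AE)
          show "AE \<omega> in M. Z s \<omega> * Y s \<omega> = (Y s \<omega>)\<^sup>2 - Y s \<omega> * I s \<omega>"
            using YZI[OF s] by eventually_elim (simp add: power2_eq_square algebra_simps)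
        qed (use Ym[OF s] square_integrableD(1)[OF Z_L2[OF s]] square_integrableD(1)[OF ito_L2[OF s]] in measurable)
        also have "\<dots> = v s - C s"
          using square_integrableD(2)[OF Y_L2'[OF s]] prod[OF Y_L2'[OF s] ito_L2[OF s]]
          by (simp add: v_def C_def)
        finally show "expectation (\<lambda>\<omega>. Z s \<omega> * Y s \<omega>) = v s - C s" .
      qed
    qed simp
    finally show ?thesis .
  qed
  have veq: "v t = y0\<^sup>2 + (LBINT s:{0..t}. (b - 2 * a) * v s + g s)" if t: "t \<in> {0..T}" for t
  proof -
    note m = Ym[OF t] square_integrableD(1)[OF Z_L2[OF t]] square_integrableD(1)[OF ito_L2[OF t]]
    have ZI: "expectation (\<lambda>\<omega>. Z t \<omega> * I t \<omega>) = C t - G t"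
    proof -
      have "expectation (\<lambda>\<omega>. Z t \<omega> * I t \<omega>) = expectation (\<lambda>\<omega>. Y t \<omega> * I t \<omega> - (I t \<omega>)\<^sup>2)"
      proof (rule integral_cong_AE)
        show "AE \<omega> in M. Z t \<omega> * I t \<omega> = Y t \<omega> * I t \<omega> - (I t \<omega>)\<^sup>2"
          using YZI[OF t] by eventually_elim (simp add: power2_eq_square algebra_simps)
      qed (use m in measurable)
      also have "\<dots> = C t - G t"
        using square_integrableD(2)[OF ito_L2[OF t]] prod[OF Y_L2'[OF t] ito_L2[OF t]]
        by (simp add: C_def G_def)
      finally show ?thesis .
    qed
    have "v t = expectation (\<lambda>\<omega>. (Z t \<omega>)\<^sup>2 + 2 * (Z t \<omega> * I t \<omega>) + (I t \<omega>)\<^sup>2)"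
      unfolding v_def
    proof (rule integral_cong_AE)
      show "AE \<omega> in M. (Y t \<omega>)\<^sup>2 = (Z t \<omega>)\<^sup>2 + 2 * (Z t \<omega> * I t \<omega>) + (I t \<omega>)\<^sup>2"
        using YZI[OF t] by eventually_elim (simp add: power2_eq_square algebra_simps)
    qed (use m in measurable)
    also have "\<dots> = expectation (\<lambda>\<omega>. (Z t \<omega>)\<^sup>2) + 2 * (C t - G t) + G t"
      using square_integrableD(2)[OF ito_L2[OF t]] square_integrableD(2)[OF Z_L2[OF t]]
        prod[OF Z_L2[OF t] ito_L2[OF t]]
      by (simp add: G_def ZI)
    also have "expectation (\<lambda>\<omega>. (Z t \<omega>)\<^sup>2) = y0\<^sup>2 - 2 * a * ((LBINT s:{0..t}. v s) - (LBINT s:{0..t}. C s))"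
      using Zsq[OF t] v_int[OF t] C_int[OF t] by (simp add: set_integral_diff)
    also have "\<dots> + 2 * (C t - G t) + G t = y0\<^sup>2 - 2 * a * (LBINT s:{0..t}. v s) + G t"
      unfolding Ceq[OF t] by (simp add: algebra_simps)
    also have "\<dots> = y0\<^sup>2 + (LBINT s:{0..t}. (b - 2 * a) * v s + g s)"
      unfolding Geq[OF t] using v_int[OF t] g_int[OF t] by (simp add: set_integral_add algebra_simps)
    finally show ?thesis .
  qed
  have "v T = exp ((b - 2 * a) * T) * (y0\<^sup>2 + integral {0..T} (\<lambda>s. exp (- (b - 2 * a) * s) * g s))"
    by (rule linear_volterra_solution) (use T veq v_int gc in auto)
  then show "expectation (\<lambda>\<omega>. (X T \<omega> - w)\<^sup>2) = exp ((b - 2 * a) * T) *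
      ((x\<^sub>0 - w)\<^sup>2 + integral {0..T} (\<lambda>s. exp (- (b - 2 * a) * s) * g s))"
    by (simp add: v_def Y_def y0_def)
qed

end

section \<open>The excess ratio of exponentials\<close>

lemma exp_strict_tangent:
  assumes "(x::real) \<noteq> 0"
  shows "1 + x < exp x"
proof (cases "0 \<le> 1 + x / 2")
  case True
  have "0 < x\<^sup>2"
    using assms by simp
  then have "1 + x < (1 + x / 2)\<^sup>2"
    unfolding power2_eq_square by (simp add: field_simps)
  also have "\<dots> \<le> (exp (x / 2))\<^sup>2"
    using True by (intro power_mono exp_ge_add_one_self)
  also have "\<dots> = exp x"
    by (simp add: exp_double[symmetric])
  finally show ?thesis .
next
  case False
  then have "1 + x < 0"
    by simp
  then show ?thesis
    using exp_gt_zero[of x] by linarith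
qed

text \<open>Both \<open>exp y\<close> and \<open>exp 0\<close> lie above the tangent of \<open>exp\<close> at \<open>k y\<close>.\<close>

lemma exp_strict_convex:
  fixes y k :: real
  assumes "y \<noteq> 0" and "0 < k" and "k < 1"
  shows "exp (k * y) < k * exp y + (1 - k)"
proof -
  have "exp (k * y) = exp (k * y) * (k * (1 + (1 - k) * y) + (1 - k) * (1 + - (k * y)))"
    by (simp add: algebra_simps)
  also have "\<dots> < exp (k * y) * (k * exp ((1 - k) * y) + (1 - k) * exp (- (k * y)))"
    using assms by (intro mult_strict_left_mono add_strict_mono exp_strict_tangent) auto
  also have "\<dots> = k * exp y + (1 - k)"
    by (simp add: algebra_simps exp_add[symmetric] exp_minus)
  finally show ?thesis .
qed

text \<open>Strict concavity of \<open>x \<mapsto> 1 - exp (- B x)\<close>, which vanishes at zero, so that its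
  slope from the origin decreases between \<open>k\<^sup>2\<close> and \<open>k\<close>. This decides the sign of the
  logarithmic derivative of the first variance term.\<close>

lemma one_minus_exp_ray:
  fixes B k :: real
  assumes "0 < B" and "0 < k"
  shows "k < 1 \<Longrightarrow> k * (1 - exp (- (k * B))) < 1 - exp (- (k\<^sup>2 * B))"
    and "1 < k \<Longrightarrow> 1 - exp (- (k\<^sup>2 * B)) < k * (1 - exp (- (k * B)))"
proof -
  show "k * (1 - exp (- (k * B))) < 1 - exp (- (k\<^sup>2 * B))" if "k < 1"
    using exp_strict_convex[of "- (k * B)" k] assms that by (simp add: algebra_simps power2_eq_square)
  show "1 - exp (- (k\<^sup>2 * B)) < k * (1 - exp (- (k * B)))" if "1 < k"
  proof -
    have "exp (1 / k * - (k\<^sup>2 * B)) < 1 / k * exp (- (k\<^sup>2 * B)) + (1 - 1 / k)"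
      using assms that by (intro exp_strict_convex) auto
    also have "1 / k * - (k\<^sup>2 * B) = - (k * B)"
      using assms by (simp add: power2_eq_square)
    finally have "k * exp (- (k * B)) < k * (1 / k * exp (- (k\<^sup>2 * B)) + (1 - 1 / k))"
      using assms by simp
    also have "\<dots> = exp (- (k\<^sup>2 * B)) + k - 1"
      using assms by (simp add: field_simps)
    finally show ?thesis
      by (simp add: algebra_simps)
  qed
qed

text \<open>Equality holds at \<open>E = 1\<close>, and the quotient of the right-hand side by \<open>2 (E\<^sup>2 + 1)\<close> grows faster
  than \<open>ln\<close>: the difference of the derivatives has the factor \<open>E - 1\<close>.\<close>

lemma ln_rational_bound:
  assumes "(1::real) \<le> E"
  shows "2 * ln E * (E\<^sup>2 + 1) \<le> (E - 1) * (E + 1)\<^sup>2"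
proof -
  define f where "f x = (x - 1) * (x + 1)\<^sup>2 / (2 * (x\<^sup>2 + 1)) - ln x" for x :: real
  have nz: "x\<^sup>2 + 1 \<noteq> 0" for x :: real
    using zero_le_power2[of x] by linarith
  have "f 1 \<le> f E"
  proof (rule DERIV_nonneg_imp_nondecreasing[OF assms])
    fix x :: real assume x: "1 \<le> x" "x \<le> E"
    have "(f has_real_derivative
        ((3 * x\<^sup>2 + 2 * x - 1) * (2 * (x\<^sup>2 + 1)) - (x - 1) * (x + 1)\<^sup>2 * (4 * x)) / (2 * (x\<^sup>2 + 1))\<^sup>2 - 1 / x) (at x)"
      unfolding f_def using x nz[of x]
      by (auto intro!: derivative_eq_intros simp: power2_eq_square algebra_simps)
    moreover have "((3 * x\<^sup>2 + 2 * x - 1) * (2 * (x\<^sup>2 + 1)) - (x - 1) * (x + 1)\<^sup>2 * (4 * x)) / (2 * (x\<^sup>2 + 1))\<^sup>2 - 1 / x =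
        2 * (x - 1) * (x ^ 4 - x ^ 3 + 3 * x\<^sup>2 + 3 * x + 2) / ((2 * (x\<^sup>2 + 1))\<^sup>2 * x)"
      using x nz[of x] by (simp add: divide_simps) algebra
    moreover have "0 \<le> 2 * (x - 1) * (x ^ 4 - x ^ 3 + 3 * x\<^sup>2 + 3 * x + 2) / ((2 * (x\<^sup>2 + 1))\<^sup>2 * x)"
    proof -
      have "x ^ 3 \<le> x ^ 4"
        using x by (intro power_increasing) auto
      then have "0 \<le> x ^ 4 - x ^ 3 + 3 * x\<^sup>2 + 3 * x + 2"
        using x by simp
      then show ?thesis
        using x by simp
    qed
    ultimately show "\<exists>y. (f has_real_derivative y) (at x) \<and> 0 \<le> y"
      by metis
  qed
  then have "ln E \<le> (E - 1) * (E + 1)\<^sup>2 / (2 * (E\<^sup>2 + 1))"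
    by (simp add: f_def)
  moreover have "0 < 2 * (E\<^sup>2 + 1)"
    by (simp add: add_nonneg_pos)
  ultimately show ?thesis
    by (simp add: pos_le_divide_eq mult_ac)
qed

text \<open>Convexity of \<open>sinh\<close> on the half line, stated for \<open>2 sinh\<close>.\<close>

lemma exp_diff_scaled:
  fixes t u :: real
  assumes "0 \<le> t" and "t \<le> 1" and "0 \<le> u"
  shows "exp (t * u) - exp (- (t * u)) \<le> t * (exp u - exp (- u))"
proof -
  let ?s = "\<lambda>u::real. exp u - exp (- u)"
  have "convex_on {0..} ?s"
  proof (rule f''_ge0_imp_convex)
    show "(?s has_real_derivative exp x + exp (- x)) (at x)" for x
      by (auto intro!: derivative_eq_intros)
    show "((\<lambda>x. exp x + exp (- x)) has_real_derivative ?s x) (at x)" for x :: real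
      by (auto intro!: derivative_eq_intros)
  qed auto
  from convex_onD[OF this assms(1,2), of 0 u] show ?thesis
    using assms by simp
qed

text \<open>Only the last summand depends on \<open>y\<close>. Since \<open>exp y / (exp y - 1)\<^sup>2 = 1 / (2 sinh (y / 2))\<^sup>2\<close> and
  \<open>sinh u / u\<close> is increasing, that summand is smallest for \<open>y = 2 x\<close>. In terms of \<open>E = exp x\<close> this
  extreme case is the rational bound on \<open>ln E\<close>.\<close>

lemma log_ratio_convexity:
  fixes x y B :: real
  assumes "0 < x" and "0 < y" and "y \<le> 2 * x" and B: "B = y\<^sup>2 / x"
  shows "0 \<le> exp x / (exp x - 1) - 2 * x * exp x / (exp x - 1)\<^sup>2 + B * exp y / (exp y - 1)\<^sup>2"
proof -
  define E where "E = exp x"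
  have E: "1 < E"
    using assms by (simp add: E_def)
  have sq: "exp u / (exp u - 1)\<^sup>2 = 1 / (exp (u / 2) - exp (- (u / 2)))\<^sup>2" if "0 < u" for u :: real
  proof -
    define e where "e = exp (u / 2)"
    have "1 < e"
      using that by (simp add: e_def)
    moreover have "exp u = e\<^sup>2" "exp (- (u / 2)) = 1 / e"
      by (simp_all add: e_def exp_double[symmetric] exp_minus inverse_eq_divide)
    moreover have "(e - 1 / e)\<^sup>2 = (e\<^sup>2 - 1)\<^sup>2 / e\<^sup>2"
      using \<open>1 < e\<close> by (simp add: field_simps power2_eq_square)
    ultimately show ?thesis
      by (simp add: e_def[symmetric])
  qed
  let ?s = "\<lambda>u::real. exp u - exp (- u)"
  have spos: "0 < ?s u" if "0 < u" for u
    using that by simp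
  have "?s (y / 2) \<le> (y / (2 * x)) * ?s x"
    using exp_diff_scaled[of "y / (2 * x)" x] assms by simp
  then have "(?s (y / 2))\<^sup>2 \<le> ((y / (2 * x)) * ?s x)\<^sup>2"
    using spos[of "y / 2"] assms(2) by (intro power_mono) auto
  then have "B / ((y / (2 * x)) * ?s x)\<^sup>2 \<le> B / (?s (y / 2))\<^sup>2"
    using assms spos[of "y / 2"] by (intro divide_left_mono mult_pos_pos) (auto simp: B)
  also have "B / ((y / (2 * x)) * ?s x)\<^sup>2 = 4 * x / (?s x)\<^sup>2"
    using assms by (simp add: B power2_eq_square)
  also have "\<dots> = 4 * x * (exp (2 * x) / (exp (2 * x) - 1)\<^sup>2)"
    using sq[of "2 * x"] assms by simp
  also have "exp (2 * x) = E\<^sup>2"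
    by (simp add: E_def exp_double)
  also have "B / (?s (y / 2))\<^sup>2 = B * exp y / (exp y - 1)\<^sup>2"
    by (simp only: times_divide_eq_right[symmetric] sq[OF assms(2)]) simp
  finally have 1: "4 * x * (E\<^sup>2 / (E\<^sup>2 - 1)\<^sup>2) \<le> B * exp y / (exp y - 1)\<^sup>2" .
  have "2 * x * (E\<^sup>2 + 1) \<le> (E - 1) * (E + 1)\<^sup>2"
    using ln_rational_bound[of E] E by (simp add: E_def)
  then have "0 \<le> E * ((E - 1) * (E + 1)\<^sup>2 - 2 * x * (E\<^sup>2 + 1)) / ((E - 1) * (E + 1))\<^sup>2"
    using E by simp
  also have "\<dots> = E / (E - 1) - 2 * x * E / (E - 1)\<^sup>2 + 4 * x * (E\<^sup>2 / (E\<^sup>2 - 1)\<^sup>2)"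
  proof -
    define u v where "u = E - 1" and "v = E + 1"
    have uv: "E\<^sup>2 - 1 = u * v" "u \<noteq> 0" "v \<noteq> 0" "E\<^sup>2 + 1 = v\<^sup>2 - 2 * E"
      using E by (auto simp: u_def v_def power2_eq_square algebra_simps)
    have "E / u - 2 * x * E / u\<^sup>2 + 4 * x * (E\<^sup>2 / (u * v)\<^sup>2) =
        E * (u * v\<^sup>2) / (u * v)\<^sup>2 - E * (2 * x * v\<^sup>2) / (u * v)\<^sup>2 + E * (4 * x * E) / (u * v)\<^sup>2"
      using uv(2,3) by (simp add: power2_eq_square mult_ac)
    also have "\<dots> = E * (u * v\<^sup>2 - 2 * x * (v\<^sup>2 - 2 * E)) / (u * v)\<^sup>2"
    proof -
      have num: "E * (u * v\<^sup>2) - E * (2 * x * v\<^sup>2) + E * (4 * x * E) = E * (u * v\<^sup>2 - 2 * x * (v\<^sup>2 - 2 * E))"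
        by (simp add: algebra_simps)
      show ?thesis
        unfolding diff_divide_distrib[symmetric] add_divide_distrib[symmetric] num ..
    qed
    finally show ?thesis
      unfolding u_def[symmetric] v_def[symmetric] uv(1,4) by (rule sym)
  qed
  finally show ?thesis
    using 1 by (simp add: E_def)
qed

text \<open>The first term of the terminal variance at \<open>\<rho> = k \<rho>_true\<close>, divided by \<open>(l - x\<^sub>0)\<^sup>2\<close>,
  where \<open>B = (\<rho>_true \<bullet> \<rho>_true) T\<close>.\<close>

definition excess_ratio :: "real \<Rightarrow> real \<Rightarrow> real" where
  "excess_ratio B k = (exp (k\<^sup>2 * B) - 1) / (exp (k * B) - 1)\<^sup>2"

context
  fixes B :: real
  assumes B: "0 < B"
begin

text \<open>The logarithmic derivative of the excess ratio.\<close>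

definition log_slope :: "real \<Rightarrow> real" where
  "log_slope k = 2 * B * (k * (exp (k\<^sup>2 * B) / (exp (k\<^sup>2 * B) - 1)) - exp (k * B) / (exp (k * B) - 1))"

lemma excess_ratio_pos: "0 < k \<Longrightarrow> 0 < excess_ratio B k"
  using B by (simp add: excess_ratio_def)

lemma excess_ratio_deriv:
  assumes "0 < k"
  shows "(excess_ratio B has_real_derivative excess_ratio B k * log_slope k) (at k)"
proof -
  let ?n = "exp (k\<^sup>2 * B) - 1" and ?d = "exp (k * B) - 1"
  have nz: "?n \<noteq> 0" "?d \<noteq> 0"
    using assms B by auto
  have n: "((\<lambda>k. exp (k\<^sup>2 * B) - 1) has_real_derivative 2 * k * B * exp (k\<^sup>2 * B)) (at k)"
    by (auto intro!: derivative_eq_intros)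
  have d: "((\<lambda>k. (exp (k * B) - 1)\<^sup>2) has_real_derivative 2 * ?d * (B * exp (k * B))) (at k)"
    by (auto intro!: derivative_eq_intros)
  have alg: "(2 * k * B * e * d\<^sup>2 - n * (2 * d * (B * e'))) / (d\<^sup>2 * d\<^sup>2) =
      n / d\<^sup>2 * (2 * B * (k * (e / n) - e' / d))" if "n \<noteq> 0" "d \<noteq> 0" for n d e e' :: real
    using that by (simp add: divide_simps) algebra
  have "((\<lambda>k. (exp (k\<^sup>2 * B) - 1) / (exp (k * B) - 1)\<^sup>2) has_real_derivative
      (2 * k * B * exp (k\<^sup>2 * B) * ?d\<^sup>2 - ?n * (2 * ?d * (B * exp (k * B)))) / (?d\<^sup>2 * ?d\<^sup>2)) (at k)"
    using nz by (intro DERIV_divide n d) auto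
  then show ?thesis
    unfolding alg[OF nz] by (simp add: excess_ratio_def[abs_def] log_slope_def)
qed

lemma log_slope_deriv:
  assumes "0 < k"
  shows "(log_slope has_real_derivative
    2 * B * (exp (k\<^sup>2 * B) / (exp (k\<^sup>2 * B) - 1) - 2 * (k\<^sup>2 * B) * exp (k\<^sup>2 * B) / (exp (k\<^sup>2 * B) - 1)\<^sup>2
      + B * exp (k * B) / (exp (k * B) - 1)\<^sup>2)) (at k)"
proof -
  have \<psi>: "((\<lambda>x. exp x / (exp x - 1)) has_real_derivative - exp x / (exp x - 1)\<^sup>2) (at x)"
    if "0 < x" for x :: real
  proof -
    have "exp x - 1 \<noteq> 0"
      using that by auto
    then show ?thesis
      by (auto intro!: derivative_eq_intros simp: power2_eq_square field_simps)
  qed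
  have d1: "((\<lambda>k. exp (k\<^sup>2 * B) / (exp (k\<^sup>2 * B) - 1)) has_real_derivative
      - exp (k\<^sup>2 * B) / (exp (k\<^sup>2 * B) - 1)\<^sup>2 * (2 * k * B)) (at k)"
    using assms B by (intro DERIV_chain2[OF \<psi>]) (auto intro!: derivative_eq_intros)
  have d2: "((\<lambda>k. exp (k * B) / (exp (k * B) - 1)) has_real_derivative
      - exp (k * B) / (exp (k * B) - 1)\<^sup>2 * B) (at k)"
    using assms B by (intro DERIV_chain2[OF \<psi>]) (auto intro!: derivative_eq_intros)
  have "(log_slope has_real_derivative
      2 * B * (1 * (exp (k\<^sup>2 * B) / (exp (k\<^sup>2 * B) - 1)) + - exp (k\<^sup>2 * B) / (exp (k\<^sup>2 * B) - 1)\<^sup>2 * (2 * k * B) * k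
        - - exp (k * B) / (exp (k * B) - 1)\<^sup>2 * B)) (at k)"
    unfolding log_slope_def[abs_def] by (intro DERIV_cmult DERIV_diff DERIV_mult DERIV_ident d1 d2)
  then show ?thesis
    by (rule DERIV_cong) (simp add: power2_eq_square[of k] mult_ac)
qed

lemma log_slope_sign:
  assumes "0 < k"
  shows "k < 1 \<Longrightarrow> log_slope k < 0" and "log_slope 1 = 0" and "1 < k \<Longrightarrow> 0 < log_slope k"
proof -
  have \<psi>: "exp x / (exp x - 1) = 1 / (1 - exp (- x))" if "0 < x" for x :: real
  proof -
    have "1 - exp (- x) = (exp x - 1) / exp x"
      by (simp add: exp_minus field_simps)
    then show ?thesis
      by simp
  qed
  have eq: "log_slope k = 2 * B * (k / (1 - exp (- (k\<^sup>2 * B))) - 1 / (1 - exp (- (k * B))))"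
    unfolding log_slope_def using assms B by (simp add: \<psi>)
  have pos: "0 < 1 - exp (- (k\<^sup>2 * B))" "0 < 1 - exp (- (k * B))"
    using assms B by simp_all
  show "log_slope k < 0" if "k < 1"
  proof -
    have "k / (1 - exp (- (k\<^sup>2 * B))) < 1 / (1 - exp (- (k * B)))"
      using one_minus_exp_ray(1)[OF B assms that] pos by (simp add: field_simps)
    then show ?thesis
      unfolding eq using B by (simp add: mult_pos_neg)
  qed
  show "0 < log_slope k" if "1 < k"
  proof -
    have "1 / (1 - exp (- (k * B))) < k / (1 - exp (- (k\<^sup>2 * B)))"
      using one_minus_exp_ray(2)[OF B assms that] pos by (simp add: field_simps)
    then show ?thesis
      unfolding eq using B by simp
  qed
  show "log_slope 1 = 0"
    by (simp add: log_slope_def)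
qed

lemma excess_ratio_continuous: "continuous_on {0<..} (excess_ratio B)"
  using excess_ratio_deriv by (intro continuous_at_imp_continuous_on) (auto intro: DERIV_isCont)

lemma excess_ratio_decreasing:
  assumes "0 < x" and "x < y" and "y \<le> 1"
  shows "excess_ratio B y < excess_ratio B x"
proof (rule DERIV_neg_imp_decreasing_open[OF assms(2)])
  fix k assume "x < k" "k < y"
  then have k: "0 < k" "k < 1"
    using assms by auto
  then show "\<exists>d. (excess_ratio B has_real_derivative d) (at k) \<and> d < 0"
    using excess_ratio_deriv[OF k(1)] excess_ratio_pos[OF k(1)] log_slope_sign(1)[OF k]
    by (auto intro!: exI mult_pos_neg)
qed (use assms in \<open>auto intro: continuous_on_subset[OF excess_ratio_continuous]\<close>)

lemma excess_ratio_increasing: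
  assumes "1 \<le> x" and "x < y"
  shows "excess_ratio B x < excess_ratio B y"
proof (rule DERIV_pos_imp_increasing_open[OF assms(2)])
  fix k assume "x < k" "k < y"
  then have k: "0 < k" "1 < k"
    using assms by auto
  then show "\<exists>d. (excess_ratio B has_real_derivative d) (at k) \<and> 0 < d"
    using excess_ratio_deriv[OF k(1)] excess_ratio_pos[OF k(1)] log_slope_sign(3)[OF k]
    by (auto intro!: exI mult_pos_pos)
qed (use assms in \<open>auto intro: continuous_on_subset[OF excess_ratio_continuous]\<close>)

lemma excess_ratio_stationary: "(excess_ratio B has_real_derivative 0) (at 1)"
  using excess_ratio_deriv[of 1] log_slope_sign(2)[of 1] by simp

text \<open>The logarithm is convex: its second derivative is \<open>2 B\<close> times the expression of
  \<open>log_ratio_convexity\<close> at \<open>x = k\<^sup>2 B\<close> and \<open>y = k B\<close>, where \<open>y \<le> 2 x\<close> means \<open>k \<ge> 1/2\<close>.\<close>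

lemma excess_ratio_convex: "convex_on {1/2..1} (excess_ratio B)"
proof (rule f''_ge0_imp_convex)
  fix k :: real assume k: "k \<in> {1/2..1}"
  then have "0 < k"
    by simp
  let ?d = "2 * B * (exp (k\<^sup>2 * B) / (exp (k\<^sup>2 * B) - 1) - 2 * (k\<^sup>2 * B) * exp (k\<^sup>2 * B) / (exp (k\<^sup>2 * B) - 1)\<^sup>2
      + B * exp (k * B) / (exp (k * B) - 1)\<^sup>2)"
  show "(excess_ratio B has_real_derivative excess_ratio B k * log_slope k) (at k)"
    by (rule excess_ratio_deriv) fact
  show "((\<lambda>k. excess_ratio B k * log_slope k) has_real_derivative
      excess_ratio B k * ((log_slope k)\<^sup>2 + ?d)) (at k)"
    using DERIV_mult[OF excess_ratio_deriv[OF \<open>0 < k\<close>] log_slope_deriv[OF \<open>0 < k\<close>]]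
    by (rule DERIV_cong) (simp add: power2_eq_square algebra_simps)
  have "0 \<le> exp (k\<^sup>2 * B) / (exp (k\<^sup>2 * B) - 1) - 2 * (k\<^sup>2 * B) * exp (k\<^sup>2 * B) / (exp (k\<^sup>2 * B) - 1)\<^sup>2
      + B * exp (k * B) / (exp (k * B) - 1)\<^sup>2"
  proof (rule log_ratio_convexity)
    have "k * 1 \<le> k * (2 * k)"
      using k by (intro mult_left_mono) auto
    from mult_right_mono[OF this, of B] show "k * B \<le> 2 * (k\<^sup>2 * B)"
      using B by (simp add: power2_eq_square mult_ac)
    show "B = (k * B)\<^sup>2 / (k\<^sup>2 * B)"
      using B \<open>0 < k\<close> by (simp add: power2_eq_square)
  qed (use B \<open>0 < k\<close> in auto)
  then have "0 \<le> ?d"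
    using B by (rule_tac mult_nonneg_nonneg) auto
  then show "0 \<le> excess_ratio B k * ((log_slope k)\<^sup>2 + ?d)"
    by (rule mult_nonneg_nonneg[OF less_imp_le[OF excess_ratio_pos[OF \<open>0 < k\<close>]]
          add_nonneg_nonneg[OF zero_le_power2]])
qed simp

end


section \<open>The minimiser along the ray\<close>

text \<open>Left of \<open>1/2\<close> both summands exceed their values at \<open>1/2\<close>, and right of \<open>1\<close> those at \<open>1\<close>. On
  the interval in between the sum is strictly convex. At \<open>1\<close> the first summand is stationary, while
  convexity of \<open>R\<close> makes the second one drop at a linear rate to the left; at \<open>1/2\<close> the roles are
  exchanged, since \<open>k\<^sup>2 - k\<close> is stationary there.\<close>

lemma unique_minimizer_between:
  fixes p R :: "real \<Rightarrow> real"
  assumes L: "0 < L" and D: "0 < D"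
    and p_dec: "\<And>x y. 0 < x \<Longrightarrow> x < y \<Longrightarrow> y \<le> 1 \<Longrightarrow> p y < p x"
    and p_inc: "\<And>x y. 1 \<le> x \<Longrightarrow> x < y \<Longrightarrow> p x < p y"
    and p_conv: "convex_on {1/2..1} p" and p_cont: "continuous_on {1/2..1} p"
    and p_stat: "(p has_real_derivative 0) (at 1)"
    and R_conv: "convex_on UNIV R" and R_mono: "strict_mono R"
  shows "\<exists>k\<in>{1/2<..<1}. \<forall>x>0. x \<noteq> k \<longrightarrow> L * p k + D * R (k\<^sup>2 - k) < L * p x + D * R (x\<^sup>2 - x)"
proof -
  define f where "f x = L * p x + D * R (x\<^sup>2 - x)" for x
  have "continuous_on UNIV R"
    using R_conv by (intro convex_on_continuous) auto
  then have "continuous_on {1/2..1} (\<lambda>x. R (x\<^sup>2 - x))"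
    by (rule continuous_on_compose2) (auto intro!: continuous_intros)
  then have "continuous_on {1/2..1} f"
    unfolding f_def by (intro continuous_intros p_cont)
  then obtain k where k: "k \<in> {1/2..1}" and min: "\<And>x. x \<in> {1/2..1} \<Longrightarrow> f k \<le> f x"
    using continuous_attains_inf[of "{1/2..1}" f] by (auto simp del: atLeastAtMost_iff)
  have mid: "f ((x + y) / 2) < (f x + f y) / 2" if "x \<in> {1/2..1}" "y \<in> {1/2..1}" "x \<noteq> y" for x y
  proof -
    have half: "(1 - 1/2) *\<^sub>R a + (1/2) *\<^sub>R b = (a + b) / 2" for a b :: real
      by (simp add: add_divide_distrib)
    have P: "p ((x + y) / 2) \<le> (p x + p y) / 2"
      using convex_onD[OF p_conv, of "1/2" x y, unfolded half] that by simp
    have "0 < (x - y)\<^sup>2"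
      using that by simp
    then have "((x + y) / 2)\<^sup>2 - (x + y) / 2 < ((x\<^sup>2 - x) + (y\<^sup>2 - y)) / 2"
      by (simp add: power2_eq_square field_simps)
    then have "R (((x + y) / 2)\<^sup>2 - (x + y) / 2) < R (((x\<^sup>2 - x) + (y\<^sup>2 - y)) / 2)"
      using R_mono by (simp add: strict_mono_less)
    also have "\<dots> \<le> (R (x\<^sup>2 - x) + R (y\<^sup>2 - y)) / 2"
      using convex_onD[OF R_conv, of "1/2" "x\<^sup>2 - x" "y\<^sup>2 - y", unfolded half] by simp
    finally have "D * R (((x + y) / 2)\<^sup>2 - (x + y) / 2) < D * ((R (x\<^sup>2 - x) + R (y\<^sup>2 - y)) / 2)"
      using D by simp
    moreover have "L * p ((x + y) / 2) \<le> L * ((p x + p y) / 2)"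
      using P L by simp
    ultimately have "f ((x + y) / 2) < L * ((p x + p y) / 2) + D * ((R (x\<^sup>2 - x) + R (y\<^sup>2 - y)) / 2)"
      unfolding f_def by linarith
    then show ?thesis
      by (simp add: f_def field_simps)
  qed
  have inner: "f k < f x" if x: "x \<in> {1/2..1}" "x \<noteq> k" for x
  proof (rule ccontr)
    assume "\<not> f k < f x"
    with min[OF x(1)] have "f x = f k"
      by simp
    moreover have "(x + k) / 2 \<in> {1/2..1}"
      using x k by auto
    ultimately show False
      using mid[OF x(1) k x(2)] min[of "(x + k) / 2"] by simp
  qed
  have left: "f k < f x" if "0 < x" "x < 1/2" for x
  proof -
    have "(1/2)\<^sup>2 - 1/2 < x\<^sup>2 - x"
    proof -
      have "0 < (x - 1/2)\<^sup>2"
        using that by simp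
      then show ?thesis
        by (simp add: power2_eq_square field_simps)
    qed
    then have "R ((1/2)\<^sup>2 - 1/2) < R (x\<^sup>2 - x)"
      using R_mono by (simp only: strict_mono_less)
    moreover have "p (1/2) < p x"
      using that by (intro p_dec) auto
    ultimately have "f (1/2) < f x"
      unfolding f_def using L D by (intro add_strict_mono mult_strict_left_mono)
    with min[of "1/2"] show ?thesis
      by simp
  qed
  have right: "f k < f x" if "1 < x" for x
  proof -
    have "1\<^sup>2 - 1 < x\<^sup>2 - x"
      using that by (simp add: power2_eq_square)
    then have "R (1\<^sup>2 - 1) < R (x\<^sup>2 - x)"
      using R_mono by (simp only: strict_mono_less)
    moreover have "p 1 < p x"
      using that by (intro p_inc) auto
    ultimately have "f 1 < f x"
      unfolding f_def using L D by (intro add_strict_mono mult_strict_left_mono)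
    with min[of 1] show ?thesis
      by simp
  qed
  define \<delta> where "\<delta> = R 0 - R (- (1/4))"
  have \<delta>: "0 < \<delta>"
    using R_mono by (simp add: \<delta>_def strict_mono_less)
  have chord: "R (- (t / 4)) \<le> R 0 - t * \<delta>" if "0 \<le> t" "t \<le> 1" for t
    using convex_onD[OF R_conv that, of 0 "- (1/4)"] by (simp add: \<delta>_def algebra_simps)
  have "k \<noteq> 1/2"
  proof
    assume k2: "k = 1/2"
    define \<eta> where "\<eta> = p (1/2) - p 1"
    have \<eta>: "0 < \<eta>"
      using p_dec[of "1/2" 1] by (simp add: \<eta>_def)
    \<comment> \<open>the gain is \<open>2 h L \<eta>\<close> and the loss \<open>4 h\<^sup>2 D \<delta>\<close>, so this step spends at most half of the gain\<close>
    define h where "h = min (1/2) (L * \<eta> / (4 * (D * \<delta>)))"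
    have h: "0 < h" "h \<le> 1/2"
      using L D \<delta> \<eta> by (auto simp: h_def)
    have "h \<le> L * \<eta> / (4 * (D * \<delta>))"
      by (simp add: h_def)
    then have hD: "4 * h * (D * \<delta>) \<le> L * \<eta>"
      using D \<delta> by (simp add: pos_le_divide_eq mult_ac)
    have "p (1/2 + h) \<le> p (1/2) - 2 * h * \<eta>"
      using convex_onD[OF p_conv, of "2 * h" "1/2" 1] h by (simp add: \<eta>_def algebra_simps)
    then have 1: "L * p (1/2 + h) \<le> L * p (1/2) - 2 * h * (L * \<eta>)"
      using mult_left_mono[of "p (1/2 + h)" "p (1/2) - 2 * h * \<eta>" L] L by (simp add: algebra_simps)
    have "(2 * h)\<^sup>2 \<le> 1"
      using h by (intro power_le_one) auto
    then have "R (- ((1 - (2 * h)\<^sup>2) / 4)) \<le> R 0 - (1 - (2 * h)\<^sup>2) * \<delta>"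
      by (intro chord) auto
    also have "- ((1 - (2 * h)\<^sup>2) / 4) = (1/2 + h)\<^sup>2 - (1/2 + h)"
      by (simp add: power2_eq_square field_simps)
    also have "R 0 - (1 - (2 * h)\<^sup>2) * \<delta> = R (- (1/4)) + (2 * h)\<^sup>2 * \<delta>"
      by (simp add: \<delta>_def algebra_simps)
    finally have "R ((1/2 + h)\<^sup>2 - (1/2 + h)) \<le> R (- (1/4)) + (2 * h)\<^sup>2 * \<delta>" .
    then have "D * R ((1/2 + h)\<^sup>2 - (1/2 + h)) \<le> D * (R (- (1/4)) + (2 * h)\<^sup>2 * \<delta>)"
      using D by simp
    also have "\<dots> = D * R ((1/2)\<^sup>2 - 1/2) + h * (4 * h * (D * \<delta>))"
      by (simp add: power2_eq_square algebra_simps)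
    also have "\<dots> \<le> D * R ((1/2)\<^sup>2 - 1/2) + h * (L * \<eta>)"
      using hD h by simp
    finally have 2: "D * R ((1/2 + h)\<^sup>2 - (1/2 + h)) \<le> D * R ((1/2)\<^sup>2 - 1/2) + h * (L * \<eta>)" .
    have "0 < h * (L * \<eta>)"
      using h L \<eta> by simp
    with 1 2 have "f (1/2 + h) < f (1/2)"
      unfolding f_def by linarith
    with min[of "1/2 + h"] h k2 show False
      by simp
  qed
  moreover have "k \<noteq> 1"
  proof
    assume k1: "k = 1"
    have "((\<lambda>h. (p (1 + h) - p 1) / h) \<longlongrightarrow> 0) (at 0)"
      using p_stat by (simp add: DERIV_def)
    moreover have "0 < D * \<delta> / L"
      using L D \<delta> by simp
    ultimately obtain s where s: "0 < s"
      and lim: "\<And>h. h \<noteq> 0 \<Longrightarrow> \<bar>h\<bar> < s \<Longrightarrow> \<bar>(p (1 + h) - p 1) / h\<bar> < D * \<delta> / L"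
      unfolding LIM_eq by (metis diff_zero real_norm_def)
    define h where "h = min (1/2) (s / 2)"
    have h: "0 < h" "h \<le> 1/2" "h < s"
      using s by (auto simp: h_def)
    have "\<bar>(p (1 - h) - p 1) / h\<bar> < D * \<delta> / L"
      using lim[of "- h"] h by simp
    then have "(p (1 - h) - p 1) / h < D * \<delta> / L"
      by linarith
    then have 1: "L * p (1 - h) < L * p 1 + h * (D * \<delta>)"
      using h L by (simp add: field_simps)
    \<comment> \<open>the chord bound at parameter \<open>2 h\<close> yields a gain of \<open>2 h D \<delta>\<close>, twice the loss admitted above\<close>
    have "(1 - h)\<^sup>2 - (1 - h) \<le> - (2 * h / 4)"
    proof -
      have "h * h \<le> h * (1/2)"
        using h by (intro mult_left_mono) auto
      then show ?thesis
        by (simp add: power2_eq_square algebra_simps)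
    qed
    then have "R ((1 - h)\<^sup>2 - (1 - h)) \<le> R (- (2 * h / 4))"
      using R_mono by (simp only: strict_mono_less_eq)
    also have "\<dots> \<le> R 0 - 2 * h * \<delta>"
      using h by (intro chord) auto
    finally have "D * R ((1 - h)\<^sup>2 - (1 - h)) \<le> D * (R 0 - 2 * h * \<delta>)"
      using D by simp
    then have 2: "D * R ((1 - h)\<^sup>2 - (1 - h)) \<le> D * R (1\<^sup>2 - 1) - 2 * (h * (D * \<delta>))"
      by (simp add: algebra_simps)
    have "0 < h * (D * \<delta>)"
      using h D \<delta> by simp
    with 1 2 have "f (1 - h) < f 1"
      unfolding f_def by linarith
    with min[of "1 - h"] h k1 show False
      by simp
  qed
  ultimately have "k \<in> {1/2<..<1}"
    using k by auto
  moreover have "f k < f x" if "0 < x" "x \<noteq> k" for x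
    using inner[of x] left[of x] right[of x] that by (cases "x < 1/2"; cases "1 < x") auto
  ultimately show ?thesis
    unfolding f_def by blast
qed

definition exp_time_integral :: "real \<Rightarrow> real \<Rightarrow> real" where
  "exp_time_integral T z = integral {0..T} (\<lambda>s. exp (2 * z * (T - s)))"

lemma exp_time_integral_convex: "convex_on UNIV (exp_time_integral T)"
proof (rule convex_onI)
  fix t x y :: real
  assume t: "0 < t" "t < 1"
  have int: "(\<lambda>s. exp (2 * z * (T - s))) integrable_on {0..T}" for z
    by (intro integrable_continuous_interval continuous_intros)
  have "exp_time_integral T ((1 - t) *\<^sub>R x + t *\<^sub>R y) \<le>
      integral {0..T} (\<lambda>s. (1 - t) * exp (2 * x * (T - s)) + t * exp (2 * y * (T - s)))"
    unfolding exp_time_integral_def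
  proof (rule integral_le)
    fix s
    show "exp (2 * ((1 - t) *\<^sub>R x + t *\<^sub>R y) * (T - s)) \<le> (1 - t) * exp (2 * x * (T - s)) + t * exp (2 * y * (T - s))"
      using convex_onD[OF exp_convex, of t "2 * x * (T - s)" "2 * y * (T - s)"] t
      by (simp add: algebra_simps)
  qed (intro integrable_continuous_interval continuous_intros)+
  also have "\<dots> = (1 - t) * exp_time_integral T x + t * exp_time_integral T y"
    unfolding exp_time_integral_def using int
    by (subst Henstock_Kurzweil_Integration.integral_add) (auto intro!: integrable_on_mult_right)
  finally show "exp_time_integral T ((1 - t) *\<^sub>R x + t *\<^sub>R y) \<le>
      (1 - t) * exp_time_integral T x + t * exp_time_integral T y" .
qed simp

lemma exp_time_integral_strict_mono:
  assumes "0 < T"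
  shows "strict_mono (exp_time_integral T)"
proof (rule strict_monoI)
  fix x y :: real
  assume "x < y"
  let ?g = "\<lambda>s. exp (2 * y * (T - s)) - exp (2 * x * (T - s))"
  have int: "(\<lambda>s. exp (2 * z * (T - s))) integrable_on {0..T}" for z
    by (intro integrable_continuous_interval continuous_intros)
  have nn: "0 \<le> ?g s" if "s \<in> {0..T}" for s
    using that \<open>x < y\<close> by (auto intro!: mult_right_mono)
  have cont: "continuous_on {0..T} ?g"
    by (intro continuous_intros)
  have "?g 0 \<noteq> 0"
    using assms \<open>x < y\<close> by simp
  then have "integral {0..T} ?g \<noteq> 0"
    using integral_eq_0_iff[OF cont assms nn] assms by auto
  moreover have "0 \<le> integral {0..T} ?g"
    using nn by (intro integral_nonneg integrable_continuous_interval cont) auto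
  moreover have "integral {0..T} ?g = exp_time_integral T y - exp_time_integral T x"
    unfolding exp_time_integral_def by (intro Henstock_Kurzweil_Integration.integral_diff int)
  ultimately show "exp_time_integral T x < exp_time_integral T y"
    by linarith
qed

section \<open>The terminal variance and its minimiser\<close>

lemma volatility_mult_feedback_mean:
  fixes \<sigma> :: "real ^ 'd ^ 'd"
  assumes "invertible \<sigma>"
  shows "\<sigma> *v (- (y *\<^sub>R (matrix_inv \<sigma> *v \<rho>))) = - (y *\<^sub>R \<rho>)"
proof -
  have "\<sigma> *v (matrix_inv \<sigma> *v \<rho>) = \<rho>"
    using assms by (simp add: matrix_vector_mul_assoc matrix_inv_works)
  moreover have "- (y *\<^sub>R (matrix_inv \<sigma> *v \<rho>)) = (- y) *\<^sub>R (matrix_inv \<sigma> *v \<rho>)"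
    by simp
  ultimately show ?thesis
    by (simp only: matrix_vector_mult_scaleR) simp
qed

text \<open>Since \<open>\<sigma>\<close> maps the mean of the control to \<open>- (x - w) \<rho>\<close>, the volatility cancels from the wealth
  dynamics.\<close>

lemma wealth_process_sde:
  fixes \<sigma> :: "real ^ 'd ^ 'd"
  assumes "invertible \<sigma>" and "0 < c"
    and "wealth_process M F T W c x\<^sub>0 l \<sigma> \<rho>_true \<rho> X"
  defines "w \<equiv> lagrange_multiplier T x\<^sub>0 l \<rho>_true \<rho>"
  shows "sde_solution M F T W x\<^sub>0 (\<lambda>t x. - (\<rho> \<bullet> \<rho>_true) * (x - w))
    (\<lambda>t x. sqrt ((\<rho> \<bullet> \<rho>) * (x - w)\<^sup>2 + c * CARD('d) / 2 * exp ((\<rho> \<bullet> \<rho>) * (T - t)))) X"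
proof -
  let ?\<pi> = "feedback_control T c \<sigma> \<rho> w"
  have pos: "0 < c / 2 * exp ((\<rho> \<bullet> \<rho>) * (T - t))" for t
    using assms(2) by simp
  have "exploratory_drift \<rho>_true \<sigma> (?\<pi> t x) = - (\<rho> \<bullet> \<rho>_true) * (x - w)" for t x
    unfolding feedback_control_def exploratory_drift_gaussian[OF assms(1) pos]
      volatility_mult_feedback_mean[OF assms(1)]
    by (simp add: inner_commute)
  moreover have "exploratory_diffusion \<sigma> (?\<pi> t x) =
      sqrt ((\<rho> \<bullet> \<rho>) * (x - w)\<^sup>2 + c * CARD('d) / 2 * exp ((\<rho> \<bullet> \<rho>) * (T - t)))" for t x
    unfolding feedback_control_def exploratory_diffusion_gaussian[OF assms(1) pos]
      volatility_mult_feedback_mean[OF assms(1)]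
    by (simp add: power2_eq_square mult_ac)
  ultimately show ?thesis
    using assms(3) unfolding wealth_process_def w_def by (simp add: Let_def)
qed

text \<open>The choice of the multiplier gives \<open>x\<^sub>0 - w = - (l - x\<^sub>0) exp (a T) / (exp (a T) - 1)\<close>, so the
  factor \<open>exp (- 2 a T)\<close> of both moments cancels in the first term.\<close>

lemma terminal_variance:
  fixes \<sigma> :: "real ^ 'd ^ 'd"
  assumes T: "0 < T" and c: "0 < c" and "invertible \<sigma>"
    and basis: "brownian_basis M F T W"
    and a: "0 < \<rho> \<bullet> \<rho>_true"
    and X: "wealth_process M F T W c x\<^sub>0 l \<sigma> \<rho>_true \<rho> X"
  shows "prob_space.variance M (X T) =
    (l - x\<^sub>0)\<^sup>2 * ((exp ((\<rho> \<bullet> \<rho>) * T) - 1) / (exp ((\<rho> \<bullet> \<rho>_true) * T) - 1)\<^sup>2) +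
    c * CARD('d) / 2 * exp_time_integral T (\<rho> \<bullet> \<rho> - \<rho> \<bullet> \<rho>_true)"
proof -
  interpret brownian_basis M F T W
    by (rule basis)
  define w where "w = lagrange_multiplier T x\<^sub>0 l \<rho>_true \<rho>"
  define \<alpha> where "\<alpha> = \<rho> \<bullet> \<rho>_true"
  define \<beta> where "\<beta> = \<rho> \<bullet> \<rho>"
  define D where "D = c * CARD('d) / 2"
  have \<alpha>: "0 < \<alpha>" and \<beta>: "0 < \<beta>" and D: "0 \<le> D"
    using a c by (auto simp: \<alpha>_def \<beta>_def D_def)
  have sde: "sde_solution M F T W x\<^sub>0 (\<lambda>t x. - \<alpha> * (x - w))
      (\<lambda>t x. sqrt (\<beta> * (x - w)\<^sup>2 + D * exp (\<beta> * (T - t)))) X"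
    using wealth_process_sde[OF assms(3) c X] by (simp add: w_def \<alpha>_def \<beta>_def D_def)
  have g: "continuous_on {0..T} (\<lambda>t. D * exp (\<beta> * (T - t)))"
    by (intro continuous_intros)
  note moments = linear_sde_moments[OF T \<beta> g _ sde]
  let ?Y = "\<lambda>\<omega>. X T \<omega> - w"
  have Y2: "integrable M (\<lambda>\<omega>. (?Y \<omega>)\<^sup>2)" and Ym: "?Y \<in> borel_measurable M"
    using moments(1) D by (auto simp: square_integrable_def)
  have Y: "integrable M ?Y"
    using square_integrable_imp_integrable[OF Ym] Y2 by (simp add: power2_eq_square)
  have X1: "integrable M (X T)"
    using Bochner_Integration.integrable_add[OF Y integrable_const[of w]] by simp
  have "variance (X T) = variance ?Y"
    using X1 by (simp add: prob_space)
  also have "\<dots> = expectation (\<lambda>\<omega>. (?Y \<omega>)\<^sup>2) - (expectation ?Y)\<^sup>2"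
    by (rule variance_eq[OF Y Y2])
  also have "\<dots> = exp ((\<beta> - 2 * \<alpha>) * T) *
      ((x\<^sub>0 - w)\<^sup>2 + integral {0..T} (\<lambda>s. exp (- (\<beta> - 2 * \<alpha>) * s) * (D * exp (\<beta> * (T - s))))) -
      (exp (- \<alpha> * T) * (x\<^sub>0 - w))\<^sup>2"
    using moments(2,3) D by simp
  also have "\<dots> = (x\<^sub>0 - w)\<^sup>2 * (exp ((\<beta> - 2 * \<alpha>) * T) - (exp (- \<alpha> * T))\<^sup>2) +
      exp ((\<beta> - 2 * \<alpha>) * T) * integral {0..T} (\<lambda>s. exp (- (\<beta> - 2 * \<alpha>) * s) * (D * exp (\<beta> * (T - s))))"
    unfolding power_mult_distrib by (simp add: algebra_simps)
  also have "exp ((\<beta> - 2 * \<alpha>) * T) * integral {0..T} (\<lambda>s. exp (- (\<beta> - 2 * \<alpha>) * s) * (D * exp (\<beta> * (T - s)))) =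
      D * exp_time_integral T (\<beta> - \<alpha>)"
  proof -
    have "exp ((\<beta> - 2 * \<alpha>) * T) * (exp (- (\<beta> - 2 * \<alpha>) * s) * (D * exp (\<beta> * (T - s)))) =
        D * exp (2 * (\<beta> - \<alpha>) * (T - s))" for s
      by (simp add: exp_add[symmetric] mult_ac) (simp add: algebra_simps)
    then show ?thesis
      unfolding exp_time_integral_def
      by (simp only: Henstock_Kurzweil_Integration.integral_mult_right[symmetric])
  qed
  also have "(x\<^sub>0 - w)\<^sup>2 * (exp ((\<beta> - 2 * \<alpha>) * T) - (exp (- \<alpha> * T))\<^sup>2) =
      (l - x\<^sub>0)\<^sup>2 * ((exp (\<beta> * T) - 1) / (exp (\<alpha> * T) - 1)\<^sup>2)"
  proof -
    define E where "E = exp (\<alpha> * T)"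
    have E: "1 < E"
      using \<alpha> T by (simp add: E_def)
    have "x\<^sub>0 - w = - ((l - x\<^sub>0) * E / (E - 1))"
      unfolding w_def lagrange_multiplier_def \<alpha>_def[symmetric] E_def[symmetric]
      using E by (simp add: field_simps)
    moreover have "exp ((\<beta> - 2 * \<alpha>) * T) = exp (\<beta> * T) / E\<^sup>2"
      by (simp add: E_def exp_double[symmetric] exp_diff[symmetric] algebra_simps)
    moreover have "exp (- \<alpha> * T) = 1 / E"
      by (simp add: E_def exp_minus inverse_eq_divide)
    ultimately show ?thesis
      using E by (simp add: E_def[symmetric] power_divide power_mult_distrib diff_divide_distrib[symmetric])
  qed
  finally show ?thesis
    by (simp add: \<alpha>_def \<beta>_def D_def)
qed

theorem proposition3:
  fixes M :: "'w measure" and F :: "real \<Rightarrow> 'w measure" and W :: "real \<Rightarrow> 'w \<Rightarrow> real"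
    and T c x\<^sub>0 l :: real
    and \<sigma> :: "real ^ 'd ^ 'd" and \<rho>_true :: "real ^ 'd"
    and X :: "real ^ 'd \<Rightarrow> real \<Rightarrow> 'w \<Rightarrow> real"
  assumes "0 < T" and "0 < c" and "l \<noteq> x\<^sub>0" and "invertible \<sigma>"
    and "risk_premium \<rho>_true"
    and "brownian_basis M F T W"
    and "\<And>\<rho>. risk_premium \<rho> \<Longrightarrow> wealth_process M F T W c x\<^sub>0 l \<sigma> \<rho>_true \<rho> (X \<rho>)"
  shows "\<exists>k\<in>{1/2<..<1}. \<forall>\<rho>.
    is_arg_min (\<lambda>\<rho>. prob_space.variance M (X \<rho> T)) risk_premium \<rho> \<longleftrightarrow> \<rho> = k *\<^sub>R \<rho>_true"
proof -
  let ?V = "\<lambda>\<rho>. prob_space.variance M (X \<rho> T)"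
  define \<theta> where "\<theta> = \<rho>_true \<bullet> \<rho>_true"
  define B where "B = \<theta> * T"
  define L where "L = (l - x\<^sub>0)\<^sup>2"
  define D where "D = c * CARD('d) / 2"
  define R where "R s = exp_time_integral T (s * \<theta>)" for s
  define f where "f k = L * excess_ratio B k + D * R (k\<^sup>2 - k)" for k
  have inner_pos: "0 < \<rho> \<bullet> \<rho>_true" if "risk_premium \<rho>" for \<rho> :: "real ^ 'd"
    using that assms(5) by (auto simp: risk_premium_def inner_vec_def intro!: sum_pos)
  have \<theta>: "0 < \<theta>"
    using inner_pos[OF assms(5)] by (simp add: \<theta>_def)
  have B: "0 < B" and L: "0 < L" and D: "0 < D"
    using \<theta> assms by (auto simp: B_def L_def D_def)
  have R_mono: "strict_mono R"
    using exp_time_integral_strict_mono[OF assms(1)] \<theta>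
    by (auto simp: R_def strict_mono_def)
  have R_conv: "convex_on UNIV R"
  proof (rule convex_onI)
    fix t x y :: real assume "0 < t" "t < 1"
    then show "R ((1 - t) *\<^sub>R x + t *\<^sub>R y) \<le> (1 - t) * R x + t * R y"
      using convex_onD[OF exp_time_integral_convex, of t "x * \<theta>" "y * \<theta>" T]
      by (simp add: R_def algebra_simps)
  qed simp
  have p_cont: "continuous_on {1/2..1} (excess_ratio B)"
    by (rule continuous_on_subset[OF excess_ratio_continuous[OF B]]) auto
  have "\<exists>k\<in>{1/2<..<1}. \<forall>x>0. x \<noteq> k \<longrightarrow>
      L * excess_ratio B k + D * R (k\<^sup>2 - k) < L * excess_ratio B x + D * R (x\<^sup>2 - x)"
    using L D excess_ratio_decreasing[OF B] excess_ratio_increasing[OF B] excess_ratio_convex[OF B]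
      p_cont excess_ratio_stationary[OF B] R_conv R_mono
    by (intro unique_minimizer_between) auto
  then obtain k where k: "1/2 < k" "k < 1" and min: "\<And>x. 0 < x \<Longrightarrow> x \<noteq> k \<Longrightarrow> f k < f x"
    unfolding f_def by auto
  have V: "?V \<rho> = L * ((exp ((\<rho> \<bullet> \<rho>) * T) - 1) / (exp ((\<rho> \<bullet> \<rho>_true) * T) - 1)\<^sup>2) +
      D * exp_time_integral T (\<rho> \<bullet> \<rho> - \<rho> \<bullet> \<rho>_true)" if "risk_premium \<rho>" for \<rho>
    unfolding L_def D_def
    by (rule terminal_variance[OF assms(1,2,4,6) inner_pos[OF that] assms(7)[OF that]])
  have ray: "risk_premium (x *\<^sub>R \<rho>_true)" if "0 < x" for x
    using that assms(5) by (simp add: risk_premium_def)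
  have V_ray: "?V (x *\<^sub>R \<rho>_true) = f x" if "0 < x" for x
  proof -
    have "(x *\<^sub>R \<rho>_true) \<bullet> (x *\<^sub>R \<rho>_true) * T = x\<^sup>2 * B" "(x *\<^sub>R \<rho>_true) \<bullet> \<rho>_true * T = x * B"
      "(x *\<^sub>R \<rho>_true) \<bullet> (x *\<^sub>R \<rho>_true) - (x *\<^sub>R \<rho>_true) \<bullet> \<rho>_true = (x\<^sup>2 - x) * \<theta>"
      by (simp_all add: B_def \<theta>_def power2_eq_square algebra_simps)
    then show ?thesis
      unfolding V[OF ray[OF that]] by (simp only: f_def excess_ratio_def R_def)
  qed
  \<comment> \<open>replacing \<open>\<rho>\<close> by its projection onto the ray keeps \<open>\<rho> \<bullet> \<rho>_true\<close> and lowers the norm\<close>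
  have V_proj: "?V ((\<rho> \<bullet> \<rho>_true / \<theta>) *\<^sub>R \<rho>_true) < ?V \<rho>"
    if \<rho>: "risk_premium \<rho>" and ne: "\<rho> \<noteq> (\<rho> \<bullet> \<rho>_true / \<theta>) *\<^sub>R \<rho>_true" for \<rho>
  proof -
    define x where "x = \<rho> \<bullet> \<rho>_true / \<theta>"
    let ?r = "x *\<^sub>R \<rho>_true"
    have x: "0 < x"
      using inner_pos[OF \<rho>] \<theta> by (simp add: x_def)
    have same: "?r \<bullet> \<rho>_true = \<rho> \<bullet> \<rho>_true"
      using \<theta> by (simp add: x_def \<theta>_def)
    have "0 < (\<rho> - ?r) \<bullet> (\<rho> - ?r)"
      using ne by (simp add: x_def)
    also have "(\<rho> - ?r) \<bullet> (\<rho> - ?r) = \<rho> \<bullet> \<rho> - ?r \<bullet> ?r"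
    proof -
      have "\<rho> \<bullet> ?r = ?r \<bullet> ?r"
        using same by (simp add: inner_commute)
      moreover have "(u - v) \<bullet> (u - v) = u \<bullet> u - 2 * (u \<bullet> v) + v \<bullet> v" for u v :: "real ^ 'd"
        by (simp add: inner_diff_left inner_diff_right inner_commute[of v u])
      ultimately show ?thesis
        by (simp only:)
    qed
    finally have less: "?r \<bullet> ?r < \<rho> \<bullet> \<rho>"
      by simp
    let ?E = "(exp ((\<rho> \<bullet> \<rho>_true) * T) - 1)\<^sup>2"
    have "0 < exp ((\<rho> \<bullet> \<rho>_true) * T) - 1"
      using inner_pos[OF \<rho>] assms(1) by simp
    then have "(exp ((?r \<bullet> ?r) * T) - 1) / ?E < (exp ((\<rho> \<bullet> \<rho>) * T) - 1) / ?E"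
      using less assms(1) by (intro divide_strict_right_mono) auto
    moreover have "exp_time_integral T (?r \<bullet> ?r - \<rho> \<bullet> \<rho>_true) < exp_time_integral T (\<rho> \<bullet> \<rho> - \<rho> \<bullet> \<rho>_true)"
      using exp_time_integral_strict_mono[OF assms(1)] less by (simp add: strict_mono_less)
    ultimately have "?V ?r < ?V \<rho>"
      unfolding V[OF ray[OF x]] V[OF \<rho>] same using L D
      by (intro add_strict_mono mult_strict_left_mono)
    then show ?thesis
      by (simp only: x_def)
  qed
  have best: "?V (k *\<^sub>R \<rho>_true) < ?V \<rho>" if \<rho>: "risk_premium \<rho>" and ne: "\<rho> \<noteq> k *\<^sub>R \<rho>_true" for \<rho>
  proof -
    define x where "x = \<rho> \<bullet> \<rho>_true / \<theta>"
    have x: "0 < x"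
      using inner_pos[OF \<rho>] \<theta> by (simp add: x_def)
    have a: "f k \<le> f x" "x \<noteq> k \<Longrightarrow> f k < f x"
      using min[OF x] by (cases "x = k"; force)+
    have b: "?V (x *\<^sub>R \<rho>_true) \<le> ?V \<rho>" "\<rho> \<noteq> x *\<^sub>R \<rho>_true \<Longrightarrow> ?V (x *\<^sub>R \<rho>_true) < ?V \<rho>"
      using V_proj[OF \<rho>] unfolding x_def[symmetric] by (cases "\<rho> = x *\<^sub>R \<rho>_true"; force)+
    show ?thesis
      using a b ne k V_ray[OF x] V_ray[of k] by (cases "x = k") auto
  qed
  have kpos: "0 < k"
    using k by simp
  show ?thesis
  proof (intro bexI allI iffI)
    fix \<rho>
    assume "is_arg_min ?V risk_premium \<rho>"
    then have "risk_premium \<rho>" "\<not> ?V (k *\<^sub>R \<rho>_true) < ?V \<rho>"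
      using ray[OF kpos] by (auto simp: is_arg_min_def)
    then show "\<rho> = k *\<^sub>R \<rho>_true"
      using best by blast
  next
    fix \<rho>
    assume "\<rho> = k *\<^sub>R \<rho>_true"
    then show "is_arg_min ?V risk_premium \<rho>"
      using ray[OF kpos] best unfolding is_arg_min_def by (metis less_asym)
  qed (use k in simp)
qed

end
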